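(* Let $\mathbb{P}$ be the cone of positive invertible operators on a Hilbert space $H$. For any $n\in\mathbb{N}$ and $\mu_1,\dots,\mu_n\in\mathcal{P}(\mathbb{P})$, $$\mathcal{H}(\mu_1,\dots,\mu_n)\le\Lambda(\mu_1,\dots,\mu_n)\le\mathcal{A}(\mu_1,\dots,\mu_n)$$ in the stochastic order on $\mathcal{P}(\mathbb{P})$.
   Context: $\mathbb{P}$ is the set of positive invertible bounded operators on a (general) Hilbert space $H$, with the operator norm topology and the Loewner order $A\le B$ iff $B-A$ is positive semidefinite. The Thompson metric $d_T(A,B)=\max\{\log M(A/B),\log M(B/A)\}$, $M(A/B)=\inf\{\lambda>0:A\le\lambda B\}$, is a complete metric on $\mathbb{P}$ inducing the norm topology. For a complete metric space $X$, $\mathcal{P}(X)$ is the set of $\tau$-additive Borel probability measures on $X$ ($\mu(U)=\sup_\alpha\mu(U_\alpha)$ for every directed union $U=\bigcup_\alpha U_\alpha$ of open sets); equivalently, those whose support has measure $1$, or those that are inner regular by compact sets; such measures have separable support. A subset $A\subseteq\mathbb{P}$ is an upper set if $x\in A$, $y\in\mathbb{P}$, $x\le y$ imply $y\in A$. The stochastic order on $\mathcal{P}(\mathbb{P})$: $\mu\le\nu$ if $\mu(U)\le\nu(U)$ for each open upper set $U\subseteq\mathbb{P}$. For $(A_1,\dots,A_n)\in\mathbb{P}^n$: $\mathcal{A}_n(A_1,\dots,A_n)=\frac1n\sum_{j=1}^nA_j$; $\mathcal{H}_n(A_1,\dots,A_n)=\bigl[\frac1n\sum_{j=1}^nA_j^{-1}\bigr]^{-1}$;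 and $\Lambda_n(A_1,\dots,A_n)$, the Karcher mean, is the unique $X\in\mathbb{P}$ solving the Karcher equation $\sum_{j=1}^n\log(X^{-1/2}A_jX^{-1/2})=0$ (existence and uniqueness are known). All three maps $\mathbb{P}^n\to\mathbb{P}$ are continuous. For $\mu_1,\dots,\mu_n\in\mathcal{P}(\mathbb{P})$ the product measure $\mu_1\times\cdots\times\mu_n$ is regarded as an element of $\mathcal{P}(\mathbb{P}^n)$ (it is concentrated on the separable product of the supports of the $\mu_j$). With $f_*\mu(B)=\mu(f^{-1}(B))$ the push-forward, define $\Lambda(\mu_1,\dots,\mu_n)=(\Lambda_n)_*(\mu_1\times\cdots\times\mu_n)$, $\mathcal{A}(\mu_1,\dots,\mu_n)=(\mathcal{A}_n)_*(\mu_1\times\cdots\times\mu_n)$, $\mathcal{H}(\mu_1,\dots,\mu_n)=(\mathcal{H}_n)_*(\mu_1\times\cdots\times\mu_n)$, all in $\mathcal{P}(\mathbb{P})$. *)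

theory Defs
  imports "HOL-Analysis.Analysis" "HOL-Probability.Probability_Measure"
begin

section \<open>Complex Hilbert spaces\<close>

text \<open>The inner product is linear in the first argument. The class \<open>real_inner\<close> supplies the
  underlying real inner product, hence the norm, and \<open>banach\<close> supplies completeness.\<close>

class chilbert_space = banach + real_inner +
  fixes scaleC :: "complex \<Rightarrow> 'a \<Rightarrow> 'a"
    and cinner :: "'a \<Rightarrow> 'a \<Rightarrow> complex"
  assumes scaleC_add_right: "scaleC c (x + y) = scaleC c x + scaleC c y"
    and scaleC_add_left: "scaleC (c + d) x = scaleC c x + scaleC d x"
    and scaleC_scaleC: "scaleC c (scaleC d x) = scaleC (c * d) x"
    and scaleC_of_real: "scaleC (complex_of_real r) x = scaleR r x"
    and cinner_commute: "cinner x y = cnj (cinner y x)"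
    and cinner_add_left: "cinner (x + y) z = cinner x z + cinner y z"
    and cinner_scaleC_left: "cinner (scaleC c x) y = c * cinner x y"
    and Re_cinner: "Re (cinner x y) = inner x y"

instantiation complex :: chilbert_space
begin

definition scaleC_complex :: "complex \<Rightarrow> complex \<Rightarrow> complex" where
  "scaleC_complex c x = c * x"

definition cinner_complex :: "complex \<Rightarrow> complex \<Rightarrow> complex" where
  "cinner_complex x y = x * cnj y"

instance
  by standard
    (simp_all add: scaleC_complex_def cinner_complex_def algebra_simps scaleR_conv_of_real
      inner_complex_def)

end


section \<open>Bounded operators and the cone of positive invertible operators\<close>

text \<open>Elements of \<open>'a \<Rightarrow>\<^sub>L 'a\<close> are the bounded real-linear operators with the
  operator norm; the bounded operators on the complex space are those that are complex-linear.\<close>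

definition clinear_op :: "('a::chilbert_space \<Rightarrow>\<^sub>L 'a) \<Rightarrow> bool" where
  "clinear_op A \<longleftrightarrow> (\<forall>c x. A (scaleC c x) = scaleC c (A x))"

definition selfadjoint_op :: "('a::chilbert_space \<Rightarrow>\<^sub>L 'a) \<Rightarrow> bool" where
  "selfadjoint_op A \<longleftrightarrow> clinear_op A \<and> (\<forall>x y. cinner (A x) y = cinner x (A y))"

text \<open>For selfadjoint \<open>A\<close> the number \<open>cinner (A x) x\<close> is real.\<close>

definition psd_op :: "('a::chilbert_space \<Rightarrow>\<^sub>L 'a) \<Rightarrow> bool" where
  "psd_op A \<longleftrightarrow> selfadjoint_op A \<and> (\<forall>x. 0 \<le> Re (cinner (A x) x))"

definition loewner_le :: "('a::chilbert_space \<Rightarrow>\<^sub>L 'a) \<Rightarrow> ('a \<Rightarrow>\<^sub>L 'a) \<Rightarrow> bool" where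
  "loewner_le A B \<longleftrightarrow> psd_op (B - A)"

definition is_inv_op :: "('a::chilbert_space \<Rightarrow>\<^sub>L 'a) \<Rightarrow> ('a \<Rightarrow>\<^sub>L 'a) \<Rightarrow> bool" where
  "is_inv_op A B \<longleftrightarrow> clinear_op B \<and> A o\<^sub>L B = id_blinfun \<and> B o\<^sub>L A = id_blinfun"

definition op_inv :: "('a::chilbert_space \<Rightarrow>\<^sub>L 'a) \<Rightarrow> ('a \<Rightarrow>\<^sub>L 'a)" where
  "op_inv A = (THE B. is_inv_op A B)"

definition pos_cone :: "('a::chilbert_space \<Rightarrow>\<^sub>L 'a) set" where
  "pos_cone = {A. psd_op A \<and> (\<exists>B. is_inv_op A B)}"

definition op_sqrt :: "('a::chilbert_space \<Rightarrow>\<^sub>L 'a) \<Rightarrow> ('a \<Rightarrow>\<^sub>L 'a)" where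
  "op_sqrt A = (THE S. psd_op S \<and> S o\<^sub>L S = A)"

text \<open>The type \<open>'a \<Rightarrow>\<^sub>L 'a\<close> is not an instance of the Banach algebra classes
  (the zero space has \<open>norm id_blinfun = 0\<close>), so the exponential series is written out.\<close>

definition op_exp :: "('a::chilbert_space \<Rightarrow>\<^sub>L 'a) \<Rightarrow> ('a \<Rightarrow>\<^sub>L 'a)" where
  "op_exp A = (\<Sum>k. (1 / fact k) *\<^sub>R (((\<lambda>T. A o\<^sub>L T) ^^ k) id_blinfun))"

text \<open>The exponential is a bijection from the selfadjoint operators onto \<open>pos_cone\<close>; the
  logarithm is its inverse.\<close>

definition op_log :: "('a::chilbert_space \<Rightarrow>\<^sub>L 'a) \<Rightarrow> ('a \<Rightarrow>\<^sub>L 'a)" where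
  "op_log A = (THE L. selfadjoint_op L \<and> op_exp L = A)"


section \<open>The three means of an n-tuple\<close>

text \<open>An \<open>n\<close>-tuple is a function restricted to the index set \<open>{..<n}\<close>.\<close>

definition arith_mean :: "nat \<Rightarrow> (nat \<Rightarrow> ('a::chilbert_space \<Rightarrow>\<^sub>L 'a)) \<Rightarrow> ('a \<Rightarrow>\<^sub>L 'a)" where
  "arith_mean n A = (1 / real n) *\<^sub>R (\<Sum>j<n. A j)"

definition harm_mean :: "nat \<Rightarrow> (nat \<Rightarrow> ('a::chilbert_space \<Rightarrow>\<^sub>L 'a)) \<Rightarrow> ('a \<Rightarrow>\<^sub>L 'a)" where
  "harm_mean n A = op_inv ((1 / real n) *\<^sub>R (\<Sum>j<n. op_inv (A j)))"

definition karcher_mean :: "nat \<Rightarrow> (nat \<Rightarrow> ('a::chilbert_space \<Rightarrow>\<^sub>L 'a)) \<Rightarrow> ('a \<Rightarrow>\<^sub>L 'a)" where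
  "karcher_mean n A = (THE X. X \<in> pos_cone \<and>
     (\<Sum>j<n. op_log (op_inv (op_sqrt X) o\<^sub>L A j o\<^sub>L op_inv (op_sqrt X))) = 0)"


section \<open>Tau-additive Borel probability measures\<close>

definition borel_of :: "'b topology \<Rightarrow> 'b measure" where
  "borel_of X = sigma (topspace X) {U. openin X U}"

definition tau_additive :: "'b topology \<Rightarrow> 'b measure \<Rightarrow> bool" where
  "tau_additive X \<mu> \<longleftrightarrow>
     (\<forall>\<U>. \<U> \<noteq> {} \<and> (\<forall>U\<in>\<U>. openin X U) \<and> (\<forall>U\<in>\<U>. \<forall>V\<in>\<U>. \<exists>W\<in>\<U>. U \<union> V \<subseteq> W) \<longrightarrow>
        emeasure \<mu> (\<Union>\<U>) = (SUP U\<in>\<U>. emeasure \<mu> U))"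

definition tau_prob :: "'b topology \<Rightarrow> 'b measure set" where
  "tau_prob X = {\<mu>. space \<mu> = topspace X \<and> sets \<mu> = sets (borel_of X) \<and> prob_space \<mu> \<and>
     tau_additive X \<mu>}"

definition supp :: "'b topology \<Rightarrow> 'b measure \<Rightarrow> 'b set" where
  "supp X \<mu> = {x \<in> topspace X. \<forall>U. openin X U \<and> x \<in> U \<longrightarrow> emeasure \<mu> U > 0}"

text \<open>For nonseparable \<open>X\<close> the product sigma-algebra of \<open>PiM\<close> can be strictly smaller than the
  Borel sigma-algebra of the power of \<open>X\<close>, so \<open>PiM {..<n} \<mu>\<close> itself need not be a Borel measure.
  It is concentrated on the product \<open>S\<close> of the supports. For tau-additive \<open>\<mu> i\<close> on a metrizable \<open>X\<close>,
  \<open>S\<close> is separable, so \<open>B \<inter> S\<close> lies in the product sigma-algebra for every Borel set \<open>B\<close>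
  of the power. This gives the tau-additive Borel measure extending \<open>PiM {..<n} \<mu>\<close>.\<close>

definition tau_product :: "'b topology \<Rightarrow> nat \<Rightarrow> (nat \<Rightarrow> 'b measure) \<Rightarrow> (nat \<Rightarrow> 'b) measure" where
  "tau_product X n \<mu> =
     measure_of (\<Pi>\<^sub>E i\<in>{..<n}. topspace X) {U. openin (product_topology (\<lambda>_. X) {..<n}) U}
       (\<lambda>B. emeasure (PiM {..<n} \<mu>) (B \<inter> (\<Pi>\<^sub>E i\<in>{..<n}. supp X (\<mu> i))))"


section \<open>Stochastic order and means of measures on the cone\<close>

definition pos_top :: "('a::chilbert_space \<Rightarrow>\<^sub>L 'a) topology" where
  "pos_top = top_of_set pos_cone"

definition upper_set :: "('a::chilbert_space \<Rightarrow>\<^sub>L 'a) set \<Rightarrow> bool" where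
  "upper_set U \<longleftrightarrow> U \<subseteq> pos_cone \<and> (\<forall>x\<in>U. \<forall>y\<in>pos_cone. loewner_le x y \<longrightarrow> y \<in> U)"

definition stoch_le ::
  "('a::chilbert_space \<Rightarrow>\<^sub>L 'a) measure \<Rightarrow> ('a \<Rightarrow>\<^sub>L 'a) measure \<Rightarrow> bool" (infix "\<le>\<^sub>s\<^sub>t" 50)
where
  "\<mu> \<le>\<^sub>s\<^sub>t \<nu> \<longleftrightarrow> \<mu> \<in> tau_prob pos_top \<and> \<nu> \<in> tau_prob pos_top \<and>
     (\<forall>U. openin pos_top U \<and> upper_set U \<longrightarrow> emeasure \<mu> U \<le> emeasure \<nu> U)"

definition arith_measure ::
  "nat \<Rightarrow> (nat \<Rightarrow> ('a::chilbert_space \<Rightarrow>\<^sub>L 'a) measure) \<Rightarrow> ('a \<Rightarrow>\<^sub>L 'a) measure" where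
  "arith_measure n \<mu> = distr (tau_product pos_top n \<mu>) (borel_of pos_top) (arith_mean n)"

definition harm_measure ::
  "nat \<Rightarrow> (nat \<Rightarrow> ('a::chilbert_space \<Rightarrow>\<^sub>L 'a) measure) \<Rightarrow> ('a \<Rightarrow>\<^sub>L 'a) measure" where
  "harm_measure n \<mu> = distr (tau_product pos_top n \<mu>) (borel_of pos_top) (harm_mean n)"

definition karcher_measure ::
  "nat \<Rightarrow> (nat \<Rightarrow> ('a::chilbert_space \<Rightarrow>\<^sub>L 'a) measure) \<Rightarrow> ('a \<Rightarrow>\<^sub>L 'a) measure" where
  "karcher_measure n \<mu> = distr (tau_product pos_top n \<mu>) (borel_of pos_top) (karcher_mean n)"

end

theory Submission
  imports Defs "HOL-Probability.Infinite_Product_Measure"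
begin

text \<open>The weighted geometric mean \<open>X #\<^sub>t A = X\<^sup>1\<^sup>/\<^sup>2 (X\<^sup>-\<^sup>1\<^sup>/\<^sup>2 A X\<^sup>-\<^sup>1\<^sup>/\<^sup>2)\<^sup>t X\<^sup>1\<^sup>/\<^sup>2\<close> is used only for
  \<open>t = 2\<^sup>-\<^sup>k\<close>, where it is an iterated solution of the Riccati equation \<open>G X\<^sup>-\<^sup>1 G = A\<close>; monotonicity of
  the square root makes it monotone, and a contraction in \<open>X\<close> with factor \<open>1 - t\<close> for the Thompson
  metric. Write \<open>T\<^sub>t(X)\<close> for the arithmetic mean of the \<open>X #\<^sub>t A\<^sub>j\<close>. The quotient \<open>(T\<^sub>t(X) - X) / t\<close>
  decreases to the (conjugated) Karcher expression as \<open>t \<rightarrow> 0\<close>, with an error \<open>O(t)\<close> in norm. Hence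
  approximate fixed points of \<open>T\<^sub>t\<close> are norm Cauchy and converge to a solution of the Karcher equation,
  and comparing two solutions through \<open>T\<^sub>t\<close> shows uniqueness and that \<open>A\<^sub>j \<le> e\<^sup>r B\<^sub>j\<close> for all \<open>j\<close> implies
  \<open>\<Lambda>(A) \<le> e\<^sup>r \<Lambda>(B)\<close>; in particular the Karcher mean is continuous. The bounds
  \<open>1 - z\<^sup>-\<^sup>1 \<le> log z \<le> z - 1\<close>, inserted in the Karcher equation, give \<open>\<H>\<^sub>n \<le> \<Lambda>\<^sub>n \<le> \<A>\<^sub>n\<close> pointwise, so
  the preimages of an upper set under the three means are nested.\<close>

section \<open>Selfadjoint operators and the quadratic-form order\<close>

text \<open>The logarithm is given only as an inverse of the exponential series, and no spectral
  theorem is invoked: everything is built on positive square roots, which come from a fixed point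
  argument. This is why the weights are dyadic and why \<open>op_log Z\<close> is reached as the
  norm limit of \<open>(Z^t - 1) / t\<close>; both the monotonicity and the rate of these quotients
  come from expanding a single square. In infinite dimension no compactness produces a solution of
  the Karcher equation, so existence rests on completeness together with explicit rates. The
  decisive count is this: \<open>T_t\<close> contracts only with gap \<open>t\<close>, so a defect
  \<open>d\<close> in \<open>X <= e^d T_t(X)\<close> costs \<open>d / t\<close> when two operators
  are compared; defects of order \<open>t^2\<close> therefore leave an error \<open>O(t)\<close>,
  which vanishes in the limit. On the measure side, tau-additivity is used twice: it makes the
  supports separable and of full measure, and the resulting Lindeloef property of their product
  yields tau-additivity of the product measure. Continuity of the means carries this over to the
  push-forwards.\<close>

lemma inner_scaleC: "inner (scaleC c x) (scaleC c y) = (cmod c)\<^sup>2 * inner (x::'a::chilbert_space) y"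
proof -
  have "cinner (scaleC c x) (scaleC c y) = c * cnj c * cinner x y"
    by (metis (no_types, lifting) cinner_commute cinner_scaleC_left complex_cnj_cnj complex_cnj_mult mult.assoc)
  also have "c * cnj c = complex_of_real ((cmod c)\<^sup>2)"
    by (metis complex_norm_square)
  finally show ?thesis
    by (simp flip: Re_cinner)
qed

lemma bounded_linear_scaleC: "bounded_linear (scaleC c :: 'a::chilbert_space \<Rightarrow> 'a)"
proof (rule bounded_linear_intro[where K = "cmod c"])
  fix x y :: 'a and r :: real
  show "scaleC c (x + y) = scaleC c x + scaleC c y" by (rule scaleC_add_right)
  show "scaleC c (r *\<^sub>R x) = r *\<^sub>R scaleC c x"
    by (metis mult.commute scaleC_of_real scaleC_scaleC)
  have "norm (scaleC c x) = cmod c * norm x"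
    by (simp add: norm_eq_sqrt_inner inner_scaleC real_sqrt_mult)
  then show "norm (scaleC c x) \<le> norm x * cmod c" by simp
qed

text \<open>The imaginary part is read off after rotating one argument by \<open>\<i>\<close>, so
  that statements about the complex form reduce to the real inner product.\<close>

lemma cinner_eq: "cinner x (y::'a::chilbert_space) = Complex (inner x y) (- inner (scaleC \<i> x) y)"
proof -
  have "Re (cinner (scaleC \<i> x) y) = - Im (cinner x y)"
    by (simp add: cinner_scaleC_left)
  then show ?thesis by (simp add: complex_eq_iff Re_cinner)
qed

text \<open>Complex linearity moves \<open>\<i>\<close> through \<open>A\<close>, so symmetry of the
  real form forces symmetry of the imaginary part. This allows all later computations to use
  \<open>inner\<close> alone.\<close>

lemma selfadjoint_iff:
  "selfadjoint_op A \<longleftrightarrow> clinear_op A \<and> (\<forall>x y. inner (A x) y = inner x (A y))"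
proof
  assume "selfadjoint_op A"
  then show "clinear_op A \<and> (\<forall>x y. inner (A x) y = inner x (A y))"
    unfolding selfadjoint_op_def by (metis Re_cinner)
next
  assume *: "clinear_op A \<and> (\<forall>x y. inner (A x) y = inner x (A y))"
  then have "scaleC \<i> (A x) = A (scaleC \<i> x)" for x
    by (simp add: clinear_op_def)
  with * show "selfadjoint_op A"
    by (simp add: selfadjoint_op_def cinner_eq)
qed

lemma sa_sym: "selfadjoint_op A \<Longrightarrow> inner (A x) y = inner x (A y)" for A :: "'a::chilbert_space \<Rightarrow>\<^sub>L 'a"
  by (simp add: selfadjoint_iff)

lemma clinear_ops:
  "clinear_op A \<Longrightarrow> clinear_op B \<Longrightarrow> clinear_op (A + B)"
  "clinear_op A \<Longrightarrow> clinear_op B \<Longrightarrow> clinear_op (A - B)"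
  "clinear_op A \<Longrightarrow> clinear_op (r *\<^sub>R A)"
  "clinear_op A \<Longrightarrow> clinear_op B \<Longrightarrow> clinear_op (A o\<^sub>L B)"
  "clinear_op id_blinfun" "clinear_op 0"
  by (auto simp: clinear_op_def blinfun.bilinear_simps
      bounded_linear.linear[OF bounded_linear_scaleC, THEN linear_add]
      bounded_linear.linear[OF bounded_linear_scaleC, THEN linear_diff]
      bounded_linear.linear[OF bounded_linear_scaleC, THEN linear_scale]
      bounded_linear.linear[OF bounded_linear_scaleC, THEN linear_0])

lemma sa_ops:
  "selfadjoint_op A \<Longrightarrow> selfadjoint_op B \<Longrightarrow> selfadjoint_op (A + B)"
  "selfadjoint_op A \<Longrightarrow> selfadjoint_op B \<Longrightarrow> selfadjoint_op (A - B)"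
  "selfadjoint_op A \<Longrightarrow> selfadjoint_op (r *\<^sub>R A)"
  "selfadjoint_op id_blinfun" "selfadjoint_op 0"
  by (auto simp: selfadjoint_iff clinear_ops blinfun.bilinear_simps inner_simps)

lemma sa_square: "selfadjoint_op A \<Longrightarrow> selfadjoint_op (A o\<^sub>L A)"
  by (auto simp: selfadjoint_iff clinear_ops)

lemma sa_congruence: "selfadjoint_op A \<Longrightarrow> selfadjoint_op S \<Longrightarrow> selfadjoint_op (S o\<^sub>L A o\<^sub>L S)"
  by (auto simp: selfadjoint_iff clinear_ops)

lemma sa_sum: "(\<And>i. i \<in> I \<Longrightarrow> selfadjoint_op (A i)) \<Longrightarrow> selfadjoint_op (\<Sum>i\<in>I. A i)"
  by (induction I rule: infinite_finite_induct) (auto simp: sa_ops)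

lemma closed_clinear: "closed {A :: 'a::chilbert_space \<Rightarrow>\<^sub>L 'a. clinear_op A}"
  unfolding clinear_op_def
  by (intro closed_Collect_all closed_Collect_eq continuous_intros
      bounded_linear.continuous_on[OF bounded_linear_scaleC])

lemma closed_sa: "closed {A :: 'a::chilbert_space \<Rightarrow>\<^sub>L 'a. selfadjoint_op A}"
  unfolding selfadjoint_iff
  by (intro closed_Collect_conj closed_clinear closed_Collect_all closed_Collect_eq continuous_intros)

lemma sa_limit:
  assumes "\<And>k. selfadjoint_op (A k)" "A \<longlonglongrightarrow> L"
  shows "selfadjoint_op L"
  using closed_sequentially[OF closed_sa, of A L] assms by auto

lemma blinfun_eq_iff: "A = B \<longleftrightarrow> (\<forall>x. blinfun_apply A x = blinfun_apply B x)"
  by (auto intro: blinfun_eqI)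

lemmas blinfun_compose_bilinear_simps =
  bounded_bilinear.add_left[OF bounded_bilinear_blinfun_compose]
  bounded_bilinear.add_right[OF bounded_bilinear_blinfun_compose]
  bounded_bilinear.diff_left[OF bounded_bilinear_blinfun_compose]
  bounded_bilinear.diff_right[OF bounded_bilinear_blinfun_compose]
  bounded_bilinear.scaleR_left[OF bounded_bilinear_blinfun_compose]
  bounded_bilinear.scaleR_right[OF bounded_bilinear_blinfun_compose]

section \<open>Order by quadratic forms and the norm bounds it gives\<close>

text \<open>Selfadjointness is left out, so that order computations carry no side conditions; on
  selfadjoint operators this is \<open>loewner_le\<close>. Antisymmetry holds only there, see
  \<open>sa_eqI\<close>.\<close>

definition qle :: "('a::chilbert_space \<Rightarrow>\<^sub>L 'a) \<Rightarrow> ('a \<Rightarrow>\<^sub>L 'a) \<Rightarrow> bool" (infix "\<preceq>" 50)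
  where "A \<preceq> B \<longleftrightarrow> (\<forall>x. inner (A x) x \<le> inner (B x) x)"

lemma qleI: "(\<And>x. inner (A x) x \<le> inner (B x) x) \<Longrightarrow> A \<preceq> B"
  and qleD: "A \<preceq> B \<Longrightarrow> inner (A x) x \<le> inner (B x) x"
  for A B :: "'a::chilbert_space \<Rightarrow>\<^sub>L 'a"
  by (auto simp: qle_def)

lemma qle_refl [simp]: "A \<preceq> A" by (simp add: qle_def)

lemma qle_trans [trans]: "A \<preceq> B \<Longrightarrow> B \<preceq> C \<Longrightarrow> A \<preceq> C"
  unfolding qle_def by (meson order_trans)

lemma qle_add: "A \<preceq> B \<Longrightarrow> C \<preceq> D \<Longrightarrow> A + C \<preceq> B + D"
  unfolding qle_def by (simp add: blinfun.bilinear_simps inner_simps add_mono)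

lemma qle_scaleR: "A \<preceq> B \<Longrightarrow> 0 \<le> r \<Longrightarrow> r *\<^sub>R A \<preceq> r *\<^sub>R B"
  unfolding qle_def by (simp add: blinfun.bilinear_simps mult_left_mono)

lemma qle_scaleR_iff: "0 < r \<Longrightarrow> r *\<^sub>R A \<preceq> r *\<^sub>R B \<longleftrightarrow> A \<preceq> B"
  unfolding qle_def by (simp add: blinfun.bilinear_simps)

lemma qle_sum: "(\<And>i. i \<in> I \<Longrightarrow> A i \<preceq> B i) \<Longrightarrow> (\<Sum>i\<in>I. A i) \<preceq> (\<Sum>i\<in>I. B i)"
  by (induction I rule: infinite_finite_induct) (auto simp: qle_add)

lemma qle_congruence:
  assumes "A \<preceq> B" "selfadjoint_op S"
  shows "S o\<^sub>L A o\<^sub>L S \<preceq> S o\<^sub>L B o\<^sub>L S"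
  using assms by (simp add: qle_def sa_sym)

lemma psd_iff: "psd_op A \<longleftrightarrow> selfadjoint_op A \<and> 0 \<preceq> A"
  by (simp add: psd_op_def qle_def Re_cinner)

lemma loewner_iff:
  assumes "selfadjoint_op A" "selfadjoint_op B"
  shows "loewner_le A B \<longleftrightarrow> A \<preceq> B"
  using assms by (simp add: loewner_le_def psd_iff sa_ops qle_def blinfun.bilinear_simps inner_simps)

text \<open>Polarization expresses \<open>inner (A x) y\<close> by the quadratic form at
  \<open>x + y\<close> and \<open>x - y\<close>, and the parallelogram law adds up the two
  bounds.\<close>

lemma sa_norm_le:
  fixes A :: "'a::chilbert_space \<Rightarrow>\<^sub>L 'a"
  assumes A: "selfadjoint_op A" and le: "\<And>x. \<bar>inner (A x) x\<bar> \<le> c * (norm x)\<^sup>2" and c: "0 \<le> c"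
  shows "norm A \<le> c"
proof (rule norm_blinfun_bound[OF c])
  have pol: "4 * inner (A x) y \<le> 2 * c * ((norm x)\<^sup>2 + (norm y)\<^sup>2)" for x y
  proof -
    have "4 * inner (A x) y = inner (A (x + y)) (x + y) - inner (A (x - y)) (x - y)"
      using sa_sym[OF A, of y x]
      by (simp add: blinfun.bilinear_simps inner_simps inner_commute)
    also have "\<dots> \<le> c * (norm (x + y))\<^sup>2 + c * (norm (x - y))\<^sup>2"
      using le[of "x + y"] le[of "x - y"] by linarith
    also have "\<dots> = 2 * c * ((norm x)\<^sup>2 + (norm y)\<^sup>2)"
      by (simp add: power2_norm_eq_inner inner_simps inner_commute algebra_simps)
    finally show ?thesis .
  qed
  fix x
  show "norm (A x) \<le> c * norm x"
  proof (cases "norm (A x) = 0")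
    case False
    \<comment> \<open>The direction of \<open>A x\<close> maximizes the pairing; the length of
      \<open>x\<close> balances the two squares on the right of \<open>pol\<close>.\<close>
    define y where "y = (norm x / norm (A x)) *\<^sub>R A x"
    have "norm y = norm x" using False by (simp add: y_def)
    moreover have "inner (A x) y = norm x * norm (A x)"
      using False by (simp add: y_def power2_norm_eq_inner[symmetric] power2_eq_square)
    ultimately have *: "norm x * norm (A x) \<le> norm x * (c * norm x)"
      using pol[of x y] by (simp add: power2_eq_square algebra_simps)
    moreover have "norm x > 0"
      using False by (metis blinfun.zero_right norm_zero zero_less_norm_iff)
    ultimately show ?thesis by simp
  qed (simp add: c)
qed

lemma sa_eqI:
  assumes "selfadjoint_op A" "selfadjoint_op B" "A \<preceq> B" "B \<preceq> A"
  shows "A = B"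
proof -
  have "norm (A - B) \<le> 0"
    by (rule sa_norm_le)
      (use assms in \<open>auto simp: sa_ops qle_def blinfun.bilinear_simps inner_simps order_antisym\<close>)
  then show ?thesis by simp
qed

lemma inner_op_le: "inner (A x) x \<le> norm A * (norm x)\<^sup>2" for A :: "'a::chilbert_space \<Rightarrow>\<^sub>L 'a"
proof -
  have "inner (A x) x \<le> norm (A x) * norm x" by (rule norm_cauchy_schwarz)
  also have "\<dots> \<le> norm A * norm x * norm x" by (intro mult_right_mono norm_blinfun) auto
  finally show ?thesis by (simp add: power2_eq_square mult.assoc)
qed

lemma psd_norm_le: "psd_op A \<Longrightarrow> A \<preceq> c *\<^sub>R id_blinfun \<Longrightarrow> 0 \<le> c \<Longrightarrow> norm A \<le> c"
  by (rule sa_norm_le)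
    (auto simp: psd_iff qle_def blinfun.bilinear_simps power2_norm_eq_inner)

lemma sa_norm_between:
  assumes "selfadjoint_op A" "- c *\<^sub>R B \<preceq> A" "A \<preceq> c *\<^sub>R B" "0 \<le> c"
  shows "norm A \<le> c * norm B"
proof (rule sa_norm_le)
  fix x
  have "\<bar>inner (A x) x\<bar> \<le> c * inner (B x) x"
    using assms(2,3) by (auto simp: qle_def blinfun.bilinear_simps abs_le_iff minus_le_iff)
  also have "\<dots> \<le> c * (norm B * (norm x)\<^sup>2)"
    using assms(4) inner_op_le mult_left_mono by blast
  finally show "\<bar>inner (A x) x\<bar> \<le> c * norm B * (norm x)\<^sup>2" by (simp add: mult.assoc)
qed (use assms in auto)

lemma psd_Cauchy_Schwarz:
  fixes A :: "'a::chilbert_space \<Rightarrow>\<^sub>L 'a"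
  assumes "psd_op A"
  shows "(inner (A x) y)\<^sup>2 \<le> inner (A x) x * inner (A y) y"
proof -
  let ?a = "inner (A x) x" and ?b = "inner (A x) y" and ?c = "inner (A y) y"
  have sym: "inner (A y) x = ?b"
    using assms by (metis inner_commute psd_iff sa_sym)
  have pos: "0 \<le> inner (A z) z" for z
    using assms by (simp add: psd_iff qle_def)
  have q: "0 \<le> ?a - 2 * t * ?b + t\<^sup>2 * ?c" for t
    using pos[of "x - t *\<^sub>R y"] sym
    by (simp add: blinfun.bilinear_simps inner_simps power2_eq_square algebra_simps)
  show ?thesis
  proof (cases "?c = 0")
    case True
    have "?b = 0"
    proof (rule ccontr)
      assume "?b \<noteq> 0"
      \<comment> \<open>With \<open>?c = 0\<close> the quadratic is affine in \<open>t\<close>, and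
        at this \<open>t\<close> it takes the value -1.\<close>
      then show False using q[of "(?a + 1) / (2 * ?b)"] True by simp
    qed
    then show ?thesis using True by simp
  next
    case False
    then have c: "?c > 0" using pos[of y] by simp
    have "0 \<le> ?a - ?b\<^sup>2 / ?c"
      using q[of "?b / ?c"] c by (simp add: power2_eq_square)
    then show ?thesis using c by (simp add: field_simps)
  qed
qed

text \<open>Cauchy-Schwarz for the form of \<open>A\<close> at \<open>x\<close> and
  \<open>A x\<close>, after which one factor \<open>(norm (A x))\<^sup>2\<close> cancels.\<close>

lemma psd_norm_sq_le:
  fixes A :: "'a::chilbert_space \<Rightarrow>\<^sub>L 'a"
  assumes "psd_op A"
  shows "(norm (A x))\<^sup>2 \<le> norm A * inner (A x) x"
proof -
  have "((norm (A x))\<^sup>2)\<^sup>2 \<le> inner (A x) x * inner (A (A x)) (A x)"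
    using psd_Cauchy_Schwarz[OF assms, of x "A x"] by (simp add: power2_norm_eq_inner)
  also have "\<dots> \<le> inner (A x) x * (norm A * (norm (A x))\<^sup>2)"
    using assms by (intro mult_left_mono inner_op_le) (simp add: psd_iff qle_def)
  finally have *: "(norm (A x))\<^sup>2 * (norm (A x))\<^sup>2 \<le> (norm A * inner (A x) x) * (norm (A x))\<^sup>2"
    by (simp add: power2_eq_square mult_ac)
  show ?thesis
  proof (cases "A x = 0")
    case False
    then have "0 < (norm (A x))\<^sup>2" by simp
    with * show ?thesis by (rule mult_right_le_imp_le)
  qed auto
qed

section \<open>The cone: inverses and square roots\<close>

text \<open>The inverse is the fixed point of \<open>Y = 1 + B Y\<close>. Searching among the
  operators that commute with \<open>B\<close> makes the right inverse a left inverse as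
  well.\<close>

lemma contraction_inverse:
  fixes B :: "'a::chilbert_space \<Rightarrow>\<^sub>L 'a"
  assumes "clinear_op B" "norm B < 1"
  shows "\<exists>Y. is_inv_op (id_blinfun - B) Y"
proof -
  let ?K = "{Y. clinear_op Y \<and> Y o\<^sub>L B = B o\<^sub>L Y}"
  let ?f = "\<lambda>Y. id_blinfun + (B o\<^sub>L Y)"
  have "\<exists>!Y\<in>?K. ?f Y = Y"
  proof (rule Banach_fix[where c = "norm B"])
    show "complete ?K"
      unfolding complete_eq_closed
      by (intro closed_Collect_conj closed_clinear closed_Collect_eq continuous_intros)
    have "0 \<in> ?K" by (simp add: clinear_ops)
    then show "?K \<noteq> {}" by blast
    show "?f ` ?K \<subseteq> ?K"
      using assms(1) by (auto simp: clinear_ops blinfun_compose_bilinear_simps blinfun_eq_iff)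
        (auto simp: blinfun.bilinear_simps)
    show "dist (?f X) (?f Y) \<le> norm B * dist X Y" for X Y
      by (simp add: dist_norm bounded_bilinear.diff_right[OF bounded_bilinear_blinfun_compose, symmetric] norm_blinfun_compose)
  qed (use assms in auto)
  then obtain Y where Y: "clinear_op Y" "Y o\<^sub>L B = B o\<^sub>L Y" "id_blinfun + (B o\<^sub>L Y) = Y" by blast
  then have "is_inv_op (id_blinfun - B) Y"
    unfolding is_inv_op_def
    by (auto simp: blinfun_eq_iff blinfun.bilinear_simps) (metis add_diff_cancel_right')+
  then show ?thesis ..
qed

text \<open>Rescaling by at least the norm makes \<open>B\<close> positive, and the lower bound of
  \<open>A\<close> keeps \<open>B\<close> below \<open>1 - a / b\<close>. Inverses and square roots
  are both constructed from this normal form.\<close>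

lemma sa_contraction_form:
  fixes A :: "'a::chilbert_space \<Rightarrow>\<^sub>L 'a"
  assumes A: "selfadjoint_op A" and a: "0 < a" and low: "a *\<^sub>R id_blinfun \<preceq> A"
  obtains b B \<beta> where "0 < b" "selfadjoint_op B" "norm B \<le> \<beta>" "0 \<le> \<beta>" "\<beta> < 1"
    "A = b *\<^sub>R (id_blinfun - B)"
proof
  \<comment> \<open>The norm of \<open>A\<close> falls below \<open>a\<close> only on the zero
    space; the maximum covers that case too.\<close>
  let ?b = "max (norm A) a"
  have b: "0 < ?b" using a by simp
  then show "0 < ?b" .
  let ?B = "id_blinfun - (1 / ?b) *\<^sub>R A"
  show sa: "selfadjoint_op ?B" using A by (simp add: sa_ops)
  show "A = ?b *\<^sub>R (id_blinfun - ?B)" using b by simp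
  show "0 \<le> 1 - a / ?b" "1 - a / ?b < 1" using a b by (auto simp: divide_le_eq)
  show "norm ?B \<le> 1 - a / ?b"
  proof (rule psd_norm_le)
    have "inner (A x) x \<le> ?b * (norm x)\<^sup>2" for x
      using inner_op_le[of A x] by (smt (verit) mult_right_mono zero_le_power2)
    then have "0 \<preceq> ?B"
      using b by (auto simp: qle_def blinfun.bilinear_simps inner_simps power2_norm_eq_inner divide_le_eq mult.commute)
    then show "psd_op ?B" using sa by (simp add: psd_iff)
    have "a * inner x x / ?b \<le> inner (A x) x / ?b" for x
      using low b by (intro divide_right_mono) (auto simp: qle_def blinfun.bilinear_simps)
    then show "?B \<preceq> (1 - a / ?b) *\<^sub>R id_blinfun"
      by (auto simp: qle_def blinfun.bilinear_simps inner_simps algebra_simps)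
    show "0 \<le> 1 - a / ?b" using a b by (auto simp: divide_le_eq)
  qed
qed

lemma is_inv_unique: "is_inv_op A B \<Longrightarrow> is_inv_op A C \<Longrightarrow> B = C"
  unfolding is_inv_op_def blinfun_eq_iff by (metis blinfun_apply_blinfun_compose id_blinfun.rep_eq)

lemma is_inv_scaleR: "is_inv_op A B \<Longrightarrow> r \<noteq> 0 \<Longrightarrow> is_inv_op (r *\<^sub>R A) ((1 / r) *\<^sub>R B)"
  by (simp add: is_inv_op_def clinear_ops blinfun_compose_bilinear_simps(5,6))

lemma op_inv_eqI: "is_inv_op A B \<Longrightarrow> op_inv A = B"
  unfolding op_inv_def using is_inv_unique by (metis the_equality)

text \<open>A bounded inverse gives a lower bound on \<open>norm (A x)\<close>, which
  \<open>psd_norm_sq_le\<close> turns into one on the form. Conversely, an operator bounded below is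
  a multiple of \<open>1 - B\<close> with \<open>norm B < 1\<close>.\<close>

lemma pos_cone_iff:
  "A \<in> pos_cone \<longleftrightarrow> selfadjoint_op A \<and> (\<exists>a>0. a *\<^sub>R id_blinfun \<preceq> A)"
proof
  assume "A \<in> pos_cone"
  then obtain B where psd: "psd_op A" and B: "is_inv_op A B" by (auto simp: pos_cone_def)
  \<comment> \<open>The shifts by 1 keep the denominator positive on the zero space, where both
    norms vanish.\<close>
  define a where "a = 1 / ((norm B + 1)\<^sup>2 * (norm A + 1))"
  have nB: "norm B + 1 > 0" and nA: "norm A + 1 > 0" by (auto simp: add_nonneg_pos)
  have "a > 0" unfolding a_def using nA nB by simp
  moreover have "a *\<^sub>R id_blinfun \<preceq> A"
  proof (rule qleI)
    fix x
    have "x = B (A x)" using B by (metis is_inv_op_def blinfun_apply_blinfun_compose id_blinfun.rep_eq)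
    then have "norm x \<le> (norm B + 1) * norm (A x)"
      by (metis norm_blinfun norm_ge_zero mult_right_mono le_add_same_cancel1 order_trans zero_le_one)
    then have "(norm x)\<^sup>2 \<le> (norm B + 1)\<^sup>2 * (norm (A x))\<^sup>2"
      by (metis norm_ge_zero power_mono power_mult_distrib)
    also have "\<dots> \<le> (norm B + 1)\<^sup>2 * ((norm A + 1) * inner (A x) x)"
    proof (rule mult_left_mono)
      have "0 \<le> inner (A x) x" using psd by (simp add: psd_iff qle_def)
      then show "(norm (A x))\<^sup>2 \<le> (norm A + 1) * inner (A x) x"
        using psd_norm_sq_le[OF psd, of x] by (simp add: algebra_simps)
    qed simp
    finally show "inner ((a *\<^sub>R id_blinfun) x) x \<le> inner (A x) x"
      unfolding a_def using nA nB
      by (simp add: blinfun.bilinear_simps power2_norm_eq_inner divide_le_eq mult_ac)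
  qed
  ultimately show "selfadjoint_op A \<and> (\<exists>a>0. a *\<^sub>R id_blinfun \<preceq> A)"
    using psd by (auto simp: psd_iff)
next
  assume "selfadjoint_op A \<and> (\<exists>a>0. a *\<^sub>R id_blinfun \<preceq> A)"
  then obtain a where A: "selfadjoint_op A" and a: "0 < a" "a *\<^sub>R id_blinfun \<preceq> A" by auto
  then have "0 \<preceq> A"
    by (auto simp: qle_def blinfun.bilinear_simps) (meson inner_ge_zero less_imp_le mult_nonneg_nonneg order_trans)
  obtain b B \<beta> where B: "0 < b" "selfadjoint_op B" "norm B \<le> \<beta>" "\<beta> < 1"
    "A = b *\<^sub>R (id_blinfun - B)" using sa_contraction_form[OF A a] by metis
  obtain Y where "is_inv_op (id_blinfun - B) Y"
    using contraction_inverse[of B] B by (auto simp: selfadjoint_iff)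
  then have "is_inv_op A ((1 / b) *\<^sub>R Y)"
    using B by (auto intro: is_inv_scaleR)
  then show "A \<in> pos_cone" using A \<open>0 \<preceq> A\<close> by (auto simp: pos_cone_def psd_iff)
qed

lemma pos_sa: "A \<in> pos_cone \<Longrightarrow> selfadjoint_op A"
  and pos_psd: "A \<in> pos_cone \<Longrightarrow> psd_op A"
  and pos_ge_0: "A \<in> pos_cone \<Longrightarrow> 0 \<preceq> A"
  by (auto simp: pos_cone_def psd_iff)

lemma pos_mono: "A \<in> pos_cone \<Longrightarrow> selfadjoint_op B \<Longrightarrow> A \<preceq> B \<Longrightarrow> B \<in> pos_cone"
  unfolding pos_cone_iff using qle_trans by blast

lemma pos_scaleR: "A \<in> pos_cone \<Longrightarrow> 0 < r \<Longrightarrow> r *\<^sub>R A \<in> pos_cone"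
  unfolding pos_cone_iff
proof (elim conjE exE, intro conjI)
  fix a assume "0 < r" "0 < a" "a *\<^sub>R id_blinfun \<preceq> A"
  then show "\<exists>a>0. a *\<^sub>R id_blinfun \<preceq> r *\<^sub>R A"
    by (intro exI[of _ "r * a"]) (metis less_eq_real_def mult_pos_pos qle_scaleR scaleR_scaleR)
qed (simp add: sa_ops)

lemma pos_id: "id_blinfun \<in> pos_cone"
  unfolding pos_cone_iff by (auto simp: sa_ops intro!: exI[of _ 1])

lemma pos_add: "A \<in> pos_cone \<Longrightarrow> B \<in> pos_cone \<Longrightarrow> A + B \<in> pos_cone"
  by (rule pos_mono[of A]) (auto simp: pos_sa sa_ops dest: pos_ge_0 intro: qle_add[of A A 0 B, simplified])

lemma op_inv_is_inv: "A \<in> pos_cone \<Longrightarrow> is_inv_op A (op_inv A)"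
  unfolding pos_cone_def using op_inv_eqI by auto

lemma op_inv_apply [simp]:
  fixes A :: "'a::chilbert_space \<Rightarrow>\<^sub>L 'a"
  assumes "A \<in> pos_cone"
  shows "A (op_inv A x) = x" "op_inv A (A x) = x"
  using op_inv_is_inv[OF assms] unfolding is_inv_op_def
  by (metis blinfun_apply_blinfun_compose id_blinfun.rep_eq)+

lemma pos_op_inv [simp]:
  fixes A :: "'a::chilbert_space \<Rightarrow>\<^sub>L 'a"
  assumes "A \<in> pos_cone"
  shows "op_inv A \<in> pos_cone"
proof -
  have sym: "inner (op_inv A x) y = inner x (op_inv A y)" for x y
    using sa_sym[OF pos_sa[OF assms], of "op_inv A x" "op_inv A y"] assms by simp
  have "clinear_op (op_inv A)" using op_inv_is_inv[OF assms] by (simp add: is_inv_op_def)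
  then have "selfadjoint_op (op_inv A)" by (simp add: selfadjoint_iff sym)
  moreover have "0 \<preceq> op_inv A"
  proof (rule qleI)
    fix x
    have "0 \<le> inner (A (op_inv A x)) (op_inv A x)"
      using pos_ge_0[OF assms] by (simp add: qle_def)
    then show "inner ((0::'a \<Rightarrow>\<^sub>L 'a) x) x \<le> inner (op_inv A x) x" using assms by (simp add: inner_commute)
  qed
  moreover have "is_inv_op (op_inv A) A"
    using op_inv_is_inv[OF assms] pos_sa[OF assms] by (simp add: is_inv_op_def selfadjoint_iff)
  ultimately show ?thesis by (auto simp: pos_cone_def psd_iff)
qed

lemma op_inv_op_inv [simp]: "A \<in> pos_cone \<Longrightarrow> op_inv (op_inv A) = A"
  by (rule op_inv_eqI) (simp add: is_inv_op_def blinfun_eq_iff pos_sa selfadjoint_iff[THEN iffD1])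

lemma op_inv_scaleR:
  assumes "A \<in> pos_cone" "0 < r"
  shows "op_inv (r *\<^sub>R A) = (1 / r) *\<^sub>R op_inv A"
  using assms op_inv_is_inv[OF assms(1)] by (intro op_inv_eqI is_inv_scaleR) auto

text \<open>Cauchy-Schwarz for the form of \<open>A\<close> at the two preimages of \<open>x\<close>
  gives \<open>?b\<^sup>2 \<le> ?a * ?b\<close>, once \<open>A\<close> is replaced by the larger
  \<open>B\<close> in the second factor.\<close>

lemma op_inv_antimono:
  fixes A :: "'a::chilbert_space \<Rightarrow>\<^sub>L 'a"
  assumes "A \<in> pos_cone" "B \<in> pos_cone" "A \<preceq> B"
  shows "op_inv B \<preceq> op_inv A"
proof (rule qleI)
  fix x
  let ?b = "inner (op_inv B x) x" and ?a = "inner (op_inv A x) x"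
  have b: "0 \<le> ?b" and a: "0 \<le> ?a"
    using assms pos_ge_0[of "op_inv B"] pos_ge_0[of "op_inv A"] by (auto simp: qle_def)
  have "?b\<^sup>2 = (inner (A (op_inv A x)) (op_inv B x))\<^sup>2"
    using assms by (simp add: inner_commute)
  also have "\<dots> \<le> inner (A (op_inv A x)) (op_inv A x) * inner (A (op_inv B x)) (op_inv B x)"
    by (rule psd_Cauchy_Schwarz[OF pos_psd[OF assms(1)]])
  also have "\<dots> \<le> ?a * inner (B (op_inv B x)) (op_inv B x)"
    using assms a by (intro mult_mono qleD) (auto simp: inner_commute pos_psd psd_iff qle_def[of 0] dest: pos_ge_0)
  also have "\<dots> = ?a * ?b" using assms by (simp add: inner_commute)
  finally have "?b * ?b \<le> ?a * ?b" by (simp add: power2_eq_square)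
  with a b show "?b \<le> ?a" by (metis less_eq_real_def mult_right_le_imp_le)
qed

lemma pos_congruence:
  assumes A: "A \<in> pos_cone" and S: "S \<in> pos_cone"
  shows "S o\<^sub>L A o\<^sub>L S \<in> pos_cone"
proof -
  have "is_inv_op (S o\<^sub>L A o\<^sub>L S) (op_inv S o\<^sub>L op_inv A o\<^sub>L op_inv S)"
    using assms pos_sa[of "op_inv A"] pos_sa[of "op_inv S"]
    by (auto simp: is_inv_op_def blinfun_eq_iff selfadjoint_iff clinear_ops)
  moreover have "psd_op (S o\<^sub>L A o\<^sub>L S)"
    using assms qle_congruence[of 0 A S] by (auto simp: psd_iff sa_congruence pos_sa pos_ge_0)
  ultimately show ?thesis by (auto simp: pos_cone_def)
qed

section \<open>Positive square roots: existence, uniqueness, monotonicity\<close>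

text \<open>With \<open>A = b (1 - B)\<close> and \<open>S = sqrt b (1 - Y)\<close>, the equation
  \<open>S S = A\<close> becomes \<open>Y = (B + Y Y) / 2\<close>, a contraction with factor
  \<open>\<beta>\<close> on the ball of radius \<open>\<beta>\<close>. Commutation with the
  commutant of \<open>B\<close> is a closed condition preserved by the iteration, so it is built
  into the search set; uniqueness relies on it.\<close>

lemma sqrt_exists:
  fixes A :: "'a::chilbert_space \<Rightarrow>\<^sub>L 'a"
  assumes "A \<in> pos_cone"
  shows "\<exists>S\<in>pos_cone. S o\<^sub>L S = A \<and> (\<forall>T. T o\<^sub>L A = A o\<^sub>L T \<longrightarrow> T o\<^sub>L S = S o\<^sub>L T)"
proof -
  obtain a where A: "selfadjoint_op A" "0 < a" "a *\<^sub>R id_blinfun \<preceq> A"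
    using assms by (auto simp: pos_cone_iff)
  obtain b B \<beta> where B: "0 < b" "selfadjoint_op B" "norm B \<le> \<beta>" "0 \<le> \<beta>" "\<beta> < 1"
    "A = b *\<^sub>R (id_blinfun - B)" by (rule sa_contraction_form[OF A])
  let ?K = "{Y. selfadjoint_op Y \<and> norm Y \<le> \<beta> \<and> (\<forall>T. T o\<^sub>L B = B o\<^sub>L T \<longrightarrow> T o\<^sub>L Y = Y o\<^sub>L T)}"
  let ?f = "\<lambda>Y. (1/2) *\<^sub>R (B + (Y o\<^sub>L Y))"
  have "\<exists>!Y\<in>?K. ?f Y = Y"
  proof (rule Banach_fix[where c = \<beta>])
    have "?K = {Y. selfadjoint_op Y} \<inter> {Y. norm Y \<le> \<beta>} \<inter>
        (\<Inter>T\<in>{T. T o\<^sub>L B = B o\<^sub>L T}. {Y. T o\<^sub>L Y = Y o\<^sub>L T})" by blast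
    also have "closed \<dots>"
      by (intro closed_Int closed_sa closed_INT ballI closed_Collect_le closed_Collect_eq continuous_intros)
    finally show "complete ?K" unfolding complete_eq_closed .
    have "0 \<in> ?K" using B by (simp add: sa_ops)
    then show "?K \<noteq> {}" by blast
    show "?f ` ?K \<subseteq> ?K"
    proof safe
      fix Y assume Y: "selfadjoint_op Y" "norm Y \<le> \<beta>"
        "\<forall>T. T o\<^sub>L B = B o\<^sub>L T \<longrightarrow> T o\<^sub>L Y = Y o\<^sub>L T"
      show "selfadjoint_op (?f Y)" using Y B by (intro sa_ops sa_square)
      have "norm (Y o\<^sub>L Y) \<le> norm Y * norm Y" by (rule norm_blinfun_compose)
      also have "\<dots> \<le> 1 * \<beta>" using Y B by (intro mult_mono) auto
      finally show "norm (?f Y) \<le> \<beta>"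
        using norm_triangle_ineq[of B "Y o\<^sub>L Y"] B by simp
      show "T o\<^sub>L ?f Y = ?f Y o\<^sub>L T" if "T o\<^sub>L B = B o\<^sub>L T" for T
      proof -
        have 1: "T (B x) = B (T x)" for x using that by (metis blinfun_apply_blinfun_compose)
        have 2: "T (Y x) = Y (T x)" for x using that Y by (metis blinfun_apply_blinfun_compose)
        show ?thesis by (auto simp: blinfun_eq_iff blinfun.bilinear_simps 1 2)
      qed
    qed
    show "dist (?f X) (?f Y) \<le> \<beta> * dist X Y" if "X \<in> ?K" "Y \<in> ?K" for X Y
    proof -
      have "?f X - ?f Y = (1/2) *\<^sub>R ((X o\<^sub>L (X - Y)) + ((X - Y) o\<^sub>L Y))"
        by (simp add: blinfun_compose_bilinear_simps algebra_simps)
      also have "norm \<dots> \<le> (1/2) * (norm X * norm (X - Y) + norm (X - Y) * norm Y)"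
        using norm_triangle_ineq[of "X o\<^sub>L (X - Y)" "(X - Y) o\<^sub>L Y"]
          norm_blinfun_compose[of X "X - Y"] norm_blinfun_compose[of "X - Y" Y] by simp
      also have "\<dots> \<le> (1/2) * (\<beta> * norm (X - Y) + norm (X - Y) * \<beta>)"
        using that by (intro mult_left_mono add_mono mult_right_mono) auto
      finally show ?thesis by (simp add: dist_norm)
    qed
  qed (use B in auto)
  then obtain Y where Y: "selfadjoint_op Y" "norm Y \<le> \<beta>"
    "\<And>T. T o\<^sub>L B = B o\<^sub>L T \<Longrightarrow> T o\<^sub>L Y = Y o\<^sub>L T" "(1/2) *\<^sub>R (B + (Y o\<^sub>L Y)) = Y" by blast
  define S where "S = sqrt b *\<^sub>R (id_blinfun - Y)"
  have Beq: "B = 2 *\<^sub>R Y - (Y o\<^sub>L Y)"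
  proof -
    have "2 *\<^sub>R Y = 2 *\<^sub>R ((1/2) *\<^sub>R (B + (Y o\<^sub>L Y)))" using Y(4) by simp
    then show ?thesis by simp
  qed
  have "(id_blinfun - Y) o\<^sub>L (id_blinfun - Y) = id_blinfun - B"
    unfolding Beq by (auto simp: blinfun_eq_iff blinfun.bilinear_simps scaleR_2)
  then have "S o\<^sub>L S = A"
    using B(1) unfolding B(6) S_def by (simp add: blinfun_compose_bilinear_simps(5,6))
  moreover have "S \<in> pos_cone"
    unfolding pos_cone_iff
  proof (intro conjI exI[of _ "sqrt b * (1 - \<beta>)"] qleI)
    show "selfadjoint_op S" unfolding S_def using Y by (intro sa_ops)
    fix x
    have "inner (Y x) x \<le> \<beta> * (norm x)\<^sup>2"
      using inner_op_le[of Y x] Y(2) by (meson mult_right_mono order_trans zero_le_power2)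
    then have "(1 - \<beta>) * (norm x)\<^sup>2 \<le> inner ((id_blinfun - Y) x) x"
      by (simp add: blinfun.bilinear_simps inner_simps power2_norm_eq_inner algebra_simps)
    then show "inner (((sqrt b * (1 - \<beta>)) *\<^sub>R id_blinfun) x) x \<le> inner (S x) x"
      using B(1) by (simp add: S_def blinfun.scaleR_left power2_norm_eq_inner mult_left_mono mult.assoc)
  qed (use B in auto)
  moreover have "T o\<^sub>L S = S o\<^sub>L T" if "T o\<^sub>L A = A o\<^sub>L T" for T
  proof -
    have "T o\<^sub>L B = B o\<^sub>L T"
      using that B(1) unfolding B(6) by (auto simp: blinfun_eq_iff blinfun.bilinear_simps)
    then have 2: "T (Y x) = Y (T x)" for x using Y by (metis blinfun_apply_blinfun_compose)
    show ?thesis by (auto simp: S_def blinfun_eq_iff blinfun.bilinear_simps 2)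
  qed
  ultimately show ?thesis by blast
qed

text \<open>Any root \<open>S\<close> commutes with \<open>A\<close>, hence with the constructed
  root \<open>Q\<close>. So \<open>(S + Q) (S - Q) = 0\<close>, and \<open>S + Q\<close> is
  invertible because it dominates \<open>Q\<close>.\<close>

lemma psd_sqrt_unique:
  fixes A :: "'a::chilbert_space \<Rightarrow>\<^sub>L 'a"
  assumes "A \<in> pos_cone" "psd_op S" "S o\<^sub>L S = A" "psd_op R" "R o\<^sub>L R = A"
  shows "S = R"
proof -
  obtain Q where Q: "Q \<in> pos_cone" "Q o\<^sub>L Q = A"
    "\<And>T. T o\<^sub>L A = A o\<^sub>L T \<Longrightarrow> T o\<^sub>L Q = Q o\<^sub>L T" using sqrt_exists[OF assms(1)] by blast
  have "S = Q" if S: "psd_op S" "S o\<^sub>L S = A" for S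
  proof -
    have "S (A x) = A (S x)" for x using S by auto
    then have "S o\<^sub>L Q = Q o\<^sub>L S" by (intro Q) (simp add: blinfun_eq_iff)
    then have com: "S (Q x) = Q (S x)" for x by (metis blinfun_apply_blinfun_compose)
    have sq: "S (S x) = Q (Q x)" for x using S Q by (metis blinfun_apply_blinfun_compose)
    have "S + Q \<in> pos_cone"
      using qle_add[of 0 S Q Q] S Q(1) by (intro pos_mono[OF Q(1)]) (auto simp: psd_iff sa_ops pos_sa)
    moreover have "(S + Q) ((S - Q) x) = 0" for x
      by (simp add: blinfun.bilinear_simps com sq)
    ultimately have "(S - Q) x = 0" for x by (metis op_inv_apply(2) blinfun.zero_right)
    then show ?thesis by (simp add: blinfun_eq_iff blinfun.bilinear_simps)
  qed
  then show ?thesis using assms by metis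
qed

lemma op_sqrt_eqI: "A \<in> pos_cone \<Longrightarrow> psd_op S \<Longrightarrow> S o\<^sub>L S = A \<Longrightarrow> op_sqrt A = S"
  unfolding op_sqrt_def using psd_sqrt_unique by blast

lemma op_sqrt_pos [simp]: "A \<in> pos_cone \<Longrightarrow> op_sqrt A \<in> pos_cone"
  and op_sqrt_square: "A \<in> pos_cone \<Longrightarrow> op_sqrt A o\<^sub>L op_sqrt A = A"
  using sqrt_exists op_sqrt_eqI pos_psd by metis+

lemma op_sqrt_square_apply:
  fixes A :: "'a::chilbert_space \<Rightarrow>\<^sub>L 'a"
  shows "A \<in> pos_cone \<Longrightarrow> op_sqrt A (op_sqrt A x) = A x"
  by (metis blinfun_apply_blinfun_compose op_sqrt_square)

lemma op_sqrt_scaled_id: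
  assumes "0 < r"
  shows "op_sqrt (r *\<^sub>R id_blinfun :: 'a::chilbert_space \<Rightarrow>\<^sub>L 'a) = sqrt r *\<^sub>R id_blinfun"
  using assms by (intro op_sqrt_eqI pos_scaleR pos_id pos_psd)
    (auto simp: blinfun_eq_iff blinfun.bilinear_simps)

text \<open>If \<open>d\<close> is the least bound of \<open>S - R\<close> and \<open>d > 0\<close>, expanding \<open>S = R + d - E\<close> with
  \<open>E = d - (S - R)\<close> positive shows that \<open>E\<close> is bounded below, so that \<open>d\<close> can be decreased.\<close>

lemma psd_square_mono:
  fixes S R :: "'a::chilbert_space \<Rightarrow>\<^sub>L 'a"
  assumes S: "psd_op S" and R: "psd_op R" and le: "S o\<^sub>L S \<preceq> R o\<^sub>L R"
  shows "S \<preceq> R"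
proof -
  let ?D = "S - R"
  define M where "M = {d. 0 \<le> d \<and> ?D \<preceq> d *\<^sub>R id_blinfun}"
  have "norm ?D \<in> M"
    using inner_op_le[of ?D] by (auto simp: M_def qle_def blinfun.bilinear_simps power2_norm_eq_inner)
  moreover have "closed M"
    unfolding M_def qle_def
    by (intro closed_Collect_conj closed_Collect_le closed_Collect_all continuous_intros)
  moreover have bdd: "bdd_below M" by (auto simp: M_def)
  ultimately have "Inf M \<in> M" using closed_contains_Inf by blast
  define d where "d = Inf M"
  have d: "0 \<le> d" and D: "?D \<preceq> d *\<^sub>R id_blinfun" using \<open>Inf M \<in> M\<close> by (auto simp: M_def d_def)
  have "d = 0"
  proof (rule ccontr)
    assume "d \<noteq> 0"
    then have d: "d > 0" using d by simp
    define E where "E = d *\<^sub>R id_blinfun - ?D"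
    have E: "psd_op E"
      using D S R unfolding E_def
      by (auto simp: psd_iff sa_ops qle_def blinfun.bilinear_simps inner_simps)
    \<comment> \<open>This is the constant for which the expanded inequality reads
      \<open>\<kappa> * norm x \<le> norm (E x)\<close>, see \<open>low\<close>.\<close>
    define \<kappa> where "\<kappa> = d\<^sup>2 / (2 * (norm R + d))"
    have Rd: "norm R + d > 0" using d by (simp add: add_nonneg_pos)
    have \<kappa>: "\<kappa> > 0" unfolding \<kappa>_def using d Rd by simp
    have E1: "norm E + 1 > 0" by (simp add: add_nonneg_pos)
    have low: "\<kappa> * norm x \<le> norm (E x)" for x
    proof (cases "x = 0")
      case False
      have "S x = R x + d *\<^sub>R x - E x" by (simp add: E_def blinfun.bilinear_simps)
      moreover have "inner (S x) (S x) \<le> inner (R x) (R x)"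
        using qleD[OF le, of x] S R by (simp add: psd_iff sa_sym)
      ultimately have "inner (R x + d *\<^sub>R x - E x) (R x + d *\<^sub>R x - E x) \<le> inner (R x) (R x)"
        by simp
      then have "d\<^sup>2 * inner x x + inner (E x) (E x) + 2 * d * inner (R x) x
          \<le> 2 * inner (R x) (E x) + 2 * d * inner x (E x)"
        by (simp add: inner_simps inner_commute power2_eq_square algebra_simps)
      moreover have "0 \<le> inner (R x) x" using R by (simp add: psd_iff qle_def)
      moreover have "inner (R x) (E x) \<le> norm R * norm x * norm (E x)"
        by (meson mult_right_mono norm_blinfun norm_cauchy_schwarz norm_ge_zero order_trans)
      moreover have "d * inner x (E x) \<le> d * (norm x * norm (E x))"
        using d by (intro mult_left_mono norm_cauchy_schwarz) auto
      moreover have "0 \<le> inner (E x) (E x)" by simp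
      moreover have "0 \<le> 2 * d * inner (R x) x" using d \<open>0 \<le> inner (R x) x\<close> by simp
      ultimately have "d\<^sup>2 * (norm x)\<^sup>2 \<le> 2 * (norm R * norm x * norm (E x)) + 2 * (d * (norm x * norm (E x)))"
        unfolding power2_norm_eq_inner by linarith
      also have "\<dots> = norm x * (2 * (norm R + d) * norm (E x))" by (simp add: algebra_simps)
      finally have "norm x * (d\<^sup>2 * norm x) \<le> norm x * (2 * (norm R + d) * norm (E x))"
        by (simp add: power2_eq_square mult_ac)
      then have "d\<^sup>2 * norm x \<le> 2 * (norm R + d) * norm (E x)" using False by simp
      then show ?thesis using Rd by (simp add: \<kappa>_def field_simps)
    qed simp
    have "?D \<preceq> (d - \<kappa>\<^sup>2 / (norm E + 1)) *\<^sub>R id_blinfun"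
    proof (rule qleI)
      fix x
      have "(\<kappa> * norm x)\<^sup>2 \<le> (norm (E x))\<^sup>2" using low \<kappa> by (intro power_mono) auto
      also have "\<dots> \<le> norm E * inner (E x) x" by (rule psd_norm_sq_le[OF E])
      also have "\<dots> \<le> (norm E + 1) * inner (E x) x"
        using E by (intro mult_right_mono) (auto simp: psd_iff qle_def)
      finally have "\<kappa>\<^sup>2 / (norm E + 1) * inner x x \<le> inner (E x) x"
        using E1 by (simp add: power_mult_distrib power2_norm_eq_inner field_simps)
      then show "inner (?D x) x \<le> inner (((d - \<kappa>\<^sup>2 / (norm E + 1)) *\<^sub>R id_blinfun) x) x"
        unfolding E_def by (simp add: blinfun.bilinear_simps inner_simps algebra_simps)
    qed
    then have "?D \<preceq> max 0 (d - \<kappa>\<^sup>2 / (norm E + 1)) *\<^sub>R id_blinfun"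
      by (auto simp: qle_def blinfun.bilinear_simps)
        (smt (verit) inner_ge_zero mult_right_mono)
    then have "max 0 (d - \<kappa>\<^sup>2 / (norm E + 1)) \<in> M" by (simp add: M_def)
    then have "d \<le> max 0 (d - \<kappa>\<^sup>2 / (norm E + 1))" unfolding d_def using bdd by (rule cInf_lower)
    moreover have "\<kappa>\<^sup>2 / (norm E + 1) > 0" using \<kappa> E1 by simp
    ultimately show False using d by linarith
  qed
  with D show ?thesis by (simp add: qle_def blinfun.bilinear_simps inner_simps)
qed

lemma op_sqrt_mono: "A \<in> pos_cone \<Longrightarrow> B \<in> pos_cone \<Longrightarrow> A \<preceq> B \<Longrightarrow> op_sqrt A \<preceq> op_sqrt B"
  by (rule psd_square_mono) (auto simp: op_sqrt_square pos_psd)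

section \<open>Weighted geometric means for dyadic weights\<close>

text \<open>\<open>wroot k Z\<close> is the power of \<open>Z\<close> with exponent \<open>1 / 2 ^ k\<close>, and \<open>wgeo k X A\<close> is the weighted
  geometric mean \<open>X #\<^sub>t A\<close> for \<open>t = 1 / 2 ^ k\<close>.\<close>

definition wroot :: "nat \<Rightarrow> ('a::chilbert_space \<Rightarrow>\<^sub>L 'a) \<Rightarrow> ('a \<Rightarrow>\<^sub>L 'a)" where
  "wroot k = op_sqrt ^^ k"

definition rel :: "('a::chilbert_space \<Rightarrow>\<^sub>L 'a) \<Rightarrow> ('a \<Rightarrow>\<^sub>L 'a) \<Rightarrow> ('a \<Rightarrow>\<^sub>L 'a)" where
  "rel X A = op_inv (op_sqrt X) o\<^sub>L A o\<^sub>L op_inv (op_sqrt X)"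

definition wgeo :: "nat \<Rightarrow> ('a::chilbert_space \<Rightarrow>\<^sub>L 'a) \<Rightarrow> ('a \<Rightarrow>\<^sub>L 'a) \<Rightarrow> ('a \<Rightarrow>\<^sub>L 'a)" where
  "wgeo k X A = op_sqrt X o\<^sub>L wroot k (rel X A) o\<^sub>L op_sqrt X"

lemma wroot_0 [simp]: "wroot 0 Z = Z" and wroot_Suc: "wroot (Suc k) Z = op_sqrt (wroot k Z)"
  by (simp_all add: wroot_def)

lemma wroot_pos [simp]: "Z \<in> pos_cone \<Longrightarrow> wroot k Z \<in> pos_cone"
  by (induction k) (auto simp: wroot_Suc)

lemma wroot_Suc_square: "Z \<in> pos_cone \<Longrightarrow> wroot (Suc k) Z o\<^sub>L wroot (Suc k) Z = wroot k Z"
  by (simp add: wroot_Suc op_sqrt_square)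

lemma rel_pos [simp]: "X \<in> pos_cone \<Longrightarrow> A \<in> pos_cone \<Longrightarrow> rel X A \<in> pos_cone"
  by (simp add: rel_def pos_congruence)

lemma wgeo_pos [simp]: "X \<in> pos_cone \<Longrightarrow> A \<in> pos_cone \<Longrightarrow> wgeo k X A \<in> pos_cone"
  by (simp add: wgeo_def pos_congruence)

lemma wgeo_0 [simp]: "X \<in> pos_cone \<Longrightarrow> A \<in> pos_cone \<Longrightarrow> wgeo 0 X A = A"
  by (simp add: wgeo_def rel_def blinfun_eq_iff)

lemma op_inv_eq_sqrt:
  assumes "X \<in> pos_cone"
  shows "op_inv X = op_inv (op_sqrt X) o\<^sub>L op_inv (op_sqrt X)"
proof (rule op_inv_eqI)
  have "clinear_op (op_inv (op_sqrt X))"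
    using assms pos_sa[of "op_inv (op_sqrt X)"] by (simp add: selfadjoint_iff)
  then show "is_inv_op X (op_inv (op_sqrt X) o\<^sub>L op_inv (op_sqrt X))"
    using assms unfolding is_inv_op_def
    by (auto simp: blinfun_eq_iff clinear_ops op_sqrt_square_apply[OF assms, symmetric])
qed

text \<open>The inner square roots of \<open>X\<close> cancel against \<open>op_inv X\<close> and
  leave the square of \<open>wroot (Suc k)\<close>. Halving the weight thus amounts to one Riccati
  equation, which makes induction on \<open>k\<close> possible.\<close>

lemma wgeo_Riccati:
  assumes "X \<in> pos_cone" "A \<in> pos_cone"
  shows "wgeo (Suc k) X A o\<^sub>L op_inv X o\<^sub>L wgeo (Suc k) X A = wgeo k X A"
  using assms wroot_Suc_square[of "rel X A" k, symmetric]
  by (auto simp: wgeo_def op_inv_eq_sqrt[OF assms(1)] blinfun_eq_iff)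

text \<open>Passing from \<open>op_inv X\<close> to the smaller \<open>op_inv Y\<close> and
  conjugating by the inverse root of \<open>Y\<close> turns both sides into squares of positive
  operators, to which \<open>psd_square_mono\<close> applies.\<close>

lemma Riccati_mono:
  assumes pos: "X \<in> pos_cone" "Y \<in> pos_cone" "G \<in> pos_cone" "H \<in> pos_cone"
    and XY: "X \<preceq> Y" and le: "G o\<^sub>L op_inv X o\<^sub>L G \<preceq> H o\<^sub>L op_inv Y o\<^sub>L H"
  shows "G \<preceq> H"
proof -
  let ?V = "op_sqrt Y" and ?W = "op_inv (op_sqrt Y)"
  have V: "selfadjoint_op ?V" and W: "selfadjoint_op ?W" using pos by (auto simp: pos_sa)
  have "G o\<^sub>L op_inv Y o\<^sub>L G \<preceq> H o\<^sub>L op_inv Y o\<^sub>L H"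
    using qle_congruence[OF op_inv_antimono[OF pos(1,2) XY] pos_sa[OF pos(3)]] le by (rule qle_trans)
  from qle_congruence[OF this W]
  have "(?W o\<^sub>L G o\<^sub>L ?W) o\<^sub>L (?W o\<^sub>L G o\<^sub>L ?W) \<preceq> (?W o\<^sub>L H o\<^sub>L ?W) o\<^sub>L (?W o\<^sub>L H o\<^sub>L ?W)"
    using pos by (simp add: op_inv_eq_sqrt[OF pos(2)] qle_def)
  then have "?W o\<^sub>L G o\<^sub>L ?W \<preceq> ?W o\<^sub>L H o\<^sub>L ?W"
    by (rule psd_square_mono[OF pos_psd pos_psd, rotated 2]) (use pos in \<open>auto intro: pos_congruence\<close>)
  from qle_congruence[OF this V] show ?thesis using pos by (simp add: qle_def)
qed

text \<open>Monotonicity in \<open>A\<close> and contraction in \<open>X\<close> in one statement.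
  In the induction the new exponent \<open>?f\<close> is the average of \<open>s\<close> and the old
  exponent \<open>?e\<close>, as scaling the solution of a Riccati equation by \<open>exp ?f\<close>
  scales its right-hand side by \<open>exp (2 * ?f - s)\<close>.\<close>

lemma wgeo_mono:
  fixes X Y A B :: "'a::chilbert_space \<Rightarrow>\<^sub>L 'a"
  assumes pos: "X \<in> pos_cone" "Y \<in> pos_cone" "A \<in> pos_cone" "B \<in> pos_cone"
    and X: "X \<preceq> exp s *\<^sub>R Y" and A: "A \<preceq> exp r *\<^sub>R B"
  shows "wgeo k X A \<preceq> exp ((1 - 1 / 2 ^ k) * s + r / 2 ^ k) *\<^sub>R wgeo k Y B"
proof (induction k)
  case 0
  then show ?case using pos A by simp
next
  case (Suc k)
  let ?e = "(1 - 1 / 2 ^ k) * s + r / 2 ^ k"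
  let ?f = "(1 - 1 / 2 ^ Suc k) * s + r / 2 ^ Suc k"
  let ?H = "wgeo (Suc k) Y B"
  show ?case
  proof (rule Riccati_mono[of X "exp s *\<^sub>R Y"])
    have "2 * ?f = s + ?e" by (simp add: field_simps)
    then have f: "exp ?f * exp ?f = exp s * exp ?e"
      by (simp flip: exp_add mult_2)
    have "(exp ?f *\<^sub>R ?H) o\<^sub>L op_inv (exp s *\<^sub>R Y) o\<^sub>L (exp ?f *\<^sub>R ?H)
      = (exp ?f * exp ?f / exp s) *\<^sub>R (?H o\<^sub>L op_inv Y o\<^sub>L ?H)"
      using pos by (simp add: op_inv_scaleR blinfun_compose_bilinear_simps)
    also have "\<dots> = exp ?e *\<^sub>R wgeo k Y B"
      unfolding f using wgeo_Riccati[OF pos(2,4)] by simp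
    finally show "wgeo (Suc k) X A o\<^sub>L op_inv X o\<^sub>L wgeo (Suc k) X A
        \<preceq> (exp ?f *\<^sub>R ?H) o\<^sub>L op_inv (exp s *\<^sub>R Y) o\<^sub>L (exp ?f *\<^sub>R ?H)"
      using Suc wgeo_Riccati[OF pos(1,3)] by simp
  qed (use pos X in \<open>auto simp: pos_scaleR\<close>)
qed

section \<open>Exponential and logarithm\<close>

lemma qle_limit:
  fixes A B :: "nat \<Rightarrow> 'a::chilbert_space \<Rightarrow>\<^sub>L 'a"
  assumes "A \<longlonglongrightarrow> L" "B \<longlonglongrightarrow> M" "\<forall>\<^sub>F k in sequentially. A k \<preceq> B k"
  shows "L \<preceq> M"
proof (rule qleI)
  fix x
  have "(\<lambda>k. inner (A k x) x) \<longlonglongrightarrow> inner (L x) x" "(\<lambda>k. inner (B k x) x) \<longlonglongrightarrow> inner (M x) x"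
    using assms by (auto intro!: tendsto_intros)
  then show "inner (L x) x \<le> inner (M x) x"
    using assms(3) by (intro tendsto_le[OF sequentially_bot]) (auto elim!: eventually_mono dest: qleD)
qed

lemma qle_scaled_id: "r \<le> r' \<Longrightarrow> r *\<^sub>R id_blinfun \<preceq> r' *\<^sub>R (id_blinfun :: 'a::chilbert_space \<Rightarrow>\<^sub>L 'a)"
  by (simp add: qle_def blinfun.bilinear_simps mult_right_mono)

lemma pos_exp_bounds:
  fixes A :: "'a::chilbert_space \<Rightarrow>\<^sub>L 'a"
  assumes "A \<in> pos_cone"
  shows "\<exists>s0\<ge>0. \<forall>s\<ge>s0. exp (- s) *\<^sub>R id_blinfun \<preceq> A \<and> A \<preceq> exp s *\<^sub>R id_blinfun"
proof -
  obtain a where a: "0 < a" "a *\<^sub>R id_blinfun \<preceq> A" using assms by (auto simp: pos_cone_iff)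
  define s0 where "s0 = max (norm A) (max 0 (- ln a))"
  have "exp (- s) *\<^sub>R id_blinfun \<preceq> A \<and> A \<preceq> exp s *\<^sub>R id_blinfun" if "s \<ge> s0" for s
  proof
    have "- s \<le> ln a" using that by (simp add: s0_def)
    then have "exp (- s) \<le> a" using a by (metis exp_le_cancel_iff exp_ln)
    then show "exp (- s) *\<^sub>R id_blinfun \<preceq> A" using qle_scaled_id a qle_trans by blast
    have "norm A \<le> s" using that by (simp add: s0_def)
    then have "norm A \<le> exp s" using exp_ge_add_one_self[of s] by linarith
    then have "norm A *\<^sub>R id_blinfun \<preceq> exp s *\<^sub>R (id_blinfun :: 'a \<Rightarrow>\<^sub>L 'a)" by (rule qle_scaled_id)
    moreover have "A \<preceq> norm A *\<^sub>R id_blinfun"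
      using inner_op_le[of A] by (simp add: qle_def blinfun.bilinear_simps power2_norm_eq_inner)
    ultimately show "A \<preceq> exp s *\<^sub>R id_blinfun" using qle_trans by blast
  qed
  moreover have "0 \<le> s0" by (simp add: s0_def)
  ultimately show ?thesis by blast
qed

text \<open>The difference quotients \<open>(Z\<^sup>t - 1) / t\<close> at \<open>t = 1 / 2 ^ k\<close>.\<close>

definition dlog :: "nat \<Rightarrow> ('a::chilbert_space \<Rightarrow>\<^sub>L 'a) \<Rightarrow> ('a \<Rightarrow>\<^sub>L 'a)" where
  "dlog k Z = 2 ^ k *\<^sub>R (wroot k Z - id_blinfun)"

lemma wroot_dlog: "wroot k Z = id_blinfun + (1 / 2 ^ k) *\<^sub>R dlog k Z"
  by (simp add: dlog_def)

lemma dlog_0 [simp]: "dlog 0 Z = Z - id_blinfun"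
  by (simp add: dlog_def)

lemma dlog_sa: "Z \<in> pos_cone \<Longrightarrow> selfadjoint_op (dlog k Z)"
  by (simp add: dlog_def sa_ops pos_sa)

section \<open>Monotonicity and rate of convergence of the difference quotients\<close>

text \<open>The identity \<open>W W - 1 = 2 V + V V\<close> for \<open>W = 1 + V\<close>. The
  increment is a square, hence positive, and \<open>V\<close> is \<open>O(2^-k)\<close>, hence the
  increment is too; both directions of the later estimates start here.\<close>

lemma dlog_Suc:
  fixes k :: nat
  assumes "Z \<in> pos_cone"
  defines "V \<equiv> wroot (Suc k) Z - id_blinfun"
  shows "dlog k Z = dlog (Suc k) Z + 2 ^ k *\<^sub>R (V o\<^sub>L V)"
proof -
  have "wroot k Z = 2 *\<^sub>R V + (V o\<^sub>L V) + id_blinfun"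
    unfolding wroot_Suc_square[OF assms(1), of k, symmetric] V_def
    by (auto simp: blinfun_eq_iff blinfun.bilinear_simps scaleR_2)
  then show ?thesis
    by (simp add: dlog_def V_def[symmetric] scaleR_add_right mult.commute)
qed

lemma dlog_antimono:
  assumes Z: "Z \<in> pos_cone" and "k \<le> m"
  shows "dlog m Z \<preceq> dlog k Z"
  using \<open>k \<le> m\<close>
proof (induction m rule: dec_induct)
  case (step m)
  define V where "V = wroot (Suc m) Z - id_blinfun"
  have "selfadjoint_op V" unfolding V_def using Z by (intro sa_ops pos_sa) auto
  then have "inner (V (V x)) x = inner (V x) (V x)" for x by (rule sa_sym)
  then have "dlog (Suc m) Z \<preceq> dlog m Z"
    unfolding dlog_Suc[OF Z, of m] V_def[symmetric]
    by (simp add: qle_def blinfun.add_left blinfun.scaleR_left inner_simps)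
  then show ?case using step.IH qle_trans by blast
qed simp

lemma wroot_bounds:
  fixes Z :: "'a::chilbert_space \<Rightarrow>\<^sub>L 'a"
  assumes Z: "Z \<in> pos_cone" and "exp (- s) *\<^sub>R id_blinfun \<preceq> Z" "Z \<preceq> exp s *\<^sub>R id_blinfun"
  shows "exp (- (s / 2 ^ k)) *\<^sub>R id_blinfun \<preceq> wroot k Z" "wroot k Z \<preceq> exp (s / 2 ^ k) *\<^sub>R id_blinfun"
proof -
  have sq: "sqrt (exp x) = exp (x / 2)" for x :: real
    by (rule real_sqrt_unique) (simp_all flip: exp_of_nat_mult)
  have "exp (- (s / 2 ^ k)) *\<^sub>R id_blinfun \<preceq> wroot k Z \<and> wroot k Z \<preceq> exp (s / 2 ^ k) *\<^sub>R id_blinfun"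
  proof (induction k)
    case (Suc k)
    have "op_sqrt (exp (- (s / 2 ^ k)) *\<^sub>R id_blinfun) \<preceq> op_sqrt (wroot k Z)"
      "op_sqrt (wroot k Z) \<preceq> op_sqrt (exp (s / 2 ^ k) *\<^sub>R id_blinfun)"
      using Suc Z by (auto intro!: op_sqrt_mono pos_scaleR pos_id)
    then show ?case by (simp add: op_sqrt_scaled_id sq wroot_Suc mult.commute)
  qed (use assms in auto)
  then show "exp (- (s / 2 ^ k)) *\<^sub>R id_blinfun \<preceq> wroot k Z" "wroot k Z \<preceq> exp (s / 2 ^ k) *\<^sub>R id_blinfun"
    by auto
qed

lemma exp_minus_one_le: "0 \<le> u \<Longrightarrow> exp u - 1 \<le> u * exp (u::real)"
proof -
  have "(1 - u) * exp u \<le> exp (- u) * exp u"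
    using exp_ge_add_one_self[of "- u"] by (intro mult_right_mono) auto
  then show ?thesis by (simp add: algebra_simps exp_minus)
qed

text \<open>The root lies between \<open>exp (- u)\<close> and \<open>exp u\<close> with
  \<open>u = s / 2 ^ k\<close>, and both deviate from 1 by at most
  \<open>exp u - 1 \<le> u * exp s\<close>.\<close>

lemma wroot_minus_id_norm:
  fixes Z :: "'a::chilbert_space \<Rightarrow>\<^sub>L 'a"
  assumes Z: "Z \<in> pos_cone" and b: "exp (- s) *\<^sub>R id_blinfun \<preceq> Z" "Z \<preceq> exp s *\<^sub>R id_blinfun"
    and s: "0 \<le> s"
  shows "norm (wroot k Z - id_blinfun) \<le> s * exp s / 2 ^ k"
proof (rule sa_norm_le)
  show "selfadjoint_op (wroot k Z - id_blinfun)" using Z by (intro sa_ops pos_sa) auto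
  show "0 \<le> s * exp s / 2 ^ k" using s by simp
  fix x
  let ?u = "s / 2 ^ k"
  have u: "0 \<le> ?u" "?u \<le> s" using s mult_left_mono[of 1 "2 ^ k" s] by (auto simp: divide_le_eq)
  have "exp ?u - 1 \<le> ?u * exp ?u" by (rule exp_minus_one_le[OF u(1)])
  also have "\<dots> \<le> ?u * exp s" using u by (intro mult_left_mono) auto
  finally have e: "exp ?u - 1 \<le> s * exp s / 2 ^ k" by simp
  have "1 - exp (- ?u) \<le> ?u" using exp_ge_add_one_self[of "- ?u"] by linarith
  then have e': "1 - exp (- ?u) \<le> exp ?u - 1" using exp_ge_add_one_self[of ?u] by linarith
  have "inner (wroot k Z x) x \<le> exp ?u * (norm x)\<^sup>2" "exp (- ?u) * (norm x)\<^sup>2 \<le> inner (wroot k Z x) x"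
    using wroot_bounds[OF Z b, of k] by (auto simp: qle_def blinfun.bilinear_simps power2_norm_eq_inner)
  moreover have "exp ?u \<le> 1 + s * exp s / 2 ^ k" "1 - s * exp s / 2 ^ k \<le> exp (- ?u)"
    using e e' by linarith+
  from this[THEN mult_right_mono, of "(norm x)\<^sup>2"]
  have "exp ?u * (norm x)\<^sup>2 \<le> (1 + s * exp s / 2 ^ k) * (norm x)\<^sup>2"
    "(1 - s * exp s / 2 ^ k) * (norm x)\<^sup>2 \<le> exp (- ?u) * (norm x)\<^sup>2" by auto
  ultimately have "inner (wroot k Z x) x \<le> (norm x)\<^sup>2 + s * exp s / 2 ^ k * (norm x)\<^sup>2"
    "(norm x)\<^sup>2 - s * exp s / 2 ^ k * (norm x)\<^sup>2 \<le> inner (wroot k Z x) x"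
    by (simp_all add: ring_distribs)
  then show "\<bar>inner ((wroot k Z - id_blinfun) x) x\<bar> \<le> s * exp s / 2 ^ k * (norm x)\<^sup>2"
    by (simp add: blinfun.bilinear_simps inner_simps power2_norm_eq_inner abs_le_iff)
qed

text \<open>The increments in \<open>dlog_Suc\<close> are summed; the error is carried as a
  difference \<open>1 / 2 ^ k - 1 / 2 ^ m\<close> so that it telescopes.\<close>

lemma dlog_almost_mono:
  fixes Z :: "'a::chilbert_space \<Rightarrow>\<^sub>L 'a"
  assumes Z: "Z \<in> pos_cone" and b: "exp (- s) *\<^sub>R id_blinfun \<preceq> Z" "Z \<preceq> exp s *\<^sub>R id_blinfun"
    and s: "0 \<le> s" and "k \<le> m"
  shows "dlog k Z \<preceq> dlog m Z + ((s * exp s)\<^sup>2 / 2 ^ k) *\<^sub>R id_blinfun"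
proof -
  let ?C = "(s * exp s)\<^sup>2"
  have "dlog k Z \<preceq> dlog m Z + (?C * (1 / 2 ^ k - 1 / 2 ^ m)) *\<^sub>R id_blinfun"
    using \<open>k \<le> m\<close>
  proof (induction m rule: dec_induct)
    case (step m)
    define V where "V = wroot (Suc m) Z - id_blinfun"
    have V: "selfadjoint_op V" unfolding V_def using Z by (intro sa_ops pos_sa) auto
    have "dlog m Z \<preceq> dlog (Suc m) Z + (?C * (1 / 2 ^ m - 1 / 2 ^ Suc m)) *\<^sub>R id_blinfun"
    proof (rule qleI)
      fix x
      have "norm (V x) \<le> norm V * norm x" by (rule norm_blinfun)
      also have "\<dots> \<le> s * exp s / 2 ^ Suc m * norm x"
        unfolding V_def by (intro mult_right_mono wroot_minus_id_norm Z b s norm_ge_zero)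
      finally have "(norm (V x))\<^sup>2 \<le> (s * exp s / 2 ^ Suc m * norm x)\<^sup>2" by (intro power_mono) auto
      also have "\<dots> = (s * exp s / 2 ^ Suc m)\<^sup>2 * inner x x"
        by (simp only: power_mult_distrib power2_norm_eq_inner)
      finally have "2 ^ m * inner (V x) (V x) \<le> 2 ^ m * ((s * exp s / 2 ^ Suc m)\<^sup>2 * inner x x)"
        by (intro mult_left_mono) (auto simp: power2_norm_eq_inner)
      also have "\<dots> = ?C * (1 / 2 ^ m / 4) * inner x x"
        by (simp add: power_divide power2_eq_square field_simps)
      \<comment> \<open>The factor 1/4 is enlarged to 1/2 to obtain the telescoping
        difference.\<close>
      also have "\<dots> \<le> ?C * (1 / 2 ^ m - 1 / 2 ^ Suc m) * inner x x"
        by (intro mult_right_mono mult_left_mono) (auto simp: field_simps)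
      finally have "2 ^ m * inner (V x) (V x) \<le> ?C * (1 / 2 ^ m - 1 / 2 ^ Suc m) * inner x x" .
      moreover have "inner (V (V x)) x = inner (V x) (V x)" using V by (rule sa_sym)
      ultimately show "inner (dlog m Z x) x
          \<le> inner ((dlog (Suc m) Z + (?C * (1 / 2 ^ m - 1 / 2 ^ Suc m)) *\<^sub>R id_blinfun) x) x"
        unfolding dlog_Suc[OF Z, of m] V_def[symmetric]
        by (simp add: blinfun.add_left blinfun.scaleR_left inner_simps del: power_Suc)
    qed
    from qle_add[OF this, of "(?C * (1 / 2 ^ k - 1 / 2 ^ m)) *\<^sub>R id_blinfun", OF qle_refl]
    have "dlog m Z + (?C * (1 / 2 ^ k - 1 / 2 ^ m)) *\<^sub>R id_blinfun
        \<preceq> dlog (Suc m) Z + (?C * (1 / 2 ^ k - 1 / 2 ^ Suc m)) *\<^sub>R id_blinfun"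
      by (simp add: add.assoc flip: scaleR_add_left) (simp add: algebra_simps)
    with step.IH show ?case by (rule qle_trans)
  qed simp
  also have "dlog m Z + (?C * (1 / 2 ^ k - 1 / 2 ^ m)) *\<^sub>R id_blinfun \<preceq> dlog m Z + (?C / 2 ^ k) *\<^sub>R id_blinfun"
    by (intro qle_add qle_refl qle_scaled_id) (simp add: algebra_simps)
  finally show ?thesis .
qed

text \<open>The companion quotients \<open>(1 - Z\<^sup>-\<^sup>t) / t\<close> increase as \<open>t\<close> decreases and stay below \<open>dlog\<close>.\<close>

lemma dlog_ge_id_minus_inv:
  fixes Z :: "'a::chilbert_space \<Rightarrow>\<^sub>L 'a"
  assumes Z: "Z \<in> pos_cone"
  shows "id_blinfun - op_inv Z \<preceq> dlog k Z"
proof -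
  let ?E = "\<lambda>k. 2 ^ k *\<^sub>R (id_blinfun - op_inv (wroot k Z))"
  have "id_blinfun - op_inv Z \<preceq> ?E k"
  proof (induction k)
    case (Suc k)
    let ?v = "op_inv (wroot (Suc k) Z)"
    have v: "selfadjoint_op ?v" using Z by (simp add: pos_sa)
    have "op_inv (wroot k Z) = ?v o\<^sub>L ?v"
      using Z op_inv_eq_sqrt[of "wroot k Z"] by (simp add: wroot_Suc)
    \<comment> \<open>Positivity of \<open>(1 - v)\<^sup>2\<close> is the inequality
      \<open>1 - v\<^sup>2 \<le> 2 (1 - v)\<close>.\<close>
    moreover have "0 \<le> inner (x - ?v x) (x - ?v x)" for x by simp
    ultimately have "id_blinfun - op_inv (wroot k Z) \<preceq> 2 *\<^sub>R (id_blinfun - ?v)"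
      by (auto simp: qle_def blinfun.bilinear_simps inner_simps inner_commute sa_sym[OF v] algebra_simps)
    from qle_scaleR[OF this, of "2 ^ k"] have "?E k \<preceq> ?E (Suc k)" by (simp add: mult.commute)
    with Suc show ?case by (rule qle_trans)
  qed simp
  moreover have "?E k \<preceq> dlog k Z"
    unfolding dlog_def
  proof (intro qle_scaleR qleI)
    fix x
    let ?w = "wroot k Z"
    have w: "?w \<in> pos_cone" using Z by simp
    \<comment> \<open>The form of the inverse of \<open>w\<close> at \<open>(w - 1) x\<close>
      encodes \<open>0 \<le> w - 2 + w\<^sup>-\<^sup>1\<close>.\<close>
    have "0 \<le> inner (op_inv ?w (?w x - x)) (?w x - x)"
      using qleD[OF pos_ge_0, of "op_inv ?w" "?w x - x"] w by simp
    also have "\<dots> = inner (?w x) x + inner (op_inv ?w x) x - 2 * inner x x"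
      using w sa_sym[OF pos_sa, of "op_inv ?w" x "?w x"]
      by (simp add: blinfun.bilinear_simps inner_simps inner_commute)
    finally show "inner ((id_blinfun - op_inv ?w) x) x \<le> inner ((?w - id_blinfun) x) x"
      by (simp add: blinfun.bilinear_simps inner_simps)
  qed simp
  ultimately show ?thesis by (rule qle_trans)
qed

lemma dlog_diff_norm:
  fixes Z :: "'a::chilbert_space \<Rightarrow>\<^sub>L 'a"
  assumes Z: "Z \<in> pos_cone" and b: "exp (- s) *\<^sub>R id_blinfun \<preceq> Z" "Z \<preceq> exp s *\<^sub>R id_blinfun"
    and s: "0 \<le> s" and "k \<le> m"
  shows "norm (dlog k Z - dlog m Z) \<le> (s * exp s)\<^sup>2 / 2 ^ k"
proof (rule psd_norm_le)
  show "psd_op (dlog k Z - dlog m Z)"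
    using dlog_antimono[OF Z \<open>k \<le> m\<close>] Z
    by (auto simp: psd_iff sa_ops dlog_sa qle_def blinfun.bilinear_simps inner_simps)
  show "dlog k Z - dlog m Z \<preceq> ((s * exp s)\<^sup>2 / 2 ^ k) *\<^sub>R id_blinfun"
    using dlog_almost_mono[OF assms] by (auto simp: qle_def blinfun.bilinear_simps inner_simps diff_le_eq add.commute)
qed simp

lemma dlog_convergent:
  assumes Z: "Z \<in> pos_cone"
  shows "convergent (\<lambda>k. dlog k Z)"
proof -
  obtain s where s: "exp (- s) *\<^sub>R id_blinfun \<preceq> Z" "Z \<preceq> exp s *\<^sub>R id_blinfun" "0 \<le> s"
    using pos_exp_bounds[OF Z] by blast
  have "Cauchy (\<lambda>k. dlog k Z)"
  proof (rule CauchyI')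
    fix e :: real assume "0 < e"
    have "(\<lambda>k. (s * exp s)\<^sup>2 / 2 ^ k) \<longlonglongrightarrow> 0"
      using LIMSEQ_divide_realpow_zero[of 2] by simp
    from order_tendstoD(2)[OF this \<open>0 < e\<close>]
    obtain M where M: "(s * exp s)\<^sup>2 / 2 ^ k < e" if "k \<ge> M" for k
      by (auto simp: eventually_sequentially)
    have "dist (dlog m Z) (dlog n Z) < e" if "m \<ge> M" "n > m" for m n
      using dlog_diff_norm[OF Z s, of m n] M[of m] that by (simp add: dist_norm)
    then show "\<exists>M. \<forall>m\<ge>M. \<forall>n>m. dist (dlog m Z) (dlog n Z) < e" by blast
  qed
  then show ?thesis by (rule Cauchy_convergent)
qed

section \<open>The exponential series and its doubling formula\<close>

definition op_pow :: "('a::chilbert_space \<Rightarrow>\<^sub>L 'a) \<Rightarrow> nat \<Rightarrow> ('a \<Rightarrow>\<^sub>L 'a)" where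
  "op_pow A k = ((\<lambda>T. A o\<^sub>L T) ^^ k) id_blinfun"

lemma op_pow_0 [simp]: "op_pow A 0 = id_blinfun" and op_pow_Suc: "op_pow A (Suc k) = A o\<^sub>L op_pow A k"
  by (simp_all add: op_pow_def)

lemma blinfun_compose_id: "A o\<^sub>L id_blinfun = A" "id_blinfun o\<^sub>L A = A"
  by (simp_all add: blinfun_eq_iff)

lemma op_pow_add: "op_pow A (j + k) = op_pow A j o\<^sub>L op_pow A k"
  by (induction j) (auto simp: op_pow_Suc blinfun_eq_iff)

lemma op_pow_scaleR: "op_pow (r *\<^sub>R A) k = r ^ k *\<^sub>R op_pow A k"
  by (induction k) (auto simp: op_pow_Suc blinfun_compose_bilinear_simps)

lemma norm_op_pow: "norm (op_pow A k) \<le> norm A ^ k"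
proof (induction k)
  case (Suc k)
  have "norm (op_pow A (Suc k)) \<le> norm A * norm (op_pow A k)"
    unfolding op_pow_Suc by (rule norm_blinfun_compose)
  also have "\<dots> \<le> norm A * norm A ^ k" using Suc by (intro mult_left_mono) auto
  finally show ?case by simp
qed (simp add: norm_blinfun_id_le)

lemma op_pow_sa:
  assumes "selfadjoint_op A"
  shows "selfadjoint_op (op_pow A k)"
proof -
  have com: "A (op_pow A k x) = op_pow A k (A x)" for k x
    using op_pow_add[of A k 1] op_pow_add[of A 1 k]
    by (auto simp: op_pow_Suc blinfun_eq_iff)
  show ?thesis
  proof (induction k)
    case (Suc k)
    then show ?case using assms
      by (auto simp: selfadjoint_iff op_pow_Suc clinear_ops com)
  qed (simp add: sa_ops)
qed

lemma exp_sums: "(\<lambda>k. 1 / fact k * x ^ k) sums exp (x::real)"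
  using exp_converges[of x] by (simp add: divide_inverse mult.commute)

lemma norm_exp_term: "norm ((1 / fact k) *\<^sub>R op_pow A k) \<le> 1 / fact k * norm A ^ k"
  using norm_op_pow[of A k] by (simp add: divide_right_mono)

lemma op_exp_summable: "summable (\<lambda>k. norm ((1 / fact k) *\<^sub>R op_pow A k))"
proof (rule summable_comparison_test')
  show "summable (\<lambda>k. 1 / fact k * norm A ^ k)" using exp_sums by (rule sums_summable)
  show "norm (norm ((1 / fact k) *\<^sub>R op_pow A k)) \<le> 1 / fact k * norm A ^ k" for k
    unfolding real_norm_def abs_norm_cancel by (rule norm_exp_term)
qed

lemma op_exp_sums: "(\<lambda>k. (1 / fact k) *\<^sub>R op_pow A k) sums op_exp A"
  unfolding op_exp_def op_pow_def[symmetric]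
  by (rule summable_sums[OF summable_norm_cancel[OF op_exp_summable]])

lemma op_exp_sa: "selfadjoint_op A \<Longrightarrow> selfadjoint_op (op_exp A)"
  using op_exp_sums[of A] unfolding sums_def
  by (rule sa_limit[rotated]) (intro sa_sum sa_ops op_pow_sa)

text \<open>Each term is dominated by the scalar series at \<open>norm A\<close>, so the remainders
  are too. The case \<open>n = 0\<close> bounds the exponential, the case \<open>n = 2\<close> its
  linear approximation.\<close>

lemma op_exp_tail_norm:
  "norm (op_exp A - (\<Sum>k<n. (1 / fact k) *\<^sub>R op_pow A k)) \<le> exp (norm A) - (\<Sum>k<n. 1 / fact k * norm A ^ k)"
proof -
  have "(\<lambda>k. (1 / fact (k + n)) *\<^sub>R op_pow A (k + n)) sums
      (op_exp A - (\<Sum>k<n. (1 / fact k) *\<^sub>R op_pow A k))"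
    using sums_split_initial_segment[OF op_exp_sums] .
  moreover have "(\<lambda>k. 1 / fact (k + n) * norm A ^ (k + n)) sums
      (exp (norm A) - (\<Sum>k<n. 1 / fact k * norm A ^ k))"
    using sums_split_initial_segment[OF exp_sums] .
  ultimately show ?thesis by (rule norm_sums_le) (rule norm_exp_term)
qed

lemma norm_op_exp: "norm (op_exp A) \<le> exp (norm A)"
  using op_exp_tail_norm[of A 0] by simp

lemma op_exp_linear_approx:
  assumes "norm A \<le> 1"
  shows "norm (op_exp A - id_blinfun - A) \<le> (norm A)\<^sup>2"
  using op_exp_tail_norm[of A 2] exp_bound[of "norm A"] assms
  by (simp add: numeral_2_eq_2 op_pow_Suc diff_diff_eq blinfun_compose_id)

text \<open>Summing along diagonals, each row of binomial coefficients adds up to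
  \<open>2 ^ k\<close>. An arbitrary \<open>T\<close> allows the same identity for operator powers
  and for powers of the norm.\<close>

lemma double_exp_partial_sum:
  fixes T :: "nat \<Rightarrow> 'b::real_vector"
  shows "(\<Sum>(i, j)\<in>{(i, j). i + j < N}. (1 / fact i * (1 / fact j)) *\<^sub>R T (i + j))
    = (\<Sum>k<N. (2 ^ k / fact k) *\<^sub>R T k)"
proof -
  have binom: "(\<Sum>i\<le>k. 1 / fact i * (1 / fact (k - i))) = (2 ^ k / fact k :: real)" for k
  proof -
    have "(\<Sum>i\<le>k. 1 / fact i * (1 / fact (k - i))) = (\<Sum>i\<le>k. real (k choose i) / fact k)"
      by (intro sum.cong) (auto simp: binomial_fact)
    also have "\<dots> = real (\<Sum>i\<le>k. k choose i) / fact k" by (simp flip: sum_divide_distrib)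
    finally show ?thesis by (simp only: choose_row_sum of_nat_power of_nat_numeral)
  qed
  have "(\<Sum>(i, j)\<in>{(i, j). i + j < N}. (1 / fact i * (1 / fact j)) *\<^sub>R T (i + j))
    = (\<Sum>k<N. \<Sum>i\<le>k. (1 / fact i * (1 / fact (k - i))) *\<^sub>R T (i + (k - i)))"
    by (rule sum.triangle_reindex)
  also have "\<dots> = (\<Sum>k<N. (\<Sum>i\<le>k. 1 / fact i * (1 / fact (k - i))) *\<^sub>R T k)"
    unfolding scaleR_sum_left by (intro sum.cong) auto
  finally show ?thesis by (simp only: binom)
qed

text \<open>The product of two partial sums runs over a square of indices, the partial sum for
  \<open>2 *\<^sub>R A\<close> over a triangle in it. The operator terms in between are dominated by
  the scalar ones, whose sum tends to \<open>exp ?a * exp ?a - exp (2 * ?a) = 0\<close>. Doubling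
  makes the exponential of \<open>L / 2\<close> a square root of that of \<open>L\<close>.\<close>

lemma op_exp_double: "op_exp (2 *\<^sub>R A) = op_exp A o\<^sub>L op_exp A"
proof -
  let ?a = "norm A"
  let ?c = "\<lambda>(i, j). 1 / fact i * (1 / fact j) :: real"
  let ?T1 = "\<lambda>N. {..<N} \<times> {..<N} :: (nat \<times> nat) set"
  let ?T2 = "\<lambda>N. {(i, j). i + j < N} :: (nat \<times> nat) set"
  let ?S = "\<lambda>N. \<Sum>k<N. (1 / fact k) *\<^sub>R op_pow A k"
  let ?s = "\<lambda>N. \<Sum>k<N. 1 / fact k * ?a ^ k"
  let ?R = "\<lambda>N. \<Sum>k<N. (2 ^ k / fact k) *\<^sub>R op_pow A k"
  let ?r = "\<lambda>N. \<Sum>k<N. (2 ^ k / fact k) *\<^sub>R ?a ^ k"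
  have sub: "?T2 N \<subseteq> ?T1 N" and fin: "finite (?T1 N)" for N by auto
  have SS: "?S N o\<^sub>L ?S N = (\<Sum>p\<in>?T1 N. ?c p *\<^sub>R op_pow A (fst p + snd p))" for N
  proof -
    have "?S N o\<^sub>L ?S N = (\<Sum>i<N. \<Sum>j<N. ((1 / fact i) *\<^sub>R op_pow A i) o\<^sub>L ((1 / fact j) *\<^sub>R op_pow A j))"
      unfolding bounded_bilinear.sum_left[OF bounded_bilinear_blinfun_compose]
      unfolding bounded_bilinear.sum_right[OF bounded_bilinear_blinfun_compose] ..
    also have "\<dots> = (\<Sum>i<N. \<Sum>j<N. (1 / fact i * (1 / fact j)) *\<^sub>R op_pow A (i + j))"
      by (simp add: blinfun_compose_bilinear_simps op_pow_add mult.commute)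
    finally show ?thesis by (simp add: sum.cartesian_product split_beta)
  qed
  have ss: "?s N * ?s N = (\<Sum>p\<in>?T1 N. ?c p *\<^sub>R ?a ^ (fst p + snd p))" for N
  proof -
    have "?s N * ?s N = (\<Sum>i<N. \<Sum>j<N. (1 / fact i * (1 / fact j)) *\<^sub>R ?a ^ (i + j))"
      unfolding sum_product by (simp add: power_add)
    then show ?thesis by (simp add: sum.cartesian_product split_beta)
  qed
  have R: "?R N = (\<Sum>p\<in>?T2 N. ?c p *\<^sub>R op_pow A (fst p + snd p))" for N
    using double_exp_partial_sum[of "op_pow A" N] by (simp add: split_beta)
  have r: "?r N = (\<Sum>p\<in>?T2 N. ?c p *\<^sub>R ?a ^ (fst p + snd p))" for N
    using double_exp_partial_sum[of "\<lambda>k. ?a ^ k" N] by (simp add: split_beta)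
  have bound: "norm ((?S N o\<^sub>L ?S N) - ?R N) \<le> ?s N * ?s N - ?r N" for N
  proof -
    have "norm ((?S N o\<^sub>L ?S N) - ?R N) = norm (\<Sum>p\<in>?T1 N - ?T2 N. ?c p *\<^sub>R op_pow A (fst p + snd p))"
      unfolding SS R by (subst sum_diff[OF fin sub]) (rule refl)
    also have "\<dots> \<le> (\<Sum>p\<in>?T1 N - ?T2 N. ?c p *\<^sub>R ?a ^ (fst p + snd p))"
      by (intro sum_norm_le) (auto intro!: divide_right_mono norm_op_pow)
    also have "\<dots> = ?s N * ?s N - ?r N" unfolding ss r by (rule sum_diff[OF fin sub])
    finally show ?thesis .
  qed
  have null: "(\<lambda>N. ?s N * ?s N - ?r N) \<longlonglongrightarrow> 0"
  proof -
    have "(\<lambda>N. ?s N) \<longlonglongrightarrow> exp ?a" using exp_sums unfolding sums_def .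
    moreover have "(\<lambda>N. ?r N) \<longlonglongrightarrow> exp (2 * ?a)"
      using exp_sums[of "2 * ?a"] unfolding sums_def by (simp only: power_mult_distrib real_scaleR_def times_divide_eq_left mult_1)
    ultimately have "(\<lambda>N. ?s N * ?s N - ?r N) \<longlonglongrightarrow> exp ?a * exp ?a - exp (2 * ?a)"
      by (intro tendsto_intros)
    then show ?thesis by (simp only: mult_2 exp_add diff_self)
  qed
  have "(\<lambda>N. (?S N o\<^sub>L ?S N) - ?R N) \<longlonglongrightarrow> 0"
    using null by (rule Lim_null_comparison[OF always_eventually, rotated]) (intro allI bound)
  moreover have "(\<lambda>N. (?S N o\<^sub>L ?S N) - ?R N) \<longlonglongrightarrow> (op_exp A o\<^sub>L op_exp A) - op_exp (2 *\<^sub>R A)"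
  proof -
    have "?S \<longlonglongrightarrow> op_exp A" using op_exp_sums unfolding sums_def .
    moreover have "?R \<longlonglongrightarrow> op_exp (2 *\<^sub>R A)"
      using op_exp_sums[of "2 *\<^sub>R A"] unfolding sums_def by (simp add: op_pow_scaleR)
    ultimately show ?thesis
      by (intro tendsto_diff bounded_bilinear.tendsto[OF bounded_bilinear_blinfun_compose])
  qed
  ultimately have "(op_exp A o\<^sub>L op_exp A) - op_exp (2 *\<^sub>R A) = 0" by (rule LIMSEQ_unique[rotated])
  then show ?thesis by simp
qed

section \<open>The logarithm as limit of the difference quotients\<close>

lemma tendsto_divide_pow2: "(\<lambda>k. c / 2 ^ k) \<longlonglongrightarrow> (0::real)"
  using LIMSEQ_divide_realpow_zero[of 2 c] by simp

lemma eventually_divide_pow2_less: "0 < e \<Longrightarrow> \<forall>\<^sub>F k in sequentially. c / 2 ^ k < (e::real)"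
  using order_tendstoD(2)[OF tendsto_divide_pow2] .

lemma op_exp_halve: "op_exp A = op_exp ((1/2) *\<^sub>R A) o\<^sub>L op_exp ((1/2) *\<^sub>R A)"
  using op_exp_double[of "(1/2) *\<^sub>R A"] by simp

lemma op_exp_psd:
  assumes "selfadjoint_op L"
  shows "psd_op (op_exp L)"
proof -
  have E: "selfadjoint_op (op_exp ((1/2) *\<^sub>R L))" using assms by (intro op_exp_sa sa_ops)
  show ?thesis
    unfolding op_exp_halve[of L] psd_iff
    by (intro conjI sa_square[OF E] qleI) (simp add: sa_sym[OF E, of "blinfun_apply _ _"])
qed

lemma wroot_op_exp:
  assumes L: "selfadjoint_op L" and pos: "op_exp L \<in> pos_cone"
  shows "wroot k (op_exp L) = op_exp ((1 / 2 ^ k) *\<^sub>R L)"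
proof (induction k)
  case (Suc k)
  have "wroot k (op_exp L) \<in> pos_cone" using pos by simp
  then show ?case unfolding wroot_Suc Suc
    using L op_exp_halve[of "(1 / 2 ^ k) *\<^sub>R L"]
    by (intro op_sqrt_eqI op_exp_psd sa_ops) (simp_all add: mult.commute)
qed simp

text \<open>This is injectivity of \<open>op_exp\<close>: \<open>L\<close> is recovered from its
  exponential. The quadratic error at \<open>L / 2 ^ k\<close>, multiplied by \<open>2 ^ k\<close>,
  is \<open>O(2^-k)\<close>.\<close>

lemma dlog_op_exp_tendsto:
  assumes L: "selfadjoint_op L" and pos: "op_exp L \<in> pos_cone"
  shows "(\<lambda>k. dlog k (op_exp L)) \<longlonglongrightarrow> L"
proof -
  have "\<forall>\<^sub>F k in sequentially. norm (dlog k (op_exp L) - L) \<le> (norm L)\<^sup>2 / 2 ^ k"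
    using eventually_divide_pow2_less[OF zero_less_one, of "norm L"]
  proof eventually_elim
    case (elim k)
    let ?M = "(1 / 2 ^ k) *\<^sub>R L"
    have "dlog k (op_exp L) - L = 2 ^ k *\<^sub>R (op_exp ?M - id_blinfun - ?M)"
      by (simp add: dlog_def wroot_op_exp[OF assms] scaleR_diff_right)
    then have "norm (dlog k (op_exp L) - L) = 2 ^ k * norm (op_exp ?M - id_blinfun - ?M)" by simp
    also have "\<dots> \<le> 2 ^ k * (norm ?M)\<^sup>2"
      using elim by (intro mult_left_mono op_exp_linear_approx) auto
    also have "\<dots> = (norm L)\<^sup>2 / 2 ^ k" by (simp add: power2_eq_square)
    finally show ?case .
  qed
  then have "(\<lambda>k. dlog k (op_exp L) - L) \<longlonglongrightarrow> 0"
    by (rule Lim_null_comparison) (rule tendsto_divide_pow2)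
  then show ?thesis by (simp add: LIM_zero_iff)
qed

lemma exp_dominates_norm_wroot:
  fixes Z :: "'a::chilbert_space \<Rightarrow>\<^sub>L 'a"
  assumes "Z \<in> pos_cone" "exp (- s) *\<^sub>R id_blinfun \<preceq> Z" "Z \<preceq> exp s *\<^sub>R id_blinfun"
  shows "norm (wroot k Z) \<le> exp (s / 2 ^ k)"
  using assms by (intro psd_norm_le pos_psd wroot_bounds) auto

text \<open>The two sequences of iterated square roots, of \<open>op_exp L\<close> and of \<open>Z\<close>, differ by \<open>O(4\<^sup>-\<^sup>k)\<close>
  at depth \<open>k\<close>; squaring back \<open>k\<close> times costs a factor \<open>O(2\<^sup>k)\<close>.\<close>

lemma op_exp_dlog_limit:
  fixes Z :: "'a::chilbert_space \<Rightarrow>\<^sub>L 'a"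
  assumes Z: "Z \<in> pos_cone" and L: "(\<lambda>k. dlog k Z) \<longlonglongrightarrow> L"
  shows "op_exp L = Z"
proof -
  obtain s where s: "exp (- s) *\<^sub>R id_blinfun \<preceq> Z" "Z \<preceq> exp s *\<^sub>R id_blinfun" "0 \<le> s"
    using pos_exp_bounds[OF Z] by blast
  let ?C = "(s * exp s)\<^sup>2"
  \<comment> \<open>A common growth exponent: both sequences at depth \<open>k\<close> have norm at
    most \<open>exp (q / 2 ^ k)\<close>.\<close>
  define q where "q = max s (norm L)"
  have Lk: "norm (L - dlog k Z) \<le> ?C / 2 ^ k" for k
  proof (rule Lim_bounded)
    show "(\<lambda>m. norm (dlog m Z - dlog k Z)) \<longlonglongrightarrow> norm (L - dlog k Z)" using L by (intro tendsto_intros)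
    show "\<forall>m\<ge>k. norm (dlog m Z - dlog k Z) \<le> ?C / 2 ^ k"
      using dlog_diff_norm[OF Z s, of k] by (metis norm_minus_commute)
  qed
  define e where "e k = op_exp ((1 / 2 ^ k) *\<^sub>R L)" for k :: nat
  have e_Suc: "e k = e (Suc k) o\<^sub>L e (Suc k)" for k
    using op_exp_halve[of "(1 / 2 ^ k) *\<^sub>R L"] by (simp add: e_def mult.commute)
  have step: "norm (e k - wroot k Z) \<le> 2 * exp (q / 2 ^ Suc k) * norm (e (Suc k) - wroot (Suc k) Z)" for k
  proof -
    let ?a = "e (Suc k)" and ?b = "wroot (Suc k) Z"
    have "norm ?a \<le> exp (norm L / 2 ^ Suc k)"
      using norm_op_exp[of "(1 / 2 ^ Suc k) *\<^sub>R L"] by (simp add: e_def)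
    also have "\<dots> \<le> exp (q / 2 ^ Suc k)" by (simp add: q_def divide_right_mono)
    finally have a: "norm ?a \<le> exp (q / 2 ^ Suc k)" .
    have "norm ?b \<le> exp (s / 2 ^ Suc k)" by (rule exp_dominates_norm_wroot[OF Z s(1,2)])
    also have "\<dots> \<le> exp (q / 2 ^ Suc k)" by (simp add: q_def divide_right_mono)
    finally have b: "norm ?b \<le> exp (q / 2 ^ Suc k)" .
    have "e k - wroot k Z = (?a o\<^sub>L (?a - ?b)) + ((?a - ?b) o\<^sub>L ?b)"
      unfolding e_Suc[of k] wroot_Suc_square[OF Z, of k, symmetric]
      by (simp add: blinfun_compose_bilinear_simps)
    also have "norm \<dots> \<le> norm ?a * norm (?a - ?b) + norm (?a - ?b) * norm ?b"
      by (intro order_trans[OF norm_triangle_ineq] add_mono norm_blinfun_compose)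
    also have "\<dots> \<le> exp (q / 2 ^ Suc k) * norm (?a - ?b) + norm (?a - ?b) * exp (q / 2 ^ Suc k)"
      by (intro add_mono mult_left_mono mult_right_mono a b) auto
    finally show ?thesis by (simp add: mult.commute)
  qed
  \<comment> \<open>The exponent is the sum of \<open>q / 2 ^ j\<close> for \<open>j\<close> from 1
    to \<open>k\<close>, so the growth factors together stay below \<open>exp q\<close> while each
    squaring contributes a 2.\<close>
  have iter: "norm (e 0 - wroot 0 Z) \<le> 2 ^ k * exp (q * (1 - 1 / 2 ^ k)) * norm (e k - wroot k Z)" for k
  proof (induction k)
    case (Suc k)
    have "norm (e 0 - wroot 0 Z)
      \<le> 2 ^ k * exp (q * (1 - 1 / 2 ^ k)) * (2 * exp (q / 2 ^ Suc k) * norm (e (Suc k) - wroot (Suc k) Z))"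
      using Suc step[of k] by (meson exp_ge_zero mult_left_mono mult_nonneg_nonneg order_trans zero_le_numeral zero_le_power)
    also have "\<dots> = 2 ^ Suc k * (exp (q * (1 - 1 / 2 ^ k)) * exp (q / 2 ^ Suc k)) * norm (e (Suc k) - wroot (Suc k) Z)"
      by simp
    also have "exp (q * (1 - 1 / 2 ^ k)) * exp (q / 2 ^ Suc k) = exp (q * (1 - 1 / 2 ^ Suc k))"
      unfolding exp_add[symmetric] by (simp add: field_simps)
    finally show ?case .
  qed simp
  have q: "0 \<le> q" using s by (simp add: q_def)
  have "\<forall>\<^sub>F k in sequentially. norm (e 0 - wroot 0 Z) \<le> exp q * ((norm L)\<^sup>2 + ?C) / 2 ^ k"
    using eventually_divide_pow2_less[OF zero_less_one, of "norm L"]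
  proof eventually_elim
    case (elim k)
    let ?M = "(1 / 2 ^ k) *\<^sub>R L"
    \<comment> \<open>The bracket is quadratic in \<open>?M\<close>, and the other term is the rate
      \<open>Lk\<close> scaled once more by \<open>1 / 2 ^ k\<close>; both are of order
      \<open>1 / 4 ^ k\<close>.\<close>
    have "e k - wroot k Z = (op_exp ?M - id_blinfun - ?M) + (1 / 2 ^ k) *\<^sub>R (L - dlog k Z)"
      by (simp add: e_def dlog_def scaleR_diff_right)
    also have "norm \<dots> \<le> (norm ?M)\<^sup>2 + 1 / 2 ^ k * (?C / 2 ^ k)"
      using elim mult_left_mono[OF Lk[of k], of "1 / 2 ^ k"]
      by (intro order_trans[OF norm_triangle_ineq] add_mono op_exp_linear_approx) simp_all
    also have "\<dots> = ((norm L)\<^sup>2 + ?C) / 2 ^ k / 2 ^ k"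
      by (simp add: power2_eq_square add_divide_distrib)
    finally have "norm (e k - wroot k Z) \<le> ((norm L)\<^sup>2 + ?C) / 2 ^ k / 2 ^ k" .
    moreover have "exp (q * (1 - 1 / 2 ^ k)) \<le> exp q"
      using q by (simp add: mult_left_le)
    ultimately have "2 ^ k * exp (q * (1 - 1 / 2 ^ k)) * norm (e k - wroot k Z)
      \<le> 2 ^ k * exp q * (((norm L)\<^sup>2 + ?C) / 2 ^ k / 2 ^ k)"
      by (intro mult_mono) auto
    also have "\<dots> = exp q * ((norm L)\<^sup>2 + ?C) / 2 ^ k" by simp
    finally show ?case using iter[of k] by linarith
  qed
  then have "norm (e 0 - wroot 0 Z) \<le> 0"
    by (intro tendsto_lowerbound[OF tendsto_divide_pow2]) auto
  then show ?thesis by (simp add: e_def)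
qed

text \<open>The limit exponentiates to \<open>Z\<close> by \<open>op_exp_dlog_limit\<close>, and any
  other logarithm equals it by \<open>dlog_op_exp_tendsto\<close>; so the description defining
  \<open>op_log\<close> denotes.\<close>

lemma dlog_tendsto_op_log:
  assumes Z: "Z \<in> pos_cone"
  shows "(\<lambda>k. dlog k Z) \<longlonglongrightarrow> op_log Z"
proof -
  obtain L where L: "(\<lambda>k. dlog k Z) \<longlonglongrightarrow> L" using dlog_convergent[OF Z] by (auto simp: convergent_def)
  have "selfadjoint_op L" using dlog_sa[OF Z] L by (rule sa_limit)
  moreover have "op_exp L = Z" by (rule op_exp_dlog_limit[OF Z L])
  moreover have "L' = L" if "selfadjoint_op L' \<and> op_exp L' = Z" for L'
    using dlog_op_exp_tendsto[of L'] that Z L LIMSEQ_unique by blast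
  ultimately have "op_log Z = L" unfolding op_log_def by blast
  with L show ?thesis by simp
qed

lemma op_log_sa: "Z \<in> pos_cone \<Longrightarrow> selfadjoint_op (op_log Z)"
  using sa_limit[OF dlog_sa dlog_tendsto_op_log] .

section \<open>Power means and the Karcher equation\<close>

text \<open>The quotient \<open>(wgeo k X A - X) / t\<close> at \<open>t = 1 / 2 ^ k\<close>, see
  \<open>wgeo_slope\<close>. Written as a congruence, it inherits the estimates for
  \<open>dlog\<close>.\<close>

definition slope :: "nat \<Rightarrow> ('a::chilbert_space \<Rightarrow>\<^sub>L 'a) \<Rightarrow> ('a \<Rightarrow>\<^sub>L 'a) \<Rightarrow> ('a \<Rightarrow>\<^sub>L 'a)" where
  "slope k X A = op_sqrt X o\<^sub>L dlog k (rel X A) o\<^sub>L op_sqrt X"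

definition wgeo_mean ::
  "nat \<Rightarrow> nat \<Rightarrow> (nat \<Rightarrow> ('a::chilbert_space \<Rightarrow>\<^sub>L 'a)) \<Rightarrow> ('a \<Rightarrow>\<^sub>L 'a) \<Rightarrow> ('a \<Rightarrow>\<^sub>L 'a)" where
  "wgeo_mean k n A X = arith_mean n (\<lambda>j. wgeo k X (A j))"

definition slope_mean ::
  "nat \<Rightarrow> nat \<Rightarrow> (nat \<Rightarrow> ('a::chilbert_space \<Rightarrow>\<^sub>L 'a)) \<Rightarrow> ('a \<Rightarrow>\<^sub>L 'a) \<Rightarrow> ('a \<Rightarrow>\<^sub>L 'a)" where
  "slope_mean k n A X = arith_mean n (\<lambda>j. slope k X (A j))"

definition log_mean ::
  "nat \<Rightarrow> (nat \<Rightarrow> ('a::chilbert_space \<Rightarrow>\<^sub>L 'a)) \<Rightarrow> ('a \<Rightarrow>\<^sub>L 'a) \<Rightarrow> ('a \<Rightarrow>\<^sub>L 'a)" where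
  "log_mean n A X = arith_mean n (\<lambda>j. op_sqrt X o\<^sub>L op_log (rel X (A j)) o\<^sub>L op_sqrt X)"

definition karcher_eq :: "nat \<Rightarrow> (nat \<Rightarrow> ('a::chilbert_space \<Rightarrow>\<^sub>L 'a)) \<Rightarrow> ('a \<Rightarrow>\<^sub>L 'a) \<Rightarrow> bool" where
  "karcher_eq n A X \<longleftrightarrow> (\<Sum>j<n. op_log (rel X (A j))) = 0"

lemma arith_mean_mono: "(\<And>j. j < n \<Longrightarrow> A j \<preceq> B j) \<Longrightarrow> arith_mean n A \<preceq> arith_mean n B"
  unfolding arith_mean_def by (intro qle_scaleR qle_sum) auto

lemma arith_mean_const: "1 \<le> n \<Longrightarrow> arith_mean n (\<lambda>j. X) = X"
  by (simp add: arith_mean_def sum_constant_scaleR)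

lemma arith_mean_add: "arith_mean n (\<lambda>j. A j + B j) = arith_mean n A + arith_mean n B"
  by (simp add: arith_mean_def sum.distrib scaleR_add_right)

lemma arith_mean_scaleR: "arith_mean n (\<lambda>j. r *\<^sub>R A j) = r *\<^sub>R arith_mean n A"
  by (simp add: arith_mean_def scaleR_sum_right mult.commute)

lemma arith_mean_sa: "(\<And>j. j < n \<Longrightarrow> selfadjoint_op (A j)) \<Longrightarrow> selfadjoint_op (arith_mean n A)"
  unfolding arith_mean_def by (intro sa_ops sa_sum) auto

lemma arith_mean_pos:
  assumes "1 \<le> n" "\<And>j. j < n \<Longrightarrow> A j \<in> pos_cone"
  shows "arith_mean n A \<in> pos_cone"
proof -
  \<comment> \<open>The induction starts at one summand, because the empty sum 0 lies in the cone
    only on the zero space.\<close>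
  have "(\<Sum>j<Suc k. A j) \<in> pos_cone" if "Suc k \<le> n" for k
    using that assms(2) by (induction k) (auto intro: pos_add)
  from this[of "n - 1"] assms(1) show ?thesis
    unfolding arith_mean_def by (intro pos_scaleR) auto
qed

lemma op_sqrt_sandwich_id: "X \<in> pos_cone \<Longrightarrow> op_sqrt X o\<^sub>L id_blinfun o\<^sub>L op_sqrt X = X"
  by (simp add: blinfun_eq_iff op_sqrt_square_apply)

lemma rel_self: "X \<in> pos_cone \<Longrightarrow> rel X X = id_blinfun"
  by (simp add: rel_def blinfun_eq_iff op_sqrt_square_apply[of X, symmetric])

lemma rel_bounds:
  assumes "X \<in> pos_cone" "exp (- s) *\<^sub>R X \<preceq> A" "A \<preceq> exp s *\<^sub>R X"
  shows "exp (- s) *\<^sub>R id_blinfun \<preceq> rel X A" "rel X A \<preceq> exp s *\<^sub>R id_blinfun"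
proof -
  have W: "selfadjoint_op (op_inv (op_sqrt X))" using assms by (intro pos_sa) simp
  have "rel X (r *\<^sub>R X) = r *\<^sub>R id_blinfun" for r
    using rel_self[OF assms(1)] by (simp add: rel_def blinfun_compose_bilinear_simps)
  then show "exp (- s) *\<^sub>R id_blinfun \<preceq> rel X A" "rel X A \<preceq> exp s *\<^sub>R id_blinfun"
    using qle_congruence[OF assms(2) W] qle_congruence[OF assms(3) W] by (simp_all add: rel_def)
qed

lemma wgeo_slope: "X \<in> pos_cone \<Longrightarrow> wgeo k X A = X + (1 / 2 ^ k) *\<^sub>R slope k X A"
  unfolding wgeo_def slope_def wroot_dlog
  by (auto simp: blinfun_eq_iff blinfun.bilinear_simps op_sqrt_square_apply)

lemma slope_antimono:
  assumes "X \<in> pos_cone" "A \<in> pos_cone" "k \<le> m"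
  shows "slope m X A \<preceq> slope k X A"
  unfolding slope_def using assms by (intro qle_congruence dlog_antimono pos_sa) auto

lemma slope_almost_mono:
  assumes X: "X \<in> pos_cone" and A: "A \<in> pos_cone"
    and b: "exp (- s) *\<^sub>R X \<preceq> A" "A \<preceq> exp s *\<^sub>R X" and "0 \<le> s" "k \<le> m"
  shows "slope k X A \<preceq> slope m X A + ((s * exp s)\<^sup>2 / 2 ^ k) *\<^sub>R X"
proof -
  have "slope k X A \<preceq> op_sqrt X o\<^sub>L (dlog m (rel X A) + ((s * exp s)\<^sup>2 / 2 ^ k) *\<^sub>R id_blinfun) o\<^sub>L op_sqrt X"
    unfolding slope_def
    using assms by (intro qle_congruence dlog_almost_mono rel_bounds pos_sa) auto
  also have "\<dots> = slope m X A + ((s * exp s)\<^sup>2 / 2 ^ k) *\<^sub>R X"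
    unfolding slope_def using X by (auto simp: blinfun_eq_iff blinfun.bilinear_simps op_sqrt_square_apply)
  finally show ?thesis .
qed

locale pos_tuple =
  fixes n :: nat and A :: "nat \<Rightarrow> ('a::chilbert_space \<Rightarrow>\<^sub>L 'a)"
  assumes n: "1 \<le> n" and pos: "\<And>j. j < n \<Longrightarrow> A j \<in> pos_cone"
begin

lemma wgeo_mean_pos: "X \<in> pos_cone \<Longrightarrow> wgeo_mean k n A X \<in> pos_cone"
  unfolding wgeo_mean_def using pos by (intro arith_mean_pos n) auto

lemma wgeo_mean_slope: "X \<in> pos_cone \<Longrightarrow> wgeo_mean k n A X = X + (1 / 2 ^ k) *\<^sub>R slope_mean k n A X"
  by (simp add: wgeo_mean_def slope_mean_def wgeo_slope arith_mean_add arith_mean_scaleR arith_mean_const[OF n])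

lemma slope_mean_antimono: "X \<in> pos_cone \<Longrightarrow> k \<le> m \<Longrightarrow> slope_mean m n A X \<preceq> slope_mean k n A X"
  unfolding slope_mean_def using pos by (intro arith_mean_mono slope_antimono) auto

lemma slope_mean_almost_mono:
  assumes "X \<in> pos_cone" "\<And>j. j < n \<Longrightarrow> exp (- s) *\<^sub>R X \<preceq> A j" "\<And>j. j < n \<Longrightarrow> A j \<preceq> exp s *\<^sub>R X"
    "0 \<le> s" "k \<le> m"
  shows "slope_mean k n A X \<preceq> slope_mean m n A X + ((s * exp s)\<^sup>2 / 2 ^ k) *\<^sub>R X"
proof -
  have "slope_mean k n A X \<preceq> arith_mean n (\<lambda>j. slope m X (A j) + ((s * exp s)\<^sup>2 / 2 ^ k) *\<^sub>R X)"
    unfolding slope_mean_def using assms pos by (intro arith_mean_mono slope_almost_mono) auto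
  then show ?thesis by (simp add: slope_mean_def arith_mean_add arith_mean_const[OF n])
qed

lemma slope_mean_tendsto:
  assumes "X \<in> pos_cone"
  shows "(\<lambda>k. slope_mean k n A X) \<longlonglongrightarrow> log_mean n A X"
  unfolding slope_mean_def log_mean_def arith_mean_def slope_def
  using assms pos
  by (intro tendsto_scaleR tendsto_const tendsto_sum dlog_tendsto_op_log rel_pos
      bounded_bilinear.tendsto[OF bounded_bilinear_blinfun_compose]) auto

lemma karcher_eq_iff:
  assumes "X \<in> pos_cone"
  shows "karcher_eq n A X \<longleftrightarrow> log_mean n A X = 0"
proof -
  let ?S = "\<Sum>j<n. op_log (rel X (A j))"
  have "log_mean n A X = (1 / real n) *\<^sub>R (op_sqrt X o\<^sub>L ?S o\<^sub>L op_sqrt X)"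
    by (simp add: log_mean_def arith_mean_def bounded_bilinear.sum_left[OF bounded_bilinear_blinfun_compose]
        bounded_bilinear.sum_right[OF bounded_bilinear_blinfun_compose])
  then have "log_mean n A X = 0 \<longleftrightarrow> op_sqrt X o\<^sub>L ?S o\<^sub>L op_sqrt X = 0" using n by simp
  also have "\<dots> \<longleftrightarrow> ?S = 0"
  proof
    assume *: "op_sqrt X o\<^sub>L ?S o\<^sub>L op_sqrt X = 0"
    have "?S x = op_inv (op_sqrt X) ((op_sqrt X o\<^sub>L ?S o\<^sub>L op_sqrt X) (op_inv (op_sqrt X) x))" for x
      using assms by simp
    then show "?S = 0" unfolding * by (simp add: blinfun_eq_iff)
  qed simp
  finally show ?thesis by (simp add: karcher_eq_def)
qed

text \<open>The slopes decrease to \<open>log_mean n A X = 0\<close>, so each of them is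
  positive.\<close>

lemma karcher_eq_wgeo_mean_lower:
  assumes X: "X \<in> pos_cone" and eq: "karcher_eq n A X"
  shows "X \<preceq> wgeo_mean k n A X"
proof -
  have "log_mean n A X \<preceq> slope_mean k n A X"
    by (rule qle_limit[OF slope_mean_tendsto[OF X] tendsto_const])
      (auto intro: eventually_sequentiallyI slope_mean_antimono X)
  then have "0 \<preceq> slope_mean k n A X" using eq X by (simp add: karcher_eq_iff)
  then show ?thesis
    unfolding wgeo_mean_slope[OF X] by (auto simp: qle_def blinfun.bilinear_simps inner_simps)
qed

text \<open>The slope exceeds its limit 0 by \<open>O(t)\<close>, and the step multiplies it by
  another \<open>t\<close>. The defect \<open>O(t\<^sup>2)\<close> is small even against the
  contraction gap \<open>t\<close>.\<close>

lemma karcher_eq_wgeo_mean_upper: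
  assumes X: "X \<in> pos_cone" and eq: "karcher_eq n A X"
    and b: "\<And>j. j < n \<Longrightarrow> exp (- s) *\<^sub>R X \<preceq> A j" "\<And>j. j < n \<Longrightarrow> A j \<preceq> exp s *\<^sub>R X" "0 \<le> s"
  shows "wgeo_mean k n A X \<preceq> (1 + (s * exp s)\<^sup>2 / 2 ^ k / 2 ^ k) *\<^sub>R X"
proof -
  let ?c = "(s * exp s)\<^sup>2 / 2 ^ k"
  have "slope_mean k n A X \<preceq> log_mean n A X + ?c *\<^sub>R X"
    by (rule qle_limit[OF tendsto_const tendsto_add[OF slope_mean_tendsto[OF X] tendsto_const]])
      (auto intro: eventually_sequentiallyI slope_mean_almost_mono X b)
  then have "slope_mean k n A X \<preceq> ?c *\<^sub>R X" using eq X by (simp add: karcher_eq_iff)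
  from qle_add[OF qle_refl[of X] qle_scaleR[OF this, of "1 / 2 ^ k"]] show ?thesis
    unfolding wgeo_mean_slope[OF X] by (simp add: scaleR_add_left)
qed

text \<open>Converse of the two preceding bounds: division by the step \<open>t\<close> leaves
  slopes between 0 and \<open>c / 2 ^ k\<close> times \<open>X\<close>, so their limit
  vanishes.\<close>

lemma karcher_eqI:
  assumes X: "X \<in> pos_cone" and low: "\<And>k. X \<preceq> wgeo_mean k n A X"
    and up: "\<And>k. wgeo_mean k n A X \<preceq> (1 + c / 2 ^ k / 2 ^ k) *\<^sub>R X"
  shows "karcher_eq n A X"
proof -
  have "0 \<preceq> slope_mean k n A X" for k
  proof -
    have "(1 / 2 ^ k) *\<^sub>R 0 \<preceq> (1 / 2 ^ k) *\<^sub>R slope_mean k n A X"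
      using low[of k] unfolding wgeo_mean_slope[OF X]
      by (simp add: qle_def blinfun.add_left inner_simps)
    then show ?thesis by (subst (asm) qle_scaleR_iff) auto
  qed
  then have "0 \<preceq> log_mean n A X"
    by (intro qle_limit[OF tendsto_const slope_mean_tendsto[OF X]]) auto
  moreover have "slope_mean k n A X \<preceq> (c / 2 ^ k) *\<^sub>R X" for k
    using up[of k] unfolding wgeo_mean_slope[OF X]
    by (auto simp: qle_def blinfun.bilinear_simps inner_simps field_simps)
  then have "log_mean n A X \<preceq> 0 *\<^sub>R X"
    by (intro qle_limit[OF slope_mean_tendsto[OF X] tendsto_scaleR[OF tendsto_divide_pow2[of c] tendsto_const]]) auto
  moreover have "selfadjoint_op (log_mean n A X)"
    unfolding log_mean_def using X pos by (intro arith_mean_sa sa_congruence op_log_sa pos_sa) auto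
  ultimately show ?thesis using X by (simp add: karcher_eq_iff sa_eqI sa_ops)
qed

end

section \<open>Comparison of approximate solutions and uniqueness\<close>

lemma pos_exp_le:
  assumes "Y \<in> pos_cone" "s \<le> r"
  shows "exp s *\<^sub>R Y \<preceq> exp r *\<^sub>R Y"
  using pos_ge_0[OF assms(1)] assms(2)
  by (auto simp: qle_def blinfun.bilinear_simps mult_right_mono)

lemma pos_scale_le: "Y \<in> pos_cone \<Longrightarrow> s \<le> r \<Longrightarrow> s *\<^sub>R Y \<preceq> r *\<^sub>R Y"
  by (auto simp: qle_def blinfun.bilinear_simps mult_right_mono dest!: pos_ge_0)

lemma qle_exp_trans: "X \<preceq> exp s *\<^sub>R Y \<Longrightarrow> Y \<preceq> exp r *\<^sub>R Z \<Longrightarrow> X \<preceq> exp (s + r) *\<^sub>R Z"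
  using qle_trans qle_scaleR[of Y "exp r *\<^sub>R Z" "exp s"] by (auto simp: exp_add)

lemma qle_exp_minus: "exp (- s) *\<^sub>R X \<preceq> Y \<longleftrightarrow> X \<preceq> exp s *\<^sub>R Y"
  using qle_scaleR_iff[of "exp s" "exp (- s) *\<^sub>R X" Y] by (simp flip: exp_add)

lemma qle_step:
  assumes "0 < t"
  shows "X + t *\<^sub>R S \<preceq> (1 + t * r) *\<^sub>R X \<longleftrightarrow> S \<preceq> r *\<^sub>R X"
    and "(1 - t * r) *\<^sub>R X \<preceq> X + t *\<^sub>R S \<longleftrightarrow> (- r) *\<^sub>R X \<preceq> S"
  unfolding qle_scaleR_iff[OF assms, of S, symmetric] qle_scaleR_iff[OF assms, of _ S, symmetric]
  unfolding qle_def
  by ((rule iff_allI, simp add: blinfun.bilinear_simps inner_simps algebra_simps; linarith?)+)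

lemma pos_comparable:
  assumes "X \<in> pos_cone" "Y \<in> pos_cone"
  shows "\<exists>s\<ge>0. X \<preceq> exp s *\<^sub>R Y"
proof -
  obtain s where s: "0 \<le> s" "X \<preceq> exp s *\<^sub>R id_blinfun" using pos_exp_bounds[OF assms(1)] by blast
  obtain r where r: "0 \<le> r" "id_blinfun \<preceq> exp r *\<^sub>R Y"
    using pos_exp_bounds[OF assms(2)] unfolding qle_exp_minus by blast
  have "X \<preceq> exp (s + r) *\<^sub>R Y" using s r qle_exp_trans by blast
  with s r show ?thesis by (intro exI[of _ "s + r"]) auto
qed

text \<open>If \<open>c\<close> is the least exponent with \<open>X \<le> e\<^sup>c Y\<close>, then the contraction property of the weighted
  geometric means yields \<open>c \<le> (1 - t) c + t r + d\<^sub>1 + d\<^sub>2\<close> for \<open>t = 1 / 2 ^ k\<close>.\<close>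

lemma wgeo_mean_compare:
  assumes A: "pos_tuple n A" and B: "pos_tuple n B" and X: "X \<in> pos_cone" and Y: "Y \<in> pos_cone"
    and AB: "\<And>j. j < n \<Longrightarrow> A j \<preceq> exp r *\<^sub>R B j" and r: "0 \<le> r"
    and low: "X \<preceq> exp d1 *\<^sub>R wgeo_mean k n A X" and up: "wgeo_mean k n B Y \<preceq> exp d2 *\<^sub>R Y"
    and d: "0 \<le> d1 + d2"
  shows "X \<preceq> exp (r + 2 ^ k * (d1 + d2)) *\<^sub>R Y"
proof -
  interpret A: pos_tuple n A by fact
  interpret B: pos_tuple n B by fact
  define M where "M = {c. 0 \<le> c \<and> X \<preceq> exp c *\<^sub>R Y}"
  have "M \<noteq> {}" using pos_comparable[OF X Y] by (auto simp: M_def)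
  moreover have "closed M"
    unfolding M_def qle_def
    by (intro closed_Collect_conj closed_Collect_le closed_Collect_all continuous_intros)
  moreover have bdd: "bdd_below M" by (auto simp: M_def)
  ultimately have "Inf M \<in> M" using closed_contains_Inf by blast
  define c where "c = Inf M"
  have c: "0 \<le> c" "X \<preceq> exp c *\<^sub>R Y" using \<open>Inf M \<in> M\<close> by (auto simp: M_def c_def)
  let ?t = "1 / 2 ^ k :: real"
  let ?e = "(1 - ?t) * c + r / 2 ^ k"
  have "wgeo_mean k n A X \<preceq> arith_mean n (\<lambda>j. exp ?e *\<^sub>R wgeo k Y (B j))"
    unfolding wgeo_mean_def using A.pos B.pos X Y c AB by (intro arith_mean_mono wgeo_mono) auto
  then have "wgeo_mean k n A X \<preceq> exp ?e *\<^sub>R wgeo_mean k n B Y"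
    by (simp add: arith_mean_scaleR wgeo_mean_def)
  from qle_exp_trans[OF low qle_exp_trans[OF this up]]
  have "X \<preceq> exp (d1 + (?e + d2)) *\<^sub>R Y" .
  moreover have "0 \<le> ?e" using c r by simp
  ultimately have "d1 + (?e + d2) \<in> M" using d by (simp add: M_def)
  then have "c \<le> d1 + (?e + d2)" unfolding c_def using bdd by (rule cInf_lower)
  \<comment> \<open>Cancelling \<open>(1 - t) c\<close> leaves \<open>t c\<close> on the left;
    division by \<open>t\<close> produces the factor \<open>2 ^ k\<close>.\<close>
  then have "c \<le> r + 2 ^ k * (d1 + d2)" by (simp add: field_simps)
  from pos_exp_le[OF Y this] c(2) show ?thesis using qle_trans by blast
qed

text \<open>A solution has lower defect 0 and upper defect \<open>O(4^-k)\<close> at level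
  \<open>k\<close>, so the comparison leaves an error \<open>O(2^-k)\<close> in the exponent, which
  is sent to 0.\<close>

lemma karcher_eq_mono:
  assumes A: "pos_tuple n A" and B: "pos_tuple n B" and X: "X \<in> pos_cone" and Y: "Y \<in> pos_cone"
    and AB: "\<And>j. j < n \<Longrightarrow> A j \<preceq> exp r *\<^sub>R B j" and r: "0 \<le> r"
    and eqX: "karcher_eq n A X" and eqY: "karcher_eq n B Y"
  shows "X \<preceq> exp r *\<^sub>R Y"
proof -
  interpret A: pos_tuple n A by fact
  interpret B: pos_tuple n B by fact
  obtain s where s: "0 \<le> s" "\<And>j. j < n \<Longrightarrow> exp (- s) *\<^sub>R Y \<preceq> B j" "\<And>j. j < n \<Longrightarrow> B j \<preceq> exp s *\<^sub>R Y"
  proof -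
    have "\<forall>j\<in>{..<n}. \<exists>s\<ge>0. B j \<preceq> exp s *\<^sub>R Y" "\<forall>j\<in>{..<n}. \<exists>s\<ge>0. Y \<preceq> exp s *\<^sub>R B j"
      using B.pos Y pos_comparable by blast+
    then obtain f g where f: "\<And>j. j < n \<Longrightarrow> 0 \<le> f j \<and> B j \<preceq> exp (f j) *\<^sub>R Y"
      and g: "\<And>j. j < n \<Longrightarrow> 0 \<le> g j \<and> Y \<preceq> exp (g j) *\<^sub>R B j" by (metis lessThan_iff)
    \<comment> \<open>One exponent for both families: a sum of nonnegative numbers bounds each of
      them.\<close>
    let ?s = "(\<Sum>j<n. f j) + (\<Sum>j<n. g j)"
    have le: "f j \<le> ?s" "g j \<le> ?s" if "j < n" for j
    proof -
      have "f j \<le> (\<Sum>j<n. f j)" "g j \<le> (\<Sum>j<n. g j)"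
        using that f g by (auto intro!: member_le_sum)
      moreover have "0 \<le> (\<Sum>j<n. f j)" "0 \<le> (\<Sum>j<n. g j)"
        using f g by (auto intro!: sum_nonneg)
      ultimately show "f j \<le> ?s" "g j \<le> ?s" by linarith+
    qed
    show thesis
    proof (rule that[of ?s])
      show "0 \<le> ?s" using f g by (intro add_nonneg_nonneg sum_nonneg) auto
      show "exp (- ?s) *\<^sub>R Y \<preceq> B j" if "j < n" for j
        unfolding qle_exp_minus using that g B.pos le pos_exp_le qle_trans by blast
      show "B j \<preceq> exp ?s *\<^sub>R Y" if "j < n" for j
        using that f Y le pos_exp_le qle_trans by blast
    qed
  qed
  let ?C = "(s * exp s)\<^sup>2"
  have *: "X \<preceq> exp (r + ?C / 2 ^ k) *\<^sub>R Y" for k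
  proof -
    let ?d = "?C / 2 ^ k / 2 ^ k"
    have "wgeo_mean k n B Y \<preceq> (1 + ?d) *\<^sub>R Y"
      by (rule B.karcher_eq_wgeo_mean_upper[OF Y eqY s(2,3,1)])
    also have "\<dots> \<preceq> exp ?d *\<^sub>R Y" by (rule pos_scale_le[OF Y exp_ge_add_one_self])
    finally have up: "wgeo_mean k n B Y \<preceq> exp ?d *\<^sub>R Y" .
    have "X \<preceq> exp 0 *\<^sub>R wgeo_mean k n A X"
      using A.karcher_eq_wgeo_mean_lower[OF X eqX] by simp
    from wgeo_mean_compare[OF A B X Y AB r this up] show ?thesis by simp
  qed
  have "(\<lambda>k. exp (r + ?C / 2 ^ k) *\<^sub>R Y) \<longlonglongrightarrow> exp (r + 0) *\<^sub>R Y"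
    by (intro tendsto_intros tendsto_divide_pow2)
  from qle_limit[OF tendsto_const this always_eventually] * show ?thesis by simp
qed

lemma karcher_eq_unique:
  assumes "pos_tuple n A" "X \<in> pos_cone" "Y \<in> pos_cone" "karcher_eq n A X" "karcher_eq n A Y"
  shows "X = Y"
  using karcher_eq_mono[of n A A X Y 0] karcher_eq_mono[of n A A Y X 0] assms
  by (intro sa_eqI) (auto simp: pos_sa)

text \<open>Thompson distance controls norm distance: \<open>X - Y\<close> lies between
  \<open>- (exp u - 1)\<close> and \<open>exp u - 1\<close> times \<open>Y\<close>, the lower bound
  because \<open>2 - exp u \<le> exp (- u)\<close>.\<close>

lemma norm_diff_exp_le:
  assumes X: "X \<in> pos_cone" and Y: "Y \<in> pos_cone"
    and XY: "X \<preceq> exp u *\<^sub>R Y" and YX: "Y \<preceq> exp u *\<^sub>R X" and u: "0 \<le> u"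
  shows "norm (X - Y) \<le> (exp u - 1) * norm Y"
proof (rule sa_norm_between)
  show "selfadjoint_op (X - Y)" using X Y by (intro sa_ops pos_sa)
  show "X - Y \<preceq> (exp u - 1) *\<^sub>R Y"
    using XY by (auto simp: qle_def blinfun.bilinear_simps inner_simps algebra_simps)
  have "exp (- u) *\<^sub>R Y \<preceq> X" using YX by (simp add: qle_exp_minus)
  moreover have "(2 - exp u) *\<^sub>R Y \<preceq> exp (- u) *\<^sub>R Y"
  proof (rule pos_scale_le[OF Y])
    have "1 - exp (- u) \<le> u" using exp_ge_add_one_self[of "- u"] by linarith
    then show "2 - exp u \<le> exp (- u)" using exp_ge_add_one_self[of u] by linarith
  qed
  ultimately have "(2 - exp u) *\<^sub>R Y \<preceq> X" using qle_trans by blast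
  then show "- (exp u - 1) *\<^sub>R Y \<preceq> X - Y"
    by (auto simp: qle_def blinfun.bilinear_simps inner_simps algebra_simps)
qed (use u in auto)

section \<open>Approximate fixed points and existence of the Karcher mean\<close>

lemma op_sqrt_id [simp]: "op_sqrt id_blinfun = id_blinfun"
  using op_sqrt_scaled_id[of 1] by simp

lemma wroot_id [simp]: "wroot k id_blinfun = id_blinfun"
  by (induction k) (simp_all add: wroot_Suc)

lemma wgeo_id: "wgeo k id_blinfun id_blinfun = id_blinfun"
  by (simp add: wgeo_def rel_self pos_id blinfun_compose_id)

context pos_tuple
begin

lemma wgeo_mean_mono:
  assumes "X \<in> pos_cone" "Y \<in> pos_cone" "X \<preceq> exp c *\<^sub>R Y"
  shows "wgeo_mean k n A X \<preceq> exp ((1 - 1 / 2 ^ k) * c) *\<^sub>R wgeo_mean k n A Y"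
proof -
  have "wgeo_mean k n A X \<preceq> arith_mean n (\<lambda>j. exp ((1 - 1 / 2 ^ k) * c + 0 / 2 ^ k) *\<^sub>R wgeo k Y (A j))"
    unfolding wgeo_mean_def using pos assms by (intro arith_mean_mono wgeo_mono) auto
  then show ?thesis by (simp add: arith_mean_scaleR wgeo_mean_def)
qed

text \<open>The order interval from \<open>exp (- p)\<close> to \<open>exp p\<close> is invariant:
  compare with the weighted mean of identities, where the exponents combine to
  \<open>(1 - t) p + t p = p\<close>.\<close>

lemma wgeo_mean_box:
  assumes X: "X \<in> pos_cone" "exp (- p) *\<^sub>R id_blinfun \<preceq> X" "X \<preceq> exp p *\<^sub>R id_blinfun"
    and A: "\<And>j. j < n \<Longrightarrow> exp (- p) *\<^sub>R id_blinfun \<preceq> A j" "\<And>j. j < n \<Longrightarrow> A j \<preceq> exp p *\<^sub>R id_blinfun"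
  shows "exp (- p) *\<^sub>R id_blinfun \<preceq> wgeo_mean k n A X" "wgeo_mean k n A X \<preceq> exp p *\<^sub>R id_blinfun"
proof -
  have e: "(1 - 1 / 2 ^ k) * p + p / 2 ^ k = p" by (simp add: algebra_simps)
  have 1: "wgeo k X (A j) \<preceq> exp p *\<^sub>R id_blinfun" if "j < n" for j
    using wgeo_mono[of X id_blinfun "A j" id_blinfun p p k] pos X A that pos_id by (simp add: e wgeo_id)
  have 2: "exp (- p) *\<^sub>R id_blinfun \<preceq> wgeo k X (A j)" if "j < n" for j
    using wgeo_mono[of id_blinfun X id_blinfun "A j" p p k] pos X A that pos_id
    by (simp add: e wgeo_id qle_exp_minus)
  have "wgeo_mean k n A X \<preceq> arith_mean n (\<lambda>j. exp p *\<^sub>R id_blinfun)"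
    unfolding wgeo_mean_def using 1 by (intro arith_mean_mono) auto
  then show "wgeo_mean k n A X \<preceq> exp p *\<^sub>R id_blinfun" by (simp only: arith_mean_const[OF n])
  have "arith_mean n (\<lambda>j. exp (- p) *\<^sub>R id_blinfun) \<preceq> wgeo_mean k n A X"
    unfolding wgeo_mean_def using 2 by (intro arith_mean_mono) auto
  then show "exp (- p) *\<^sub>R id_blinfun \<preceq> wgeo_mean k n A X" by (simp only: arith_mean_const[OF n])
qed

text \<open>Iterates of the contraction from the identity stay in the box, and successive ones are
  within \<open>(1 - t) ^ m * 2 p\<close>; a late enough iterate meets the tolerance.\<close>

lemma wgeo_mean_approx_fixed:
  assumes p: "0 \<le> p" and \<delta>: "0 < \<delta>"
    and A: "\<And>j. j < n \<Longrightarrow> exp (- p) *\<^sub>R id_blinfun \<preceq> A j" "\<And>j. j < n \<Longrightarrow> A j \<preceq> exp p *\<^sub>R id_blinfun"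
  shows "\<exists>X\<in>pos_cone. exp (- p) *\<^sub>R id_blinfun \<preceq> X \<and> X \<preceq> exp p *\<^sub>R id_blinfun \<and>
    X \<preceq> exp \<delta> *\<^sub>R wgeo_mean k n A X \<and> wgeo_mean k n A X \<preceq> exp \<delta> *\<^sub>R X"
proof -
  define x where "x m = (wgeo_mean k n A ^^ m) id_blinfun" for m
  have x_Suc: "x (Suc m) = wgeo_mean k n A (x m)" for m by (simp add: x_def)
  have box: "x m \<in> pos_cone \<and> exp (- p) *\<^sub>R id_blinfun \<preceq> x m \<and> x m \<preceq> exp p *\<^sub>R id_blinfun" for m
  proof (induction m)
    case 0
    then show ?case using pos_id pos_exp_le[OF pos_id, of "- p" 0] pos_exp_le[OF pos_id, of 0 p] p by (simp add: x_def)
  next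
    case (Suc m)
    then show ?case unfolding x_Suc using wgeo_mean_box A wgeo_mean_pos by blast
  qed
  let ?q = "1 - 1 / 2 ^ k :: real"
  have near: "x m \<preceq> exp (?q ^ m * (p + p)) *\<^sub>R x (Suc m) \<and> x (Suc m) \<preceq> exp (?q ^ m * (p + p)) *\<^sub>R x m" for m
  proof (induction m)
    case 0
    have "x i \<preceq> exp (p + p) *\<^sub>R x j" for i j
      using box[of i] box[of j] by (intro qle_exp_trans[of _ _ id_blinfun]) (auto simp: qle_exp_minus)
    then show ?case by simp
  next
    case (Suc m)
    then show ?case
      using wgeo_mean_mono[of "x m" "x (Suc m)" "?q ^ m * (p + p)" k]
        wgeo_mean_mono[of "x (Suc m)" "x m" "?q ^ m * (p + p)" k] box[of m] box[of "Suc m"]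
      by (simp add: x_Suc mult.assoc)
  qed
  have "(\<lambda>m. ?q ^ m * (p + p)) \<longlonglongrightarrow> 0 * (p + p)"
    by (intro tendsto_intros LIMSEQ_realpow_zero) auto
  then have "\<forall>\<^sub>F m in sequentially. ?q ^ m * (p + p) < \<delta>"
    using \<delta> by (auto dest: order_tendstoD(2))
  then obtain m where "?q ^ m * (p + p) < \<delta>"
    unfolding eventually_sequentially by blast
  then have m: "?q ^ m * (p + p) \<le> \<delta>" by (rule less_imp_le)
  have "x m \<preceq> exp \<delta> *\<^sub>R x (Suc m)" "x (Suc m) \<preceq> exp \<delta> *\<^sub>R x m"
    using near[of m] box pos_exp_le[OF _ m] qle_trans by blast+
  then show ?thesis using box[of m] unfolding x_Suc by blast
qed

text \<open>Since \<open>(Z\<^sup>t - 1) / t\<close> depends on \<open>t\<close> only up to \<open>O(t)\<close>, an approximate fixed point at level \<open>k\<close>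
  is still one at each finer level \<open>m\<close>, with an error \<open>O(2\<^sup>-\<^sup>k 2\<^sup>-\<^sup>m)\<close>.\<close>

lemma karcher_exists: "\<exists>X\<in>pos_cone. karcher_eq n A X"
proof -
  obtain p where p: "0 \<le> p" and A: "\<And>j. j < n \<Longrightarrow> exp (- p) *\<^sub>R id_blinfun \<preceq> A j"
    "\<And>j. j < n \<Longrightarrow> A j \<preceq> exp p *\<^sub>R id_blinfun"
  proof -
    have "\<exists>s\<ge>0. \<forall>r\<ge>s. exp (- r) *\<^sub>R id_blinfun \<preceq> A j \<and> A j \<preceq> exp r *\<^sub>R id_blinfun" if "j < n" for j
      using pos_exp_bounds[OF pos[OF that]] .
    then obtain f where f: "\<And>j. j < n \<Longrightarrow> 0 \<le> f j \<and>
        (\<forall>r\<ge>f j. exp (- r) *\<^sub>R id_blinfun \<preceq> A j \<and> A j \<preceq> exp r *\<^sub>R id_blinfun)" by metis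
    moreover have "f j \<le> (\<Sum>j<n. f j)" if "j < n" for j
      using that f by (auto intro!: member_le_sum)
    moreover have "0 \<le> (\<Sum>j<n. f j)" using f by (auto intro!: sum_nonneg)
    ultimately show thesis using that by blast
  qed
  \<comment> \<open>Tolerance \<open>t\<^sup>2\<close> for step \<open>t = 1 / 2 ^ k\<close>:
    divided by the step it gives slopes of size \<open>O(t)\<close>, and divided by the contraction
    gap it still gives a comparison error \<open>O(t)\<close>.\<close>
  have "\<exists>X\<in>pos_cone. exp (- p) *\<^sub>R id_blinfun \<preceq> X \<and> X \<preceq> exp p *\<^sub>R id_blinfun \<and>
      X \<preceq> exp (1 / 2 ^ k / 2 ^ k) *\<^sub>R wgeo_mean k n A X \<and> wgeo_mean k n A X \<preceq> exp (1 / 2 ^ k / 2 ^ k) *\<^sub>R X" for k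
    by (intro wgeo_mean_approx_fixed p A) auto
  then obtain X where Xpos: "\<And>k. X k \<in> pos_cone"
    and box: "\<And>k. exp (- p) *\<^sub>R id_blinfun \<preceq> X k" "\<And>k. X k \<preceq> exp p *\<^sub>R id_blinfun"
    and fix_low: "\<And>k. X k \<preceq> exp (1 / 2 ^ k / 2 ^ k) *\<^sub>R wgeo_mean k n A (X k)"
    and fix_up: "\<And>k. wgeo_mean k n A (X k) \<preceq> exp (1 / 2 ^ k / 2 ^ k) *\<^sub>R X k" by metis
  let ?t = "\<lambda>k. 1 / 2 ^ k :: real"
  \<comment> \<open>Both \<open>X k\<close> and the \<open>A j\<close> are within \<open>p\<close>
    of the identity. \<open>C\<close> is the resulting constant of
    \<open>slope_mean_almost_mono\<close>, and \<open>c\<close> adds the 2 from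
    \<open>M_low\<close>.\<close>
  define s where "s = p + p"
  define C where "C = (s * exp s)\<^sup>2"
  define c where "c = C + 2"
  have s: "0 \<le> s" using p by (simp add: s_def)
  have C: "0 \<le> C" by (simp add: C_def)
  have t: "0 < ?t k" "?t k \<le> 1" for k by auto
  have tmono: "?t m \<le> ?t k" if "k \<le> m" for k m using that by (simp add: field_simps power_increasing)
  have XA: "exp (- s) *\<^sub>R X k \<preceq> A j" "A j \<preceq> exp s *\<^sub>R X k" if "j < n" for j k
    using qle_exp_trans[of "X k" p id_blinfun p "A j"] qle_exp_trans[of "A j" p id_blinfun p "X k"] box A that
    by (auto simp: qle_exp_minus s_def)
  have M_up: "slope_mean k n A (X k) \<preceq> (2 * ?t k) *\<^sub>R X k" for k
  proof -
    define w where "w = ?t k / 2 ^ k"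
    have w: "0 \<le> w" "w \<le> 1" using mult_mono[of "?t k" 1 "?t k" 1] t[of k] by (auto simp: w_def)
    have "exp w \<le> 1 + w + w\<^sup>2" using w by (intro exp_bound)
    also have "\<dots> \<le> 1 + 2 * w" using w by (simp add: power2_eq_square mult_left_le)
    finally have "exp (?t k / 2 ^ k) \<le> 1 + 2 * ?t k / 2 ^ k" by (simp add: w_def)
    then have "exp (?t k / 2 ^ k) *\<^sub>R X k \<preceq> (1 + 2 * ?t k / 2 ^ k) *\<^sub>R X k" by (rule pos_scale_le[OF Xpos])
    with fix_up[of k] have "wgeo_mean k n A (X k) \<preceq> (1 + 2 * ?t k / 2 ^ k) *\<^sub>R X k" by (rule qle_trans)
    then show ?thesis unfolding wgeo_mean_slope[OF Xpos]
      using qle_step(1)[of "?t k" "X k" "slope_mean k n A (X k)" "2 * ?t k"] by simp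
  qed
  have M_low: "(- (2 * ?t k)) *\<^sub>R X k \<preceq> slope_mean k n A (X k)" for k
  proof -
    have "(1 - 2 * ?t k / 2 ^ k) *\<^sub>R X k \<preceq> exp (- (?t k / 2 ^ k)) *\<^sub>R X k"
    proof (rule pos_scale_le[OF Xpos])
      show "1 - 2 * ?t k / 2 ^ k \<le> exp (- (?t k / 2 ^ k))"
        using exp_ge_add_one_self[of "- (?t k / 2 ^ k)"] t[of k] by (simp add: field_simps)
    qed
    also have "\<dots> \<preceq> wgeo_mean k n A (X k)" using fix_low[of k] by (simp add: qle_exp_minus)
    finally show ?thesis unfolding wgeo_mean_slope[OF Xpos]
      using qle_step(2)[of "?t k" "2 * ?t k" "X k" "slope_mean k n A (X k)"] by simp
  qed
  \<comment> \<open>Finer levels \<open>m \<ge> k\<close>: the slopes decrease, so the upper bound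
    persists and the lower one loses \<open>C / 2 ^ k\<close>. These two bounds make the sequence
    Cauchy.\<close>
  have T_up: "wgeo_mean m n A (X k) \<preceq> (1 + ?t m * (2 * ?t k)) *\<^sub>R X k" if "k \<le> m" for k m
    unfolding wgeo_mean_slope[OF Xpos] qle_step(1)[OF t(1)]
    using slope_mean_antimono[OF Xpos that] M_up by (rule qle_trans)
  have T_low: "(1 - ?t m * (c * ?t k)) *\<^sub>R X k \<preceq> wgeo_mean m n A (X k)" if "k \<le> m" for k m
  proof -
    have "slope_mean k n A (X k) \<preceq> slope_mean m n A (X k) + (C / 2 ^ k) *\<^sub>R X k"
      unfolding C_def by (rule slope_mean_almost_mono[OF Xpos XA s that])
    from qle_add[OF qle_trans[OF M_low this] qle_refl[of "(- (C * ?t k)) *\<^sub>R X k"]]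
    have "(- (2 * ?t k)) *\<^sub>R X k + (- (C * ?t k)) *\<^sub>R X k \<preceq> slope_mean m n A (X k)" by simp
    then have "(- (c * ?t k)) *\<^sub>R X k \<preceq> slope_mean m n A (X k)"
      by (simp only: c_def ring_distribs minus_add_distrib scaleR_add_left add.commute)
    then show ?thesis unfolding wgeo_mean_slope[OF Xpos] qle_step(2)[OF t(1)] .
  qed
  \<comment> \<open>Coarser levels \<open>m \<le> k\<close>: these serve the limit
    \<open>k \<rightarrow> \<infinity>\<close> at fixed \<open>m\<close>. The surviving error is
    \<open>C / 4 ^ m\<close>, exactly what \<open>karcher_eqI\<close> tolerates.\<close>
  have T_low': "(1 - ?t m * (2 * ?t k)) *\<^sub>R X k \<preceq> wgeo_mean m n A (X k)" if "m \<le> k" for k m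
  proof -
    have "(- (2 * ?t k)) *\<^sub>R X k \<preceq> slope_mean m n A (X k)"
      using M_low slope_mean_antimono[OF Xpos that] by (rule qle_trans)
    then show ?thesis unfolding wgeo_mean_slope[OF Xpos] qle_step(2)[OF t(1)] .
  qed
  have T_up': "wgeo_mean m n A (X k) \<preceq> (1 + ?t m * (2 * ?t k + C * ?t m)) *\<^sub>R X k" if "m \<le> k" for k m
  proof -
    have "slope_mean m n A (X k) \<preceq> slope_mean k n A (X k) + (C / 2 ^ m) *\<^sub>R X k"
      unfolding C_def by (rule slope_mean_almost_mono[OF Xpos XA s that])
    also have "\<dots> \<preceq> (2 * ?t k) *\<^sub>R X k + (C / 2 ^ m) *\<^sub>R X k" by (intro qle_add M_up qle_refl)
    also have "\<dots> = (2 * ?t k + C * ?t m) *\<^sub>R X k" by (simp add: scaleR_add_left)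
    finally have "slope_mean m n A (X k) \<preceq> (2 * ?t k + C * ?t m) *\<^sub>R X k" .
    then show ?thesis unfolding wgeo_mean_slope[OF Xpos] qle_step(1)[OF t(1)] .
  qed
  \<comment> \<open>From \<open>k0\<close> on the defect \<open>u\<close> below is at most 1/2, the
    range in which \<open>exp (- (2 * u)) \<le> 1 - u\<close> is shown.\<close>
  obtain k0 where k0: "\<And>k. k0 \<le> k \<Longrightarrow> c / 2 ^ k < 1 / 2"
    using eventually_divide_pow2_less[of "1/2" c] by (auto simp: eventually_sequentially)
  \<comment> \<open>After multiplication by \<open>2 ^ m\<close>, the defect \<open>2 * u\<close> of
    \<open>X k\<close> contributes \<open>2 * c\<close> and the tolerance of \<open>X m\<close>
    contributes 1.\<close>
  define K where "K = 2 * c + 1"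
  have K: "0 \<le> K" using C by (simp add: K_def c_def)
  have self: "pos_tuple n A" by unfold_locales
  have compare: "X k \<preceq> exp (K * ?t k) *\<^sub>R X m \<and> X m \<preceq> exp (K * ?t k) *\<^sub>R X k" if km: "k0 \<le> k" "k \<le> m" for k m
  proof
    define u where "u = ?t m * (c * ?t k)"
    have u0: "0 \<le> u" using C by (simp add: u_def c_def)
    have "u \<le> 1 * (c * ?t k)"
      unfolding u_def using t[of m] C t[of k] by (intro mult_right_mono) (auto simp: c_def)
    also have "\<dots> = c / 2 ^ k" by simp
    finally have u: "u \<le> 1 / 2" using k0[OF km(1)] by linarith
    have tm: "?t m / 2 ^ m * 2 ^ m \<le> ?t k" using tmono[OF km(2)] by simp
    have "exp (- (2 * u)) \<le> 1 - u"
    proof -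
      \<comment> \<open>The product expands to \<open>1 + u - u * u * (1 + u)\<close>.\<close>
      have "1 \<le> (1 + u) * (1 + u) * (1 - u)"
      proof -
        have "u * u * (1 + u) \<le> u * (1/2) * (3/2)" using u u0 by (intro mult_mono) auto
        then have "u * u * (1 + u) \<le> u" using u0 by linarith
        then show ?thesis by (simp add: algebra_simps)
      qed
      moreover have "(1 + u) * (1 + u) * (1 - u) \<le> exp u * exp u * (1 - u)"
        using u u0 by (intro mult_right_mono mult_mono exp_ge_add_one_self) auto
      ultimately have "1 \<le> exp u * exp u * (1 - u)" by linarith
      also have "exp u * exp u = 1 / exp (- (2 * u))"
        by (simp add: exp_minus mult_exp_exp inverse_eq_divide)
      finally show ?thesis by (simp add: le_divide_eq)
    qed
    then have "exp (- (2 * u)) *\<^sub>R X k \<preceq> wgeo_mean m n A (X k)"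
      using pos_scale_le[OF Xpos] T_low[OF km(2)] qle_trans unfolding u_def by blast
    then have "X k \<preceq> exp (2 * u) *\<^sub>R wgeo_mean m n A (X k)" by (simp only: qle_exp_minus)
    from wgeo_mean_compare[OF self self Xpos Xpos _ order_refl this fix_up[of m]] u0
    have "X k \<preceq> exp (2 ^ m * (2 * u + ?t m / 2 ^ m)) *\<^sub>R X m" by simp
    moreover have "2 ^ m * (2 * u + ?t m / 2 ^ m) \<le> K * ?t k"
      using tm by (simp add: u_def K_def algebra_simps add_divide_distrib)
    ultimately show "X k \<preceq> exp (K * ?t k) *\<^sub>R X m" using pos_exp_le[OF Xpos] qle_trans by blast
    have "wgeo_mean m n A (X k) \<preceq> exp (?t m * (2 * ?t k)) *\<^sub>R X k"
      using T_up[OF km(2)] pos_scale_le[OF Xpos exp_ge_add_one_self] qle_trans by blast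
    from wgeo_mean_compare[OF self self Xpos Xpos _ order_refl fix_low[of m] this]
    have "X m \<preceq> exp (2 ^ m * (?t m / 2 ^ m + ?t m * (2 * ?t k))) *\<^sub>R X k" by simp
    moreover have "2 ^ m * (?t m / 2 ^ m + ?t m * (2 * ?t k)) \<le> K * ?t k"
    proof -
      have "2 ^ m * (?t m / 2 ^ m + ?t m * (2 * ?t k)) \<le> 3 * ?t k"
        using tm by (simp add: algebra_simps)
      also have "\<dots> \<le> K * ?t k" using C t[of k] by (intro mult_right_mono) (auto simp: K_def c_def)
      finally show ?thesis .
    qed
    ultimately show "X m \<preceq> exp (K * ?t k) *\<^sub>R X k" using pos_exp_le[OF Xpos] qle_trans by blast
  qed
  have X_norm: "norm (X k) \<le> exp p" for k
    using box Xpos by (intro psd_norm_le pos_psd) auto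
  have "Cauchy X"
  proof (rule CauchyI')
    fix e :: real assume e: "0 < e"
    have "(\<lambda>k. (exp (K / 2 ^ k) - 1) * exp p) \<longlonglongrightarrow> (exp 0 - 1) * exp p"
      by (intro tendsto_intros tendsto_divide_pow2)
    from order_tendstoD(2)[OF this, of e] e
    have "\<forall>\<^sub>F k in sequentially. (exp (K / 2 ^ k) - 1) * exp p < e" by simp
    then obtain k1 where k1: "\<And>k. k1 \<le> k \<Longrightarrow> (exp (K / 2 ^ k) - 1) * exp p < e"
      by (auto simp: eventually_sequentially)
    have "dist (X k) (X m) < e" if "max k0 k1 \<le> k" "k < m" for k m
    proof -
      have "norm (X k - X m) \<le> (exp (K * ?t k) - 1) * norm (X m)"
        using compare[of k m] that K by (intro norm_diff_exp_le Xpos) auto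
      also have "\<dots> \<le> (exp (K * ?t k) - 1) * exp p"
        using K t[of k] by (intro mult_left_mono X_norm) auto
      also have "\<dots> < e" using k1[of k] that by simp
      finally show ?thesis by (simp add: dist_norm)
    qed
    then show "\<exists>M. \<forall>m\<ge>M. \<forall>n>m. dist (X m) (X n) < e" by blast
  qed
  then obtain L where L: "X \<longlonglongrightarrow> L" using Cauchy_convergent convergent_def by blast
  have L_low: "exp (- p) *\<^sub>R id_blinfun \<preceq> L"
    using qle_limit[OF tendsto_const L always_eventually] box by blast
  have "selfadjoint_op L" using sa_limit[OF pos_sa[OF Xpos] L] .
  then have Lpos: "L \<in> pos_cone" using L_low unfolding pos_cone_iff by (metis exp_gt_zero)
  have near: "X k \<preceq> exp (K * ?t k) *\<^sub>R L" "L \<preceq> exp (K * ?t k) *\<^sub>R X k" if "k0 \<le> k" for k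
  proof -
    have "(\<lambda>m. exp (K * ?t k) *\<^sub>R X m) \<longlonglongrightarrow> exp (K * ?t k) *\<^sub>R L" using L by (intro tendsto_intros)
    then show "X k \<preceq> exp (K * ?t k) *\<^sub>R L"
      by (rule qle_limit[OF tendsto_const]) (use compare that in \<open>auto simp: eventually_sequentially\<close>)
    show "L \<preceq> exp (K * ?t k) *\<^sub>R X k"
      by (rule qle_limit[OF L tendsto_const]) (use compare that in \<open>auto simp: eventually_sequentially\<close>)
  qed
  have t0: "?t \<longlonglongrightarrow> 0" by (rule tendsto_divide_pow2)
  \<comment> \<open>Order bounds replace continuity of the averaged map: \<open>X k\<close> is below
    its image up to \<open>T_low'\<close>, and that image is compared with the image of
    \<open>L\<close> by \<open>near\<close> and monotonicity.\<close>
  have "L \<preceq> wgeo_mean m n A L" for m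
  proof (rule qle_limit)
    let ?e = "\<lambda>k. exp ((1 - ?t m) * (K * ?t k))"
    show "(\<lambda>k. (1 - ?t m * (2 * ?t k)) *\<^sub>R X k) \<longlonglongrightarrow> L"
      by (rule tendsto_eq_intros t0 L refl | simp)+
    show "(\<lambda>k. ?e k *\<^sub>R wgeo_mean m n A L) \<longlonglongrightarrow> wgeo_mean m n A L"
      by (rule tendsto_eq_intros t0 refl | simp)+
    show "\<forall>\<^sub>F k in sequentially. (1 - ?t m * (2 * ?t k)) *\<^sub>R X k \<preceq> ?e k *\<^sub>R wgeo_mean m n A L"
      using eventually_ge_at_top[of "max m k0"]
      by eventually_elim (use T_low' wgeo_mean_mono Xpos Lpos near qle_trans in \<open>meson max.boundedE\<close>)
  qed
  moreover have "wgeo_mean m n A L \<preceq> (1 + C / 2 ^ m / 2 ^ m) *\<^sub>R L" for m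
  proof (rule qle_limit)
    let ?e = "\<lambda>k. exp ((1 - ?t m) * (K * ?t k))"
    let ?r = "\<lambda>k. 1 + ?t m * (2 * ?t k + C * ?t m)"
    show "(\<lambda>k. wgeo_mean m n A L) \<longlonglongrightarrow> wgeo_mean m n A L" by (rule tendsto_const)
    show "(\<lambda>k. ?e k *\<^sub>R ?r k *\<^sub>R X k) \<longlonglongrightarrow> (1 + C / 2 ^ m / 2 ^ m) *\<^sub>R L"
      by (rule tendsto_eq_intros t0 L refl | simp)+
    show "\<forall>\<^sub>F k in sequentially. wgeo_mean m n A L \<preceq> ?e k *\<^sub>R ?r k *\<^sub>R X k"
      using eventually_ge_at_top[of "max m k0"]
    proof eventually_elim
      case (elim k)
      have "wgeo_mean m n A L \<preceq> ?e k *\<^sub>R wgeo_mean m n A (X k)"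
        using elim by (intro wgeo_mean_mono Lpos Xpos near) auto
      also have "\<dots> \<preceq> ?e k *\<^sub>R ?r k *\<^sub>R X k" using elim by (intro qle_scaleR T_up') auto
      finally show ?case .
    qed
  qed
  ultimately show ?thesis using karcher_eqI[OF Lpos] Lpos by blast
qed

end

section \<open>The three means: order and continuity\<close>

lemma op_inv_congruence:
  assumes A: "A \<in> pos_cone" and S: "S \<in> pos_cone"
  shows "op_inv (S o\<^sub>L A o\<^sub>L S) = op_inv S o\<^sub>L op_inv A o\<^sub>L op_inv S"
  using assms pos_sa[of "op_inv A"] pos_sa[of "op_inv S"]
  by (intro op_inv_eqI) (auto simp: is_inv_op_def blinfun_eq_iff selfadjoint_iff clinear_ops)

lemma op_inv_exp_antimono:
  assumes "A \<in> pos_cone" "B \<in> pos_cone" "A \<preceq> exp r *\<^sub>R B"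
  shows "op_inv B \<preceq> exp r *\<^sub>R op_inv A"
proof -
  have "op_inv (exp r *\<^sub>R B) = exp (- r) *\<^sub>R op_inv B"
    using op_inv_scaleR[OF assms(2), of "exp r"] by (simp add: exp_minus inverse_eq_divide)
  then have "exp (- r) *\<^sub>R op_inv B \<preceq> op_inv A"
    using op_inv_antimono[OF assms(1) pos_scaleR[OF assms(2)] assms(3)] by simp
  then show ?thesis by (simp add: qle_exp_minus)
qed

context pos_tuple
begin

lemma karcher_mean: "karcher_mean n A \<in> pos_cone" "karcher_eq n A (karcher_mean n A)"
proof -
  have self: "pos_tuple n A" by unfold_locales
  have "\<exists>!X. X \<in> pos_cone \<and> karcher_eq n A X"
    using karcher_exists karcher_eq_unique[OF self] by blast
  from theI'[OF this] show "karcher_mean n A \<in> pos_cone" "karcher_eq n A (karcher_mean n A)"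
    by (simp_all add: karcher_mean_def karcher_eq_def rel_def)
qed

lemma arith_mean_inv_pos: "arith_mean n (\<lambda>j. op_inv (A j)) \<in> pos_cone"
  using pos by (intro arith_mean_pos n) auto

lemma harm_mean_eq: "harm_mean n A = op_inv (arith_mean n (\<lambda>j. op_inv (A j)))"
  by (simp add: harm_mean_def arith_mean_def)

lemma harm_mean_pos: "harm_mean n A \<in> pos_cone"
  unfolding harm_mean_eq by (intro pos_op_inv arith_mean_inv_pos)

text \<open>At \<open>k = 0\<close> the weighted mean returns its second argument, so the lower
  bound for solutions at level 0 is already the claim.\<close>

lemma karcher_le_arith: "karcher_mean n A \<preceq> arith_mean n A"
proof -
  have "arith_mean n (\<lambda>j. wgeo 0 (karcher_mean n A) (A j)) = arith_mean n A"
    using pos karcher_mean(1) by (simp add: arith_mean_def)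
  then show ?thesis
    using karcher_eq_wgeo_mean_lower[OF karcher_mean, of 0] by (simp add: wgeo_mean_def)
qed

text \<open>Conjugating \<open>1 - z\<^sup>-\<^sup>1 \<le> log z\<close> by
  \<open>op_sqrt ?X\<close> and averaging gives \<open>?X - ?X ?M ?X \<le> 0\<close>, as the
  logarithms cancel. Congruence by \<open>op_inv ?X\<close> leaves
  \<open>op_inv ?X \<le> ?M\<close>, to be inverted.\<close>

lemma harm_le_karcher: "harm_mean n A \<preceq> karcher_mean n A"
proof -
  let ?X = "karcher_mean n A" and ?M = "arith_mean n (\<lambda>j. op_inv (A j))"
  have X: "?X \<in> pos_cone" by (rule karcher_mean)
  have "?X - (?X o\<^sub>L op_inv (A j) o\<^sub>L ?X) \<preceq> op_sqrt ?X o\<^sub>L op_log (rel ?X (A j)) o\<^sub>L op_sqrt ?X"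
    if j: "j < n" for j
  proof -
    have "id_blinfun - op_inv (rel ?X (A j)) \<preceq> op_log (rel ?X (A j))"
    proof (rule qle_limit[OF tendsto_const dlog_tendsto_op_log])
      show "rel ?X (A j) \<in> pos_cone" using X pos[OF j] by simp
      then show "\<forall>\<^sub>F k in sequentially. id_blinfun - op_inv (rel ?X (A j)) \<preceq> dlog k (rel ?X (A j))"
        by (intro always_eventually allI dlog_ge_id_minus_inv)
    qed
    from qle_congruence[OF this pos_sa[OF op_sqrt_pos[OF X]]]
    show ?thesis
      using X pos[OF j] op_sqrt_sandwich_id[OF X]
      by (simp add: rel_def op_inv_congruence blinfun_compose_bilinear_simps qle_def blinfun.bilinear_simps
          op_sqrt_square_apply)
  qed
  then have "arith_mean n (\<lambda>j. ?X - (?X o\<^sub>L op_inv (A j) o\<^sub>L ?X)) \<preceq> log_mean n A ?X"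
    unfolding log_mean_def by (rule arith_mean_mono)
  also have "log_mean n A ?X = 0" using karcher_mean(2) karcher_eq_iff[OF X] by simp
  also have "arith_mean n (\<lambda>j. ?X - (?X o\<^sub>L op_inv (A j) o\<^sub>L ?X)) = ?X - (?X o\<^sub>L ?M o\<^sub>L ?X)"
  proof -
    have "arith_mean n (\<lambda>j. ?X o\<^sub>L op_inv (A j) o\<^sub>L ?X) = ?X o\<^sub>L ?M o\<^sub>L ?X"
      by (simp add: arith_mean_def blinfun_compose_bilinear_simps
          bounded_bilinear.sum_left[OF bounded_bilinear_blinfun_compose]
          bounded_bilinear.sum_right[OF bounded_bilinear_blinfun_compose])
    then show ?thesis
      using arith_mean_add[of n "\<lambda>j. ?X - (?X o\<^sub>L op_inv (A j) o\<^sub>L ?X)" "\<lambda>j. ?X o\<^sub>L op_inv (A j) o\<^sub>L ?X"]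
      by (simp add: arith_mean_const[OF n] eq_diff_eq)
  qed
  finally have "?X \<preceq> ?X o\<^sub>L ?M o\<^sub>L ?X"
    by (simp add: qle_def blinfun.bilinear_simps inner_simps)
  from qle_congruence[OF this pos_sa[OF pos_op_inv[OF X]]]
  have "op_inv ?X \<preceq> ?M" using X by (simp add: qle_def)
  then show ?thesis
    unfolding harm_mean_eq using op_inv_antimono[OF pos_op_inv[OF X] arith_mean_inv_pos] X by simp
qed

end

section \<open>Nonexpansiveness and continuity of the means\<close>

lemma arith_mean_exp_mono:
  assumes "\<And>j. j < n \<Longrightarrow> A j \<preceq> exp r *\<^sub>R B j"
  shows "arith_mean n A \<preceq> exp r *\<^sub>R arith_mean n B"
  using arith_mean_mono[OF assms] by (simp add: arith_mean_scaleR)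

lemma harm_mean_exp_mono:
  assumes A: "pos_tuple n A" and B: "pos_tuple n B" and AB: "\<And>j. j < n \<Longrightarrow> A j \<preceq> exp r *\<^sub>R B j"
  shows "harm_mean n A \<preceq> exp r *\<^sub>R harm_mean n B"
proof -
  interpret A: pos_tuple n A by fact
  interpret B: pos_tuple n B by fact
  have "arith_mean n (\<lambda>j. op_inv (B j)) \<preceq> exp r *\<^sub>R arith_mean n (\<lambda>j. op_inv (A j))"
    using A.pos B.pos AB by (intro arith_mean_exp_mono op_inv_exp_antimono)
  then show ?thesis
    unfolding A.harm_mean_eq B.harm_mean_eq
    by (intro op_inv_exp_antimono A.arith_mean_inv_pos B.arith_mean_inv_pos)
qed

lemma karcher_mean_exp_mono:
  assumes A: "pos_tuple n A" and B: "pos_tuple n B" and AB: "\<And>j. j < n \<Longrightarrow> A j \<preceq> exp r *\<^sub>R B j"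
    and r: "0 \<le> r"
  shows "karcher_mean n A \<preceq> exp r *\<^sub>R karcher_mean n B"
  using karcher_eq_mono[OF A B _ _ AB r] pos_tuple.karcher_mean[OF A] pos_tuple.karcher_mean[OF B] by blast

text \<open>Counterpart of \<open>norm_diff_exp_le\<close>: a perturbation of norm below
  \<open>a * u\<close> is at most \<open>u\<close> times \<open>A\<close> as a form, since
  \<open>A\<close> is bounded below by \<open>a\<close>.\<close>

lemma pos_norm_nbhd:
  fixes A :: "'a::chilbert_space \<Rightarrow>\<^sub>L 'a"
  assumes A: "A \<in> pos_cone" and r: "0 < r"
  shows "\<exists>\<epsilon>>0. \<forall>B. norm (B - A) < \<epsilon> \<longrightarrow> B \<preceq> exp r *\<^sub>R A \<and> A \<preceq> exp r *\<^sub>R B"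
proof -
  obtain a where a: "0 < a" "a *\<^sub>R id_blinfun \<preceq> A" using A by (auto simp: pos_cone_iff)
  \<comment> \<open>This \<open>u\<close> serves both sides: \<open>1 - u = exp (- r)\<close> and
    \<open>1 + u \<le> exp r\<close>.\<close>
  define u where "u = 1 - exp (- r)"
  have u: "0 < u" using r by (simp add: u_def)
  have eu: "1 + u \<le> exp r"
    using exp_ge_add_one_self[of r] exp_ge_add_one_self[of "- r"] unfolding u_def by linarith
  have "B \<preceq> exp r *\<^sub>R A \<and> A \<preceq> exp r *\<^sub>R B" if B: "norm (B - A) < a * u" for B
  proof
    have *: "\<bar>inner ((B - A) x) x\<bar> \<le> u * inner (A x) x" for x
    proof -
      have "\<bar>inner ((B - A) x) x\<bar> \<le> norm ((B - A) x) * norm x" by (rule Cauchy_Schwarz_ineq2)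
      also have "\<dots> \<le> norm (B - A) * norm x * norm x" by (intro mult_right_mono norm_blinfun) auto
      also have "\<dots> \<le> a * u * norm x * norm x" using B by (intro mult_right_mono) auto
      also have "\<dots> = u * (a * inner x x)" by (simp flip: power2_norm_eq_inner add: power2_eq_square)
      also have "\<dots> \<le> u * inner (A x) x"
        using qleD[OF a(2), of x] u by (intro mult_left_mono) (auto simp: blinfun.bilinear_simps)
      finally show ?thesis .
    qed
    have "B \<preceq> (1 + u) *\<^sub>R A"
      by (rule qleI) (use * in \<open>auto simp: blinfun.bilinear_simps inner_simps abs_le_iff algebra_simps\<close>)
    then show "B \<preceq> exp r *\<^sub>R A" using pos_scale_le[OF A eu] qle_trans by blast
    have "exp (- r) *\<^sub>R A \<preceq> B"
    proof (rule qleI)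
      fix x
      show "inner ((exp (- r) *\<^sub>R A) x) x \<le> inner (B x) x"
        using *[of x] by (simp add: u_def blinfun.bilinear_simps inner_simps abs_le_iff algebra_simps)
    qed
    then show "A \<preceq> exp r *\<^sub>R B" by (simp add: qle_exp_minus)
  qed
  then show ?thesis using a u by (intro exI[of _ "a * u"]) auto
qed

lemma topspace_pos_top [simp]: "topspace pos_top = pos_cone"
  by (simp add: pos_top_def)

text \<open>A map which is monotone up to factors \<open>e\<^sup>r\<close> is nonexpansive for the Thompson metric.\<close>

lemma continuous_map_exp_mono:
  fixes f :: "(nat \<Rightarrow> ('a::chilbert_space \<Rightarrow>\<^sub>L 'a)) \<Rightarrow> ('a \<Rightarrow>\<^sub>L 'a)"
  assumes n: "1 \<le> n" and f: "\<And>A. pos_tuple n A \<Longrightarrow> f A \<in> pos_cone"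
    and mono: "\<And>A B r. pos_tuple n A \<Longrightarrow> pos_tuple n B \<Longrightarrow> 0 \<le> r \<Longrightarrow>
      (\<And>j. j < n \<Longrightarrow> A j \<preceq> exp r *\<^sub>R B j) \<Longrightarrow> f A \<preceq> exp r *\<^sub>R f B"
  shows "continuous_map (product_topology (\<lambda>_. pos_top) {..<n}) pos_top f"
proof -
  let ?X = "product_topology (\<lambda>_. pos_top :: ('a \<Rightarrow>\<^sub>L 'a) topology) {..<n}"
  have tup: "A \<in> topspace ?X \<Longrightarrow> pos_tuple n A" for A
    using n by (auto simp: pos_tuple_def)
  have "openin ?X {A \<in> topspace ?X. f A \<in> U}" if "openin pos_top U" for U
  proof (subst openin_subopen, safe)
    fix A assume A: "A \<in> topspace ?X" "f A \<in> U"
    have "\<exists>V. open V \<and> U = pos_cone \<inter> V" using that by (simp add: pos_top_def openin_open)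
    then obtain V where V: "open V" "U = pos_cone \<inter> V" by (elim exE conjE)
    have "f A \<in> V" using A(2) V(2) by simp
    then obtain e where e: "0 < e" "ball (f A) e \<subseteq> V" using V(1) open_contains_ball by metis
    obtain r where r: "0 < r" "(exp r - 1) * norm (f A) < e"
    proof -
      have "(\<lambda>k. (exp (1 / 2 ^ k) - 1) * norm (f A)) \<longlonglongrightarrow> (exp 0 - 1) * norm (f A)"
        by (intro tendsto_intros tendsto_divide_pow2)
      from order_tendstoD(2)[OF this, of e] e(1)
      obtain k where "(exp (1 / 2 ^ k) - 1) * norm (f A) < e"
        by (auto simp: eventually_sequentially)
      then show thesis by (intro that[of "1 / 2 ^ k"]) auto
    qed
    have "\<forall>j\<in>{..<n}. \<exists>\<epsilon>>0. \<forall>B. norm (B - A j) < \<epsilon> \<longrightarrow> B \<preceq> exp r *\<^sub>R A j \<and> A j \<preceq> exp r *\<^sub>R B"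
      using pos_norm_nbhd[OF _ r(1)] pos_tuple.pos[OF tup[OF A(1)]] by blast
    then obtain \<epsilon> where \<epsilon>: "\<And>j. j < n \<Longrightarrow> 0 < \<epsilon> j"
      "\<And>j B. j < n \<Longrightarrow> norm (B - A j) < \<epsilon> j \<Longrightarrow> B \<preceq> exp r *\<^sub>R A j \<and> A j \<preceq> exp r *\<^sub>R B"
      by (metis lessThan_iff)
    let ?W = "\<Pi>\<^sub>E j\<in>{..<n}. pos_cone \<inter> ball (A j) (\<epsilon> j)"
    have "openin ?X ?W"
      by (subst openin_PiE_gen) (auto simp: pos_top_def)
    moreover have "A \<in> ?W" using A \<epsilon> by (auto simp: PiE_iff)
    moreover have "?W \<subseteq> {A \<in> topspace ?X. f A \<in> U}"
    proof
      fix B assume B: "B \<in> ?W"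
      then have BX: "B \<in> topspace ?X" by (auto simp: PiE_iff)
      have near: "B j \<preceq> exp r *\<^sub>R A j \<and> A j \<preceq> exp r *\<^sub>R B j" if "j < n" for j
        using B that by (intro \<epsilon>(2)) (auto simp: PiE_iff dist_norm norm_minus_commute)
      have "norm (f B - f A) \<le> (exp r - 1) * norm (f A)"
        using near r by (intro norm_diff_exp_le f mono tup A BX) auto
      then have "f B \<in> ball (f A) e" using r by (simp add: dist_norm norm_minus_commute)
      then show "B \<in> {A \<in> topspace ?X. f A \<in> U}"
        using V e BX f[OF tup[OF BX]] by auto
    qed
    ultimately show "\<exists>T. openin ?X T \<and> A \<in> T \<and> T \<subseteq> {A \<in> topspace ?X. f A \<in> U}" by blast
  qed
  moreover have "f \<in> topspace ?X \<rightarrow> topspace pos_top" using f tup by (auto simp del: topspace_product_topology)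
  ultimately show ?thesis by (simp add: continuous_map_def del: topspace_product_topology)
qed

lemma continuous_map_means:
  assumes "1 \<le> n"
  shows "continuous_map (product_topology (\<lambda>_. pos_top) {..<n}) pos_top (arith_mean n)"
    "continuous_map (product_topology (\<lambda>_. pos_top) {..<n}) pos_top (harm_mean n)"
    "continuous_map (product_topology (\<lambda>_. pos_top) {..<n}) pos_top (karcher_mean n)"
proof -
  show "continuous_map (product_topology (\<lambda>_. pos_top) {..<n}) pos_top (arith_mean n)"
    using assms
    by (rule continuous_map_exp_mono)
      (auto intro!: arith_mean_pos arith_mean_exp_mono simp: pos_tuple_def)
  show "continuous_map (product_topology (\<lambda>_. pos_top) {..<n}) pos_top (harm_mean n)"
    using assms
    by (rule continuous_map_exp_mono) (auto intro: pos_tuple.harm_mean_pos harm_mean_exp_mono)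
  show "continuous_map (product_topology (\<lambda>_. pos_top) {..<n}) pos_top (karcher_mean n)"
    using assms
    by (rule continuous_map_exp_mono) (auto intro: pos_tuple.karcher_mean karcher_mean_exp_mono)
qed

section \<open>Tau-additive measures on metric spaces\<close>

lemma openin_subset_Pow: "{U. openin X U} \<subseteq> Pow (topspace X)"
  by (auto dest: openin_subset)

lemma space_borel_of [simp]: "space (borel_of X) = topspace X"
  unfolding borel_of_def by (intro space_measure_of openin_subset_Pow)

lemma sets_borel_of: "sets (borel_of X) = sigma_sets (topspace X) {U. openin X U}"
  unfolding borel_of_def by (intro sets_measure_of openin_subset_Pow)

lemma openin_borel_of: "openin X U \<Longrightarrow> U \<in> sets (borel_of X)"
  by (simp add: sets_borel_of sigma_sets.Basic)

lemma tau_probD: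
  assumes "\<mu> \<in> tau_prob X"
  shows "space \<mu> = topspace X" "sets \<mu> = sets (borel_of X)" "prob_space \<mu>" "tau_additive X \<mu>"
  using assms by (auto simp: tau_prob_def)

lemma tau_additiveD:
  assumes "tau_additive X \<mu>" "\<U> \<noteq> {}" "\<And>U. U \<in> \<U> \<Longrightarrow> openin X U"
    "\<And>U V. U \<in> \<U> \<Longrightarrow> V \<in> \<U> \<Longrightarrow> \<exists>W\<in>\<U>. U \<union> V \<subseteq> W"
  shows "emeasure \<mu> (\<Union>\<U>) = (SUP U\<in>\<U>. emeasure \<mu> U)"
  by (rule assms(1)[unfolded tau_additive_def, THEN spec, THEN mp]) (intro conjI ballI assms(2-4))

lemma supp_eq: "supp X \<mu> = topspace X - \<Union>{U. openin X U \<and> emeasure \<mu> U = 0}"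
  unfolding supp_def by (auto simp: zero_less_iff_neq_zero)

lemma supp_measurable: "sets \<mu> = sets (borel_of X) \<Longrightarrow> supp X \<mu> \<in> sets \<mu>"
  unfolding supp_eq
  by (metis (no_types, lifting) openin_borel_of openin_Union mem_Collect_eq sets.Diff openin_topspace)

text \<open>The open null sets form a directed family under finite unions, so tau-additivity makes
  their union, the complement of the support, null.\<close>

lemma AE_supp:
  assumes \<mu>: "\<mu> \<in> tau_prob X"
  shows "AE x in \<mu>. x \<in> supp X \<mu>"
proof (rule AE_I)
  let ?N = "{U. openin X U \<and> emeasure \<mu> U = 0}"
  note \<mu>' = tau_probD[OF \<mu>]
  show "\<Union>?N \<in> sets \<mu>" unfolding \<mu>'(2) by (intro openin_borel_of openin_Union) auto
  have "emeasure \<mu> (\<Union>?N) = (SUP U\<in>?N. emeasure \<mu> U)"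
  proof (rule tau_additiveD[OF \<mu>'(4)])
    have "{} \<in> ?N" by simp
    then show "?N \<noteq> {}" by blast
    fix U V assume UV: "U \<in> ?N" "V \<in> ?N"
    then have "U \<in> sets \<mu>" "V \<in> sets \<mu>" unfolding \<mu>'(2) by (auto intro: openin_borel_of)
    then have "emeasure \<mu> (U \<union> V) \<le> emeasure \<mu> U + emeasure \<mu> V" by (rule emeasure_subadditive)
    then show "\<exists>W\<in>?N. U \<union> V \<subseteq> W" using UV by (intro bexI[of _ "U \<union> V"]) auto
  qed auto
  also have "\<dots> = 0" by (intro antisym SUP_least) auto
  finally show "emeasure \<mu> (\<Union>?N) = 0" .
  show "{x \<in> space \<mu>. x \<notin> supp X \<mu>} \<subseteq> \<Union>?N" unfolding \<mu>'(1) supp_eq by blast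
qed

text \<open>Finite unions of balls of radius \<open>r\<close> are directed and exhaust
  \<open>P\<close>, so by tau-additivity countably many such balls have full measure. Every
  neighbourhood of a support point has positive measure and must meet them; letting \<open>r\<close>
  run through \<open>1 / Suc m\<close> makes the centres dense.\<close>

lemma supp_separable:
  fixes P :: "'b::metric_space set"
  assumes \<mu>: "\<mu> \<in> tau_prob (top_of_set P)"
  shows "\<exists>D. countable D \<and> supp (top_of_set P) \<mu> \<subseteq> closure D"
proof -
  note \<mu>' = tau_probD[OF \<mu>]
  interpret prob_space \<mu> by (rule \<mu>')
  have spc: "space \<mu> = P" using \<mu>'(1) by simp
  have open_sets: "U \<in> sets \<mu>" if "openin (top_of_set P) U" for U
    unfolding \<mu>'(2) using that by (rule openin_borel_of)
  define V where "V r F = P \<inter> (\<Union>x\<in>F. ball x r)" for r :: real and F :: "'b set"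
  have V_open: "openin (top_of_set P) (V r F)" for r F
    unfolding V_def by (intro openin_open_Int) auto
  have "\<exists>F. countable F \<and> emeasure \<mu> (V r F) = 1" if r: "0 < r" for r
  proof -
    let ?\<U> = "V r ` {F. finite F}"
    have "emeasure \<mu> (\<Union>?\<U>) = (SUP U\<in>?\<U>. emeasure \<mu> U)"
    proof (rule tau_additiveD[OF \<mu>'(4)])
      show "\<exists>W\<in>?\<U>. U \<union> U' \<subseteq> W" if "U \<in> ?\<U>" "U' \<in> ?\<U>" for U U'
      proof -
        from that obtain F F' where "finite F" "finite F'" "U = V r F" "U' = V r F'" by blast
        then show ?thesis by (intro bexI[of _ "V r (F \<union> F')"] imageI) (auto simp: V_def)
      qed
    qed (use V_open in auto)
    moreover have "\<Union>?\<U> = P"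
    proof
      show "P \<subseteq> \<Union>?\<U>"
      proof
        fix x assume "x \<in> P"
        then have "x \<in> V r {x}" using r by (simp add: V_def)
        then show "x \<in> \<Union>?\<U>" by blast
      qed
    qed (auto simp: V_def)
    ultimately have "(SUP U\<in>?\<U>. emeasure \<mu> U) = 1" using emeasure_space_1 spc by simp
    moreover have "emeasure \<mu> ` ?\<U> \<noteq> {}" by blast
    \<comment> \<open>A supremum in \<open>ennreal\<close> is attained along a sequence, which
      passes from the directed family to countably many finite sets of centres.\<close>
    ultimately obtain f where f: "range f \<subseteq> emeasure \<mu> ` ?\<U>" "(SUP i::nat. f i) = 1"
      using ennreal_Sup_countable_SUP[of "emeasure \<mu> ` ?\<U>"] by metis
    then have "\<forall>i. \<exists>F. finite F \<and> f i = emeasure \<mu> (V r F)" by blast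
    then obtain F where F: "\<And>i. finite (F i)" "\<And>i. f i = emeasure \<mu> (V r (F i))" by metis
    have "1 \<le> emeasure \<mu> (V r (\<Union>i. F i))"
      unfolding f(2)[symmetric] F(2)
      by (intro SUP_least emeasure_mono open_sets V_open) (auto simp: V_def)
    moreover have "emeasure \<mu> (V r (\<Union>i. F i)) \<le> 1" by (simp add: emeasure_eq_measure)
    ultimately have "emeasure \<mu> (V r (\<Union>i. F i)) = 1" by (rule antisym[rotated])
    moreover have "countable (\<Union>i. F i)" using F(1) by (auto intro: countable_finite)
    ultimately show ?thesis by blast
  qed
  then obtain F where F: "\<And>r. 0 < r \<Longrightarrow> countable (F r)" "\<And>r. 0 < r \<Longrightarrow> emeasure \<mu> (V r (F r)) = 1" by metis
  define D where "D = (\<Union>m::nat. F (1 / Suc m))"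
  have "countable D" unfolding D_def using F(1) by auto
  moreover have "x \<in> closure D" if x: "x \<in> supp (top_of_set P) \<mu>" for x
    unfolding closure_approachable
  proof (intro allI impI)
    fix e :: real assume e: "0 < e"
    then obtain m where m: "1 / Suc m < e / 2" using nat_approx_posE[of "e / 2"] by auto
    let ?r = "1 / Suc m" and ?B = "P \<inter> ball x (e / 2)"
    have B: "openin (top_of_set P) ?B" by (intro openin_open_Int) auto
    then have pos: "emeasure \<mu> ?B > 0" using x e by (auto simp: supp_def)
    have "?B \<inter> V ?r (F ?r) \<noteq> {}"
    proof
      assume "?B \<inter> V ?r (F ?r) = {}"
      then have "emeasure \<mu> (?B \<union> V ?r (F ?r)) = emeasure \<mu> ?B + emeasure \<mu> (V ?r (F ?r))"
        using B V_open open_sets by (intro plus_emeasure[symmetric]) auto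
      then have "prob (?B \<union> V ?r (F ?r)) = prob ?B + 1"
        using F(2)[of ?r] B V_open open_sets by (simp add: emeasure_eq_measure flip: ennreal_plus ennreal_1)
      moreover have "0 < prob ?B" using pos by (simp add: emeasure_eq_measure)
      ultimately show False using prob_le_1[of "?B \<union> V ?r (F ?r)"] by linarith
    qed
    then obtain y d where "d \<in> F ?r" "dist x y < e / 2" "dist d y < ?r"
      by (auto simp: V_def)
    then have "d \<in> D" "dist d x < e"
      using m dist_triangle[of d x y] by (auto simp: D_def dist_commute)
    then show "\<exists>y\<in>D. dist y x < e" by blast
  qed
  ultimately show ?thesis by blast
qed

text \<open>Balls around a countable dense set with rational radii. The base property is claimed at
  support points only, because \<open>P\<close> itself may be nonseparable.\<close>

lemma supp_countable_base:
  fixes P :: "'b::metric_space set"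
  assumes \<mu>: "\<mu> \<in> tau_prob (top_of_set P)"
  shows "\<exists>\<C>. countable \<C> \<and> (\<forall>C\<in>\<C>. openin (top_of_set P) C) \<and>
    (\<forall>U. openin (top_of_set P) U \<longrightarrow> U \<inter> supp (top_of_set P) \<mu> \<subseteq> \<Union>{C\<in>\<C>. C \<subseteq> U})"
proof -
  obtain D where D: "countable D" "supp (top_of_set P) \<mu> \<subseteq> closure D" using supp_separable[OF \<mu>] by blast
  let ?\<C> = "(\<lambda>(d, q). P \<inter> ball d q) ` (D \<times> \<rat>)"
  have base: "U \<inter> supp (top_of_set P) \<mu> \<subseteq> \<Union>{C\<in>?\<C>. C \<subseteq> U}" if U: "openin (top_of_set P) U" for U
  proof
    fix x assume "x \<in> U \<inter> supp (top_of_set P) \<mu>"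
    then have xU: "x \<in> U" and x: "x \<in> supp (top_of_set P) \<mu>" by auto
    obtain e where e: "0 < e" "ball x e \<inter> P \<subseteq> U"
      using U xU unfolding openin_contains_ball by blast
    obtain d where d: "d \<in> D" "dist d x < e / 2"
      using x D(2) e(1) closure_approachable[of x D] by (meson half_gt_zero subsetD)
    obtain q where q: "q \<in> \<rat>" "dist d x < q" "q < e / 2" using Rats_dense_in_real[OF d(2)] by blast
    have "P \<inter> ball d q \<subseteq> U"
    proof
      fix y assume y: "y \<in> P \<inter> ball d q"
      then have "dist x y < e" using dist_triangle[of x y d] d q by (simp add: dist_commute)
      then show "y \<in> U" using e y by auto
    qed
    moreover have "x \<in> P \<inter> ball d q" using xU q openin_subset[OF U] by auto
    moreover have "P \<inter> ball d q \<in> ?\<C>" using d q by (intro image_eqI[of _ _ "(d, q)"]) auto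
    ultimately show "x \<in> \<Union>{C\<in>?\<C>. C \<subseteq> U}" by (intro UnionI[of "P \<inter> ball d q"] CollectI conjI)
  qed
  have "countable ?\<C>" using D countable_rat by blast
  moreover have "\<forall>C\<in>?\<C>. openin (top_of_set P) C" by (auto intro: openin_open_Int)
  ultimately show ?thesis using base by (intro exI[of _ ?\<C>] conjI allI impI)
qed

section \<open>The product measure and its tau-additivity\<close>

locale tau_family =
  fixes P :: "'b::metric_space set" and n :: nat and \<mu> :: "nat \<Rightarrow> 'b measure"
  assumes tau: "\<And>i. i < n \<Longrightarrow> \<mu> i \<in> tau_prob (top_of_set P)"
begin

abbreviation "X \<equiv> top_of_set P"
abbreviation "XX \<equiv> product_topology (\<lambda>_. X) {..<n}"
abbreviation "M \<equiv> PiM {..<n} \<mu>"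
abbreviation "S \<equiv> \<Pi>\<^sub>E i\<in>{..<n}. supp X (\<mu> i)"

lemma space_M: "space M = topspace XX"
  using tau_probD(1)[OF tau] by (auto simp: space_PiM intro!: PiE_cong)

lemma S_sets: "S \<in> sets M"
  using tau_probD(2)[OF tau] by (intro sets_PiM_I_finite) (auto intro!: supp_measurable)

lemma AE_S: "AE x in M. x \<in> S"
proof -
  have "AE x in M. \<forall>i\<in>{..<n}. x i \<in> supp X (\<mu> i)"
    by (rule AE_finite_allI) (auto intro!: AE_PiM_component AE_supp tau_probD(3) tau)
  moreover have "AE x in M. x \<in> space M" by simp
  ultimately show ?thesis by eventually_elim (auto simp: space_PiM PiE_iff)
qed

text \<open>Rectangles over the coordinate bases: there are countably many, they lie in the product
  sigma-algebra, and they form a base at the points of \<open>S\<close>.\<close>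

lemma product_base:
  obtains \<B> where "countable \<B>" "\<B> \<subseteq> sets M"
    "\<forall>W. openin XX W \<longrightarrow> W \<inter> S \<subseteq> \<Union>{B\<in>\<B>. B \<subseteq> W}"
proof -
  have "\<forall>i\<in>{..<n}. \<exists>\<C>. countable \<C> \<and> (\<forall>C\<in>\<C>. openin X C) \<and>
    (\<forall>U. openin X U \<longrightarrow> U \<inter> supp X (\<mu> i) \<subseteq> \<Union>{C\<in>\<C>. C \<subseteq> U})"
    by (intro ballI supp_countable_base tau) simp
  from bchoice[OF this] obtain \<C> where h: "\<forall>i\<in>{..<n}. countable (\<C> i) \<and> (\<forall>C\<in>\<C> i. openin X C) \<and>
    (\<forall>U. openin X U \<longrightarrow> U \<inter> supp X (\<mu> i) \<subseteq> \<Union>{C\<in>\<C> i. C \<subseteq> U})" ..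
  then have \<C>: "countable (\<C> i)" "\<And>C. C \<in> \<C> i \<Longrightarrow> openin X C"
    "\<And>U. openin X U \<Longrightarrow> U \<inter> supp X (\<mu> i) \<subseteq> \<Union>{C\<in>\<C> i. C \<subseteq> U}" if "i < n" for i
    using that by simp_all
  let ?\<B> = "PiE {..<n} ` PiE {..<n} \<C>"
  have c1: "countable ?\<B>" using \<C>(1) by (intro countable_image countable_PiE) auto
  have c2: "?\<B> \<subseteq> sets M"
  proof
    fix B assume "B \<in> ?\<B>"
    then obtain C where C: "C \<in> PiE {..<n} \<C>" "B = PiE {..<n} C" by blast
    then have "C i \<in> sets (\<mu> i)" if "i < n" for i
      unfolding tau_probD(2)[OF tau[OF that]] using that by (intro openin_borel_of \<C>(2)) (auto simp: PiE_iff)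
    then show "B \<in> sets M" unfolding C by (intro sets_PiM_I_finite) auto
  qed
  have c3: "\<exists>B\<in>?\<B>. x \<in> B \<and> B \<subseteq> W" if W: "openin XX W" "x \<in> W" and x: "x \<in> S" for W x
  proof -
    obtain U where U: "\<And>i. i < n \<Longrightarrow> openin X (U i)" "x \<in> PiE {..<n} U" "PiE {..<n} U \<subseteq> W"
      using W unfolding openin_product_topology_alt by (metis lessThan_iff)
    have "\<exists>C. C \<in> \<C> i \<and> x i \<in> C \<and> C \<subseteq> U i" if "i < n" for i
    proof -
      have "x i \<in> U i \<inter> supp X (\<mu> i)" using U(2) x that by (auto simp: PiE_iff)
      then show ?thesis using \<C>(3)[OF that U(1)[OF that]] by blast
    qed
    then have "\<forall>i\<in>{..<n}. \<exists>C. C \<in> \<C> i \<and> x i \<in> C \<and> C \<subseteq> U i" by blast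
    from bchoice[OF this] obtain C where "\<forall>i\<in>{..<n}. C i \<in> \<C> i \<and> x i \<in> C i \<and> C i \<subseteq> U i" ..
    then have C: "C i \<in> \<C> i \<and> x i \<in> C i \<and> C i \<subseteq> U i" if "i < n" for i using that by simp
    let ?C = "restrict C {..<n}"
    have "PiE {..<n} ?C \<in> ?\<B>" using C by (intro imageI) auto
    moreover have "x \<in> PiE {..<n} ?C" using C U(2) by (auto simp: PiE_iff)
    moreover have "PiE {..<n} ?C \<subseteq> W" using C by (intro order_trans[OF PiE_mono U(3)]) auto
    ultimately show ?thesis by blast
  qed
  have "\<forall>W. openin XX W \<longrightarrow> W \<inter> S \<subseteq> \<Union>{B\<in>?\<B>. B \<subseteq> W}"
  proof (intro allI impI subsetI)
    fix W x assume "openin XX W" "x \<in> W \<inter> S"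
    then have "\<exists>B\<in>?\<B>. x \<in> B \<and> B \<subseteq> W" by (intro c3) auto
    then obtain B where "B \<in> ?\<B>" "x \<in> B" "B \<subseteq> W" by (elim bexE conjE)
    then show "x \<in> \<Union>{B\<in>?\<B>. B \<subseteq> W}" by (intro UnionI CollectI conjI)
  qed
  then show thesis by (rule that[OF c1 c2])
qed

text \<open>Lindeloef property of \<open>S\<close>: for each base rectangle inside some member of
  the family, one such member is chosen.\<close>

lemma Union_trace_countable:
  assumes "\<And>W. W \<in> \<W> \<Longrightarrow> openin XX W"
  shows "\<exists>\<V>. countable \<V> \<and> \<V> \<subseteq> \<W> \<and> \<Union>\<W> \<inter> S = \<Union>\<V> \<inter> S"
proof -
  obtain \<B> where \<B>: "countable \<B>" "\<B> \<subseteq> sets M"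
    "\<forall>W. openin XX W \<longrightarrow> W \<inter> S \<subseteq> \<Union>{B\<in>\<B>. B \<subseteq> W}"
    by (rule product_base)
  let ?\<B> = "{B\<in>\<B>. \<exists>W\<in>\<W>. B \<subseteq> W}"
  have "\<forall>B\<in>?\<B>. \<exists>W. W \<in> \<W> \<and> B \<subseteq> W" by blast
  from bchoice[OF this] obtain g where g: "\<forall>B\<in>?\<B>. g B \<in> \<W> \<and> B \<subseteq> g B" ..
  have "\<Union>\<W> \<inter> S \<subseteq> \<Union>(g ` ?\<B>)"
  proof
    fix x assume "x \<in> \<Union>\<W> \<inter> S"
    then obtain W where W: "W \<in> \<W>" "x \<in> W" "x \<in> S" by blast
    then have "x \<in> \<Union>{B\<in>\<B>. B \<subseteq> W}" using \<B>(3) assms by blast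
    then obtain B where "B \<in> \<B>" "x \<in> B" "B \<subseteq> W" by blast
    with W g show "x \<in> \<Union>(g ` ?\<B>)" by blast
  qed
  moreover have "g ` ?\<B> \<subseteq> \<W>" using g by blast
  ultimately have "\<Union>\<W> \<inter> S = \<Union>(g ` ?\<B>) \<inter> S" by blast
  moreover have "countable (g ` ?\<B>)" using \<B>(1) by simp
  ultimately show ?thesis using \<open>g ` ?\<B> \<subseteq> \<W>\<close> by (intro exI[of _ "g ` ?\<B>"] conjI)
qed

lemma trace_open: "openin XX W \<Longrightarrow> W \<inter> S \<in> sets M"
proof -
  assume W: "openin XX W"
  obtain \<B> where \<B>: "countable \<B>" "\<B> \<subseteq> sets M"
    "\<forall>W. openin XX W \<longrightarrow> W \<inter> S \<subseteq> \<Union>{B\<in>\<B>. B \<subseteq> W}"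
    by (rule product_base)
  have "W \<inter> S = \<Union>{B\<in>\<B>. B \<subseteq> W} \<inter> S" using \<B>(3)[rule_format, OF W] by blast
  also have "\<dots> \<in> sets M" using \<B>(1,2) S_sets by (intro sets.Int sets.countable_Union) auto
  finally show ?thesis .
qed

text \<open>This puts the arguments \<open>B \<inter> S\<close> in \<open>tau_product\<close> within
  the domain of the product measure; complements are taken inside \<open>S\<close>.\<close>

lemma trace_sets:
  assumes "B \<in> sets (borel_of XX)"
  shows "B \<inter> S \<in> sets M"
  using assms unfolding sets_borel_of
proof (induction rule: sigma_sets.induct)
  case (Compl B)
  have "S \<subseteq> topspace XX" using sets.sets_into_space[OF S_sets] space_M by simp
  then have "(topspace XX - B) \<inter> S = S - B \<inter> S" by blast
  then show ?case using Compl S_sets by (simp only: sets.Diff)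
next
  case (Union B)
  have "(\<Union>i. B i) \<inter> S = (\<Union>i. B i \<inter> S)" by blast
  also have "\<dots> \<in> sets M" using Union.IH by (intro sets.countable_nat_UN) blast
  finally show ?case .
qed (auto intro: trace_open)

lemma tau_product_eq:
  "tau_product X n \<mu> = measure_of (topspace XX) {U. openin XX U} (\<lambda>B. emeasure M (B \<inter> S))"
  by (simp add: tau_product_def)

lemma space_tau_product: "space (tau_product X n \<mu>) = topspace XX"
  unfolding tau_product_eq by (intro space_measure_of openin_subset_Pow)

lemma sets_tau_product: "sets (tau_product X n \<mu>) = sets (borel_of XX)"
  unfolding tau_product_eq sets_borel_of by (intro sets_measure_of openin_subset_Pow)

text \<open>\<open>measure_of\<close> adopts a set function only if it is positive and countably
  additive on the generated sigma-algebra; here additivity is inherited from \<open>M\<close>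
  through the traces.\<close>

lemma emeasure_tau_product:
  assumes B: "B \<in> sets (borel_of XX)"
  shows "emeasure (tau_product X n \<mu>) B = emeasure M (B \<inter> S)"
proof (rule emeasure_measure_of[OF tau_product_eq])
  show "{U. openin XX U} \<subseteq> Pow (topspace XX)" by (rule openin_subset_Pow)
  show "B \<in> sets (tau_product X n \<mu>)" using B by (simp add: sets_tau_product)
  show "positive (sets (tau_product X n \<mu>)) (\<lambda>B. emeasure M (B \<inter> S))" by (simp add: positive_def)
  show "countably_additive (sets (tau_product X n \<mu>)) (\<lambda>B. emeasure M (B \<inter> S))"
  proof (rule countably_additiveI)
    fix A :: "nat \<Rightarrow> _"
    assume A: "range A \<subseteq> sets (tau_product X n \<mu>)" "disjoint_family A"
    have "(\<Sum>i. emeasure M (A i \<inter> S)) = emeasure M (\<Union>i. A i \<inter> S)"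
      using A by (intro suminf_emeasure) (auto simp: sets_tau_product disjoint_family_on_def intro!: trace_sets)
    then show "(\<Sum>i. emeasure M (A i \<inter> S)) = emeasure M ((\<Union>i. A i) \<inter> S)" by simp
  qed
qed

lemma prob_space_tau_product: "prob_space (tau_product X n \<mu>)"
proof
  interpret M: prob_space M using tau_probD(3)[OF tau] by (intro prob_space_PiM) auto
  have "emeasure M (topspace XX \<inter> S) = emeasure M (space M)"
    unfolding space_M[symmetric] using S_sets AE_S by (intro emeasure_eq_AE) auto
  then show "emeasure (tau_product X n \<mu>) (space (tau_product X n \<mu>)) = 1"
    using M.emeasure_space_1
    by (simp add: space_tau_product emeasure_tau_product openin_borel_of del: topspace_product_topology)
qed

lemma tau_additive_tau_product: "tau_additive XX (tau_product X n \<mu>)"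
  unfolding tau_additive_def
proof (intro allI impI, elim conjE)
  fix \<W> assume ne: "\<W> \<noteq> {}" and op: "\<forall>U\<in>\<W>. openin XX U"
    and dir: "\<forall>U\<in>\<W>. \<forall>V\<in>\<W>. \<exists>W\<in>\<W>. U \<union> V \<subseteq> W"
  let ?T = "tau_product X n \<mu>"
  have T: "W \<in> sets ?T" if "openin XX W" for W using that by (simp add: sets_tau_product openin_borel_of)
  have "\<exists>\<V>. countable \<V> \<and> \<V> \<subseteq> \<W> \<and> \<Union>\<W> \<inter> S = \<Union>\<V> \<inter> S"
    using op by (intro Union_trace_countable) simp
  then obtain \<V>' where \<V>': "countable \<V>'" "\<V>' \<subseteq> \<W>" "\<Union>\<W> \<inter> S = \<Union>\<V>' \<inter> S"
    by (elim exE conjE)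
  obtain W0 where W0: "W0 \<in> \<W>" using ne by blast
  \<comment> \<open>Adding one member makes the countable subfamily nonempty, so that it can be
    enumerated.\<close>
  define \<V> where "\<V> = insert W0 \<V>'"
  have \<V>: "countable \<V>" "\<V> \<subseteq> \<W>" "\<V> \<noteq> {}" using \<V>'(1,2) W0 by (simp_all add: \<V>_def)
  have "\<Union>\<V> \<inter> S = (W0 \<inter> S) \<union> (\<Union>\<W> \<inter> S)"
    unfolding \<V>'(3) \<V>_def by (simp only: Union_insert Int_Un_distrib2)
  also have "\<dots> = \<Union>\<W> \<inter> S" by (intro Un_absorb1 Int_mono Union_upper W0 order_refl)
  finally have trace: "\<Union>\<V> \<inter> S = \<Union>\<W> \<inter> S" .
  define V where "V = from_nat_into \<V>"
  have V: "range V = \<V>" unfolding V_def by (rule range_from_nat_into[OF \<V>(3,1)])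
  let ?U = "\<lambda>m::nat. \<Union>i\<le>m. V i"
  have Uop: "openin XX (?U m)" for m using V \<V>(2) op by (intro openin_Union) auto
  \<comment> \<open>Directedness puts every finite union below a single member, so the increasing
    limit is bounded by the supremum over the family.\<close>
  have ex: "\<exists>W\<in>\<W>. ?U m \<subseteq> W" for m
  proof (induction m)
    case 0
    then show ?case using V \<V>(2) by (intro bexI[of _ "V 0"]) auto
  next
    case (Suc m)
    then obtain W where W: "W \<in> \<W>" "?U m \<subseteq> W" by blast
    have "V (Suc m) \<in> \<W>" using V \<V>(2) by auto
    then obtain W' where "W' \<in> \<W>" "W \<union> V (Suc m) \<subseteq> W'" using dir W by meson
    moreover have "?U (Suc m) = ?U m \<union> V (Suc m)" by (simp add: atMost_Suc Un_commute)
    ultimately show ?case using W(2) by (intro bexI[of _ W']) auto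
  qed
  show "emeasure ?T (\<Union>\<W>) = (SUP U\<in>\<W>. emeasure ?T U)"
  proof (rule antisym)
    have "emeasure ?T (\<Union>\<W>) = emeasure ?T (\<Union>\<V>)"
    proof -
      have "openin XX (\<Union>\<W>)" "openin XX (\<Union>\<V>)" using \<V>(2) op by (auto intro!: openin_Union)
      then show ?thesis by (simp only: emeasure_tau_product openin_borel_of trace)
    qed
    also have "\<Union>\<V> = (\<Union>m. ?U m)" unfolding V[symmetric] by auto
    also have "emeasure ?T (\<Union>m. ?U m) = (SUP m. emeasure ?T (?U m))"
    proof (rule SUP_emeasure_incseq[symmetric])
      show "range ?U \<subseteq> sets ?T" using T[OF Uop] by blast
      show "incseq ?U" unfolding incseq_def by (intro allI impI UN_mono) auto
    qed
    also have "\<dots> \<le> (SUP U\<in>\<W>. emeasure ?T U)"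
    proof (rule SUP_least)
      fix m
      obtain W where "W \<in> \<W>" "?U m \<subseteq> W" using ex by blast
      then show "emeasure ?T (?U m) \<le> (SUP U\<in>\<W>. emeasure ?T U)"
        using op T by (intro SUP_upper2[of W] emeasure_mono) auto
    qed
    finally show "emeasure ?T (\<Union>\<W>) \<le> (SUP U\<in>\<W>. emeasure ?T U)" .
    show "(SUP U\<in>\<W>. emeasure ?T U) \<le> emeasure ?T (\<Union>\<W>)"
      using op by (intro SUP_least emeasure_mono T openin_Union) auto
  qed
qed

section \<open>Push-forwards and the stochastic order\<close>

lemma measurable_continuous_map:
  assumes "continuous_map XX Y f"
  shows "f \<in> measurable (tau_product X n \<mu>) (borel_of Y)"
  unfolding borel_of_def
proof (rule measurable_measure_of)
  show "{U. openin Y U} \<subseteq> Pow (topspace Y)" by (rule openin_subset_Pow)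
  show "f \<in> space (tau_product X n \<mu>) \<rightarrow> topspace Y"
    unfolding space_tau_product using assms by (rule continuous_map_funspace)
  fix U assume "U \<in> {U. openin Y U}"
  then have "openin XX {x \<in> topspace XX. f x \<in> U}"
    using openin_continuous_map_preimage[OF assms] by blast
  moreover have "f -` U \<inter> space (tau_product X n \<mu>) = {x \<in> topspace XX. f x \<in> U}"
    unfolding space_tau_product by blast
  ultimately show "f -` U \<inter> space (tau_product X n \<mu>) \<in> sets (tau_product X n \<mu>)"
    by (simp add: sets_tau_product openin_borel_of)
qed

text \<open>Preimages of a directed family of open sets under a continuous map are again open and
  directed, so tau-additivity passes to the image.\<close>

lemma distr_tau_prob:
  assumes f: "continuous_map XX Y f"
  shows "distr (tau_product X n \<mu>) (borel_of Y) f \<in> tau_prob Y"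
proof -
  let ?T = "tau_product X n \<mu>"
  let ?D = "distr ?T (borel_of Y) f"
  interpret T: prob_space ?T by (rule prob_space_tau_product)
  have m: "f \<in> measurable ?T (borel_of Y)" by (rule measurable_continuous_map[OF f])
  have D: "emeasure ?D U = emeasure ?T {x \<in> topspace XX. f x \<in> U}" if "openin Y U" for U
  proof -
    have "f -` U \<inter> space ?T = {x \<in> topspace XX. f x \<in> U}" unfolding space_tau_product by blast
    then show ?thesis using emeasure_distr[OF m openin_borel_of[OF that]] by simp
  qed
  have "tau_additive Y ?D"
    unfolding tau_additive_def
  proof (intro allI impI, elim conjE)
    fix \<U> assume ne: "\<U> \<noteq> {}" and op: "\<forall>U\<in>\<U>. openin Y U"
      and dir: "\<forall>U\<in>\<U>. \<forall>V\<in>\<U>. \<exists>W\<in>\<U>. U \<union> V \<subseteq> W"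
    let ?g = "\<lambda>U. {x \<in> topspace XX. f x \<in> U}"
    have "emeasure ?D (\<Union>\<U>) = emeasure ?T (?g (\<Union>\<U>))" using op by (intro D openin_Union) auto
    also have "?g (\<Union>\<U>) = \<Union>(?g ` \<U>)" by blast
    also have "emeasure ?T (\<Union>(?g ` \<U>)) = (SUP W\<in>?g ` \<U>. emeasure ?T W)"
    proof (rule tau_additiveD[OF tau_additive_tau_product])
      show "?g ` \<U> \<noteq> {}" using ne by blast
      show "openin XX W" if "W \<in> ?g ` \<U>" for W
        using that op openin_continuous_map_preimage[OF f] by blast
      fix W W' assume "W \<in> ?g ` \<U>" "W' \<in> ?g ` \<U>"
      then obtain U U' where U: "U \<in> \<U>" "U' \<in> \<U>" "W = ?g U" "W' = ?g U'" by blast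
      then obtain U'' where "U'' \<in> \<U>" "U \<union> U' \<subseteq> U''" using dir by meson
      then show "\<exists>W''\<in>?g ` \<U>. W \<union> W' \<subseteq> W''" using U by (intro bexI[of _ "?g U''"]) auto
    qed
    also have "\<dots> = (SUP U\<in>\<U>. emeasure ?T (?g U))" by (simp only: image_image)
    also have "\<dots> = (SUP U\<in>\<U>. emeasure ?D U)" using op D by (intro SUP_cong) auto
    finally show "emeasure ?D (\<Union>\<U>) = (SUP U\<in>\<U>. emeasure ?D U)" .
  qed
  then show ?thesis using T.prob_space_distr[OF m] by (simp add: tau_prob_def)
qed

lemma emeasure_distr_mono:
  assumes f: "continuous_map XX Y f" and g: "continuous_map XX Y g" and U: "openin Y U"
    and sub: "\<And>x. x \<in> topspace XX \<Longrightarrow> f x \<in> U \<Longrightarrow> g x \<in> U"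
  shows "emeasure (distr (tau_product X n \<mu>) (borel_of Y) f) U
    \<le> emeasure (distr (tau_product X n \<mu>) (borel_of Y) g) U"
proof -
  let ?T = "tau_product X n \<mu>"
  note m = measurable_continuous_map[OF f] measurable_continuous_map[OF g]
  have U': "U \<in> sets (borel_of Y)" using U by (rule openin_borel_of)
  have "emeasure ?T (f -` U \<inter> space ?T) \<le> emeasure ?T (g -` U \<inter> space ?T)"
  proof (rule emeasure_mono)
    show "g -` U \<inter> space ?T \<in> sets ?T" using m(2) U' by (rule measurable_sets)
    show "f -` U \<inter> space ?T \<subseteq> g -` U \<inter> space ?T"
      unfolding space_tau_product using sub by blast
  qed
  then show ?thesis using m U' by (simp only: emeasure_distr)
qed

end

lemma stoch_le_pushforward:
  fixes \<mu> :: "nat \<Rightarrow> ('a::chilbert_space \<Rightarrow>\<^sub>L 'a) measure"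
  assumes \<mu>: "\<And>j. j < n \<Longrightarrow> \<mu> j \<in> tau_prob pos_top"
    and f: "continuous_map (product_topology (\<lambda>_. pos_top) {..<n}) pos_top f"
    and g: "continuous_map (product_topology (\<lambda>_. pos_top) {..<n}) pos_top g"
    and le: "\<And>A. (\<And>j. j < n \<Longrightarrow> A j \<in> pos_cone) \<Longrightarrow> f A \<preceq> g A"
  shows "distr (tau_product pos_top n \<mu>) (borel_of pos_top) f
    \<le>\<^sub>s\<^sub>t distr (tau_product pos_top n \<mu>) (borel_of pos_top) g"
proof -
  interpret tau_family "pos_cone :: ('a \<Rightarrow>\<^sub>L 'a) set" n \<mu>
    by unfold_locales (use \<mu> in \<open>simp add: pos_top_def\<close>)
  have "emeasure (distr (tau_product pos_top n \<mu>) (borel_of pos_top) f) U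
      \<le> emeasure (distr (tau_product pos_top n \<mu>) (borel_of pos_top) g) U"
    if U: "openin pos_top U" "upper_set U" for U
  proof (rule emeasure_distr_mono[folded pos_top_def, OF f g U(1)])
    fix A assume A: "A \<in> topspace (product_topology (\<lambda>_. pos_top) {..<n})" and fA: "f A \<in> U"
    have "f A \<in> pos_cone" "g A \<in> pos_cone"
      using A continuous_map_image_subset_topspace[OF f] continuous_map_image_subset_topspace[OF g]
      by (auto simp del: topspace_product_topology)
    moreover have "f A \<preceq> g A" using A by (intro le) auto
    ultimately show "g A \<in> U" using U(2) fA by (auto simp: upper_set_def loewner_iff pos_sa)
  qed
  moreover note distr_tau_prob[folded pos_top_def, OF f] distr_tau_prob[folded pos_top_def, OF g]
  ultimately show ?thesis unfolding stoch_le_def by blast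
qed

theorem theorem7p5:
  fixes \<mu> :: "nat \<Rightarrow> ('a::chilbert_space \<Rightarrow>\<^sub>L 'a) measure"
    and n :: nat
  assumes "n \<ge> 1"
    and "\<And>j. j < n \<Longrightarrow> \<mu> j \<in> tau_prob pos_top"
  shows "harm_measure n \<mu> \<le>\<^sub>s\<^sub>t karcher_measure n \<mu> \<and>
         karcher_measure n \<mu> \<le>\<^sub>s\<^sub>t arith_measure n \<mu>"
  unfolding harm_measure_def karcher_measure_def arith_measure_def
  using assms
  by (intro conjI stoch_le_pushforward continuous_map_means
      pos_tuple.harm_le_karcher pos_tuple.karcher_le_arith pos_tuple.intro)

end
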